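(* Consider the multi-stage unconstrained problem, the hypothetical mirror descent algorithm, the seeds and the stochastic conditional gradients described in the context, with $\beta_t$-biased conditional scenario samplers $\widehat{\boldsymbol\xi}_t$, $t=2,\dots,T$. Assume that $\|\frac{\partial}{\partial x_t}f(x,\xi)\|_*\le \mathsf{Lip}_t$ for all $t$, $x\in\mathcal X$, $\xi\in\Xi$; that $\mathbb E[D_v(\mathbf x^*,\mathbf x^{(0)})]\le \tilde D^2$; and that $\|x-x'\|\le D$ for all $x,x'\in\mathcal X$. Let $b_t=2\beta_{t+1}\mathsf{Lip}_t$ for $t\le T-1$, $b_T=0$, $b^2=\sum_{t=1}^T b_t^2$ and $\tilde L^2=\sum_{t=1}^T\mathsf{Lip}_t^2$. Then with the step sizes $\gamma_l=\frac{\sqrt2\,\tilde D/\tilde L}{\sqrt{L+1}}$ for $l=0,\dots,L$, the output policy $\overline X$ satisfies $$\mathbb E_{\mathrm{int}}[\mathrm{GapU}(\overline X)]\le \frac{\sqrt2\,\tilde D\tilde L}{\sqrt{L+1}}+bD .$$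
   Context: **Problem.** $(\Omega,\mathcal F,\mathbb P)$ is a probability space and $\boldsymbol\xi=(\boldsymbol\xi_1,\dots,\boldsymbol\xi_T)$ with random vectors $\boldsymbol\xi_t:\Omega\to\Xi_t\subset\mathbb R^{k_t}$; $\Xi_1=\{\xi_1\}$ is a singleton. $\Xi_{1:t}=\Xi_1\times\dots\times\Xi_t$, $\Xi=\Xi_{1:T}$, $\mathcal F_t=\sigma(\boldsymbol\xi_{1:t})$. For $S\subset\mathbb R^d$, $\mathcal P_t(S)$ is the set of Borel measurable maps $\Xi_{1:t}\to S$. A policy $X_t\in\mathcal P_t(\mathbb R^{n_t})$ induces the random vector $\mathbf x_t(\omega)=X_t(\boldsymbol\xi_{1:t}(\omega))$; $X=(X_1,\dots,X_T)$, $\mathbf x=(\mathbf x_1,\dots,\mathbf x_T)$. Let $f(x_{1:T},\xi)=f_1(x_1,\xi_1)+\sum_{t=2}^T f_t(x_{t-1},x_t,\xi_t)$. The problem is $\inf\mathbb E[f(\mathbf x,\boldsymbol\xi)]$ over $X_t\in\mathcal P_t(\mathcal X_t)$, $t=1,\dots,T$. Standing assumptions, for each $t$ ($n_0=0$): $f_t(\cdot,\cdot,\xi_t)$ is convex and differentiable in $(x_{t-1},x_t)$ for all $\xi_t\in\Xi_t$; $\mathcal X_t\subset\mathbb R^{n_t}$ is nonempty, compact, convex; $f_t$, $\partial f_t/\partial x_{t-1}$, $\partial f_t/\partial x_t$ are Borel measurable in all variables jointly; and the problem has a solution $X^*$, with induced $\mathbf x^*$. $\mathrm{GapU}(X)=\mathrm{GapU}(\mathbf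 x)=\mathbb E[f(\mathbf x,\boldsymbol\xi)-f(\mathbf x^*,\boldsymbol\xi)]$. $\mathcal X=\prod_t\mathcal X_t$. **Geometry.** A distance generating function (DGF) for a convex compact $\mathcal Q\subset\mathbb R^{d}$ with norm $\|\cdot\|$ is a convex continuous $v:\mathcal Q\to\mathbb R$ such that $\mathcal Q^o=\{x\in\mathcal Q:\exists g\in\mathbb R^d,\ x\in\arg\min_{x'\in\mathcal Q}v(x')+\langle g,x'\rangle\}$ is convex and, restricted to $\mathcal Q^o$, $v$ is continuously differentiable with $\langle x'-x,\nabla v(x')-\nabla v(x)\rangle\ge\|x'-x\|^2$. $D_v(y,x)=v(y)-v(x)-\langle\nabla v(x),y-x\rangle$. Each $\mathbb R^{n_t}$ has the Euclidean inner product and a norm $\|\cdot\|$ (not necessarily induced by it), with dual norm $\|\cdot\|_*$; $v_t$ is a DGF for $\mathcal X_t$. On $\mathbb R^n$, $n=\sum_t n_t$: $\|x_{1:T}\|^2=\sum_t\|x_t\|^2$ and $v(x_{1:T})=\sum_t v_t(x_t)$. It is assumed that $\nabla v_t(X_t)$ is measurable for every $X_t\in\mathcal P_t(\mathcal X_t^o)$, and that the oracles $G_t^{(l)}$ below, for each fixed realization of the seeds, are measurable on $\Xi_{1:t}$. **Conditional scenario sampler.** A measurable $\widehat{\boldsymbol\xi}_t:\Xi_{1:(t-1)}\times[0,1]\to\Xi_t$ is $\beta_t$-biased if for every $\xi_{1:(t-1)}$, with $U\sim\mathrm{Uniform}([0,1])$, the law of $\widehat{\boldsymbol\xi}_t(\xi_{1:(t-1)},U)$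 is within total variation distance $\beta_t$ of the conditional law of $\boldsymbol\xi_t$ given $\boldsymbol\xi_{1:(t-1)}=\xi_{1:(t-1)}$, where $TV(P,Q)=\sup_A|P(A)-Q(A)|$. **Seeds.** On a separate probability space $(\Omega_{\mathrm{int}},\mathcal F_{\mathrm{int}},\mathbb P_{\mathrm{int}})$ with expectation $\mathbb E_{\mathrm{int}}$ (independent of $\Omega$: one works on the product space), $\boldsymbol\zeta_{t,l}$, $1\le t\le T$, $0\le l\le L$, are i.i.d. $\mathrm{Uniform}([0,1])$. **Algorithm.** Given deterministic initial policies $X_t^{(0)}\in\mathcal P_t(\mathcal X_t^o)$, step sizes $\gamma_0,\dots,\gamma_L>0$ and a realization $\zeta=\boldsymbol\zeta(\omega_{\mathrm{int}})$, set for $l=0,1,\dots,L-1$, all $t$ and all $\xi\in\Xi$ $$X_t^{(l+1)}(\xi_{1:t})=\arg\min_{x_t\in\mathcal X_t}\ \langle\gamma_lG_t^{(l)}(\xi_{1:t}),x_t\rangle+D_{v_t}(x_t,X_t^{(l)}(\xi_{1:t})),$$ where the stochastic conditional gradient, for $2\le t\le T-1$, is $$G_t^{(l)}(\xi_{1:t})=\tfrac{\partial f_t}{\partial x_t}\big(X_{t-1}^{(l)}(\xi_{1:(t-1)}),X_t^{(l)}(\xi_{1:t}),\xi_t\big)+\tfrac{\partial f_{t+1}}{\partial x_t}\big(X_t^{(l)}(\xi_{1:t}),X_{t+1}^{(l)}(\xi_{1:t},\hat\xi_{t+1}),\hat\xi_{t+1}\big),\quad \hat\xi_{t+1}=\widehat{\boldsymbol\xi}_{t+1}(\xi_{1:t},\zeta_{t,l});$$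 for $t=1$ the first term is $\frac{\partial f_1}{\partial x_1}(X_1^{(l)}(\xi_1),\xi_1)$; for $t=T$ only the first term is present. The output is $\overline X_t=\sum_{l=0}^L\gamma_lX_t^{(l)}/\sum_{l=0}^L\gamma_l$, which depends on $\omega_{\mathrm{int}}$ through $\zeta$; $\mathrm{GapU}(\overline X)$ is the random variable on $\Omega_{\mathrm{int}}$ sending $\omega_{\mathrm{int}}$ to $\mathrm{GapU}$ of the output policy for $\zeta=\boldsymbol\zeta(\omega_{\mathrm{int}})$. *)

theory Defs
  imports "HOL-Probability.Probability"
begin

text \<open>
  The dimensions \<open>n\<^sub>t\<close> depend on the stage, which a type cannot do. So \<open>\<real>\<^sup>n\<^sup>t\<close> is a coordinate subspace
  \<open>V t\<close> (with \<open>n\<^sub>t = dim (V t)\<close>) of one Euclidean space \<open>'a\<close> of arbitrary dimension. It carries the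
  restricted inner product, topology and Borel sets. The sets \<open>\<Xi> t\<close> are arbitrary subsets of
  one Euclidean space \<open>'b\<close>, likewise large enough to contain every \<open>\<real>\<^sup>k\<^sup>t\<close>.

  Tuples indexed by stages are functions on \<open>nat\<close>. A history in \<open>\<Xi> 1 \<times> \<dots> \<times> \<Xi> t\<close> is an element of
  \<open>PiE {1..t} \<Xi>\<close>. The stage \<open>0\<close> decision space is \<open>{0}\<close> (\<open>n\<^sub>0 = 0\<close>).
\<close>

definition coord_subspace :: "'a::euclidean_space set \<Rightarrow> bool" where
  "coord_subspace V \<longleftrightarrow> (\<exists>B\<subseteq>Basis. V = span B)"


section \<open>Norms\<close>

definition is_norm_on :: "'a::euclidean_space set \<Rightarrow> ('a \<Rightarrow> real) \<Rightarrow> bool" where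
  "is_norm_on V N \<longleftrightarrow>
     (\<forall>x\<in>V. 0 \<le> N x \<and> (N x = 0 \<longleftrightarrow> x = 0)) \<and>
     (\<forall>c. \<forall>x\<in>V. N (c *\<^sub>R x) = \<bar>c\<bar> * N x) \<and>
     (\<forall>x\<in>V. \<forall>y\<in>V. N (x + y) \<le> N x + N y)"

definition dual_norm :: "'a::euclidean_space set \<Rightarrow> ('a \<Rightarrow> real) \<Rightarrow> 'a \<Rightarrow> real" where
  "dual_norm V N g = (SUP x\<in>{x\<in>V. N x \<le> 1}. g \<bullet> x)"

definition total_norm :: "nat \<Rightarrow> (nat \<Rightarrow> 'a \<Rightarrow> real) \<Rightarrow> (nat \<Rightarrow> 'a) \<Rightarrow> real" where
  "total_norm T N x = sqrt (\<Sum>t=1..T. (N t (x t))\<^sup>2)"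


section \<open>Gradients and stage costs\<close>

text \<open>Gradient at \<open>x\<close>, as an element of the subspace \<open>V\<close>, of a function on \<open>V\<close>.\<close>

definition grad_on :: "'a::euclidean_space set \<Rightarrow> ('a \<Rightarrow> real) \<Rightarrow> 'a \<Rightarrow> 'a" where
  "grad_on V F x = (THE g. g \<in> V \<and> (F has_derivative (\<lambda>h. g \<bullet> h)) (at x within V))"

text \<open>\<open>\<partial>f\<^sub>t / \<partial>x\<^sub>t\<^sub>-\<^sub>1\<close> and \<open>\<partial>f\<^sub>t / \<partial>x\<^sub>t\<close> at \<open>(x\<^sub>t\<^sub>-\<^sub>1, x\<^sub>t, \<xi>\<^sub>t) = (x, y, s)\<close>.\<close>

definition grad_prev ::
    "(nat \<Rightarrow> 'a::euclidean_space set) \<Rightarrow> (nat \<Rightarrow> 'a \<Rightarrow> 'a \<Rightarrow> 'b \<Rightarrow> real) \<Rightarrow> nat \<Rightarrow> 'a \<Rightarrow> 'a \<Rightarrow> 'b \<Rightarrow> 'a" where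
  "grad_prev V f t x y s = grad_on (V (t - 1)) (\<lambda>z. f t z y s) x"

definition grad_curr ::
    "(nat \<Rightarrow> 'a::euclidean_space set) \<Rightarrow> (nat \<Rightarrow> 'a \<Rightarrow> 'a \<Rightarrow> 'b \<Rightarrow> real) \<Rightarrow> nat \<Rightarrow> 'a \<Rightarrow> 'a \<Rightarrow> 'b \<Rightarrow> 'a" where
  "grad_curr V f t x y s = grad_on (V t) (\<lambda>z. f t x z s) y"

definition stage_cost ::
    "(nat \<Rightarrow> 'a::euclidean_space set) \<Rightarrow> (nat \<Rightarrow> 'b::euclidean_space set)
      \<Rightarrow> (nat \<Rightarrow> 'a \<Rightarrow> 'a \<Rightarrow> 'b \<Rightarrow> real) \<Rightarrow> nat \<Rightarrow> bool" where
  "stage_cost V \<Xi> f t \<longleftrightarrow>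
     (\<forall>s\<in>\<Xi> t. convex_on (V (t - 1) \<times> V t) (\<lambda>(x, y). f t x y s)) \<and>
     (\<forall>s\<in>\<Xi> t. (\<lambda>(x, y). f t x y s) differentiable_on (V (t - 1) \<times> V t)) \<and>
     (let A = restrict_space borel (V (t - 1)) \<Otimes>\<^sub>M (restrict_space borel (V t) \<Otimes>\<^sub>M restrict_space borel (\<Xi> t))
      in (\<lambda>(x, y, s). f t x y s) \<in> borel_measurable A \<and>
         (\<lambda>(x, y, s). grad_prev V f t x y s) \<in> borel_measurable A \<and>
         (\<lambda>(x, y, s). grad_curr V f t x y s) \<in> borel_measurable A)"

definition total_cost ::
    "nat \<Rightarrow> (nat \<Rightarrow> 'a::zero \<Rightarrow> 'a \<Rightarrow> 'b \<Rightarrow> real) \<Rightarrow> (nat \<Rightarrow> 'a) \<Rightarrow> (nat \<Rightarrow> 'b) \<Rightarrow> real" where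
  "total_cost T f x \<xi> = f 1 0 (x 1) (\<xi> 1) + (\<Sum>t=2..T. f t (x (t - 1)) (x t) (\<xi> t))"

text \<open>\<open>\<partial>f / \<partial>x\<^sub>t\<close> for the total cost \<open>f\<close>.\<close>

definition grad_total ::
    "nat \<Rightarrow> (nat \<Rightarrow> 'a::euclidean_space set) \<Rightarrow> (nat \<Rightarrow> 'a \<Rightarrow> 'a \<Rightarrow> 'b \<Rightarrow> real)
      \<Rightarrow> nat \<Rightarrow> (nat \<Rightarrow> 'a) \<Rightarrow> (nat \<Rightarrow> 'b) \<Rightarrow> 'a" where
  "grad_total T V f t x \<xi> = grad_on (V t) (\<lambda>z. total_cost T f (x(t := z)) \<xi>) (x t)"


section \<open>Policies and the optimization problem\<close>

definition hist_space :: "(nat \<Rightarrow> 'b::euclidean_space set) \<Rightarrow> nat \<Rightarrow> (nat \<Rightarrow> 'b) measure" where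
  "hist_space \<Xi> t = PiM {1..t} (\<lambda>s. restrict_space borel (\<Xi> s))"

definition policies ::
    "(nat \<Rightarrow> 'b::euclidean_space set) \<Rightarrow> nat \<Rightarrow> 'a::euclidean_space set \<Rightarrow> ((nat \<Rightarrow> 'b) \<Rightarrow> 'a) set" where
  "policies \<Xi> t S = measurable (hist_space \<Xi> t) (restrict_space borel S)"

definition hist :: "(nat \<Rightarrow> 'w \<Rightarrow> 'b) \<Rightarrow> nat \<Rightarrow> 'w \<Rightarrow> (nat \<Rightarrow> 'b)" where
  "hist \<xi> t \<omega> = (\<lambda>s\<in>{1..t}. \<xi> s \<omega>)"

definition induced ::
    "(nat \<Rightarrow> 'w \<Rightarrow> 'b) \<Rightarrow> (nat \<Rightarrow> (nat \<Rightarrow> 'b) \<Rightarrow> 'a) \<Rightarrow> 'w \<Rightarrow> nat \<Rightarrow> 'a" where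
  "induced \<xi> X \<omega> t = X t (hist \<xi> t \<omega>)"

definition policy_cost ::
    "nat \<Rightarrow> (nat \<Rightarrow> 'a::zero \<Rightarrow> 'a \<Rightarrow> 'b \<Rightarrow> real) \<Rightarrow> (nat \<Rightarrow> 'w \<Rightarrow> 'b)
      \<Rightarrow> (nat \<Rightarrow> (nat \<Rightarrow> 'b) \<Rightarrow> 'a) \<Rightarrow> 'w \<Rightarrow> real" where
  "policy_cost T f \<xi> X \<omega> = total_cost T f (induced \<xi> X \<omega>) (\<lambda>t. \<xi> t \<omega>)"

definition feasible ::
    "nat \<Rightarrow> (nat \<Rightarrow> 'b::euclidean_space set) \<Rightarrow> (nat \<Rightarrow> 'a::euclidean_space set)
      \<Rightarrow> (nat \<Rightarrow> (nat \<Rightarrow> 'b) \<Rightarrow> 'a) \<Rightarrow> bool" where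
  "feasible T \<Xi> \<X> X \<longleftrightarrow> (\<forall>t\<in>{1..T}. X t \<in> policies \<Xi> t (\<X> t))"

text \<open>
  Integrability is explicit because the Bochner integral of a non-integrable function is \<open>0\<close>.
  Under bounded gradients and bounded feasible sets, two feasible policies have costs differing
  by a bounded random variable, so then all feasible policies have integrable cost.
\<close>

definition is_solution ::
    "'w measure \<Rightarrow> nat \<Rightarrow> (nat \<Rightarrow> 'a::euclidean_space \<Rightarrow> 'a \<Rightarrow> 'b::euclidean_space \<Rightarrow> real)
      \<Rightarrow> (nat \<Rightarrow> 'b set) \<Rightarrow> (nat \<Rightarrow> 'w \<Rightarrow> 'b) \<Rightarrow> (nat \<Rightarrow> 'a set)
      \<Rightarrow> (nat \<Rightarrow> (nat \<Rightarrow> 'b) \<Rightarrow> 'a) \<Rightarrow> bool" where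
  "is_solution M T f \<Xi> \<xi> \<X> Xs \<longleftrightarrow>
     feasible T \<Xi> \<X> Xs \<and> integrable M (policy_cost T f \<xi> Xs) \<and>
     (\<forall>X. feasible T \<Xi> \<X> X \<and> integrable M (policy_cost T f \<xi> X) \<longrightarrow>
        (\<integral>\<omega>. policy_cost T f \<xi> Xs \<omega> \<partial>M) \<le> (\<integral>\<omega>. policy_cost T f \<xi> X \<omega> \<partial>M))"

definition GapU ::
    "'w measure \<Rightarrow> nat \<Rightarrow> (nat \<Rightarrow> 'a::zero \<Rightarrow> 'a \<Rightarrow> 'b \<Rightarrow> real) \<Rightarrow> (nat \<Rightarrow> 'w \<Rightarrow> 'b)
      \<Rightarrow> (nat \<Rightarrow> (nat \<Rightarrow> 'b) \<Rightarrow> 'a) \<Rightarrow> (nat \<Rightarrow> (nat \<Rightarrow> 'b) \<Rightarrow> 'a) \<Rightarrow> real" where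
  "GapU M T f \<xi> Xs X = (\<integral>\<omega>. (policy_cost T f \<xi> X \<omega> - policy_cost T f \<xi> Xs \<omega>) \<partial>M)"


section \<open>Distance generating functions\<close>

definition dgf_dom :: "'a::euclidean_space set \<Rightarrow> 'a set \<Rightarrow> ('a \<Rightarrow> real) \<Rightarrow> 'a set" where
  "dgf_dom V Q v = {x\<in>Q. \<exists>g\<in>V. \<forall>x'\<in>Q. v x + g \<bullet> x \<le> v x' + g \<bullet> x'}"

text \<open>
  The gradient \<open>gv\<close> of \<open>v\<close> restricted to \<open>Q\<^sup>o\<close> is an explicit argument: \<open>Q\<^sup>o\<close> may have empty interior
  (the entropy on a simplex), and then \<open>gv\<close> is determined only up to vectors orthogonal to
  the affine hull of \<open>Q\<close>. The Bregman distance on \<open>Q\<close> and the algorithm do not depend on this choice.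
\<close>

definition is_dgf ::
    "'a::euclidean_space set \<Rightarrow> ('a \<Rightarrow> real) \<Rightarrow> 'a set \<Rightarrow> ('a \<Rightarrow> real) \<Rightarrow> ('a \<Rightarrow> 'a) \<Rightarrow> bool" where
  "is_dgf V N Q v gv \<longleftrightarrow>
     convex_on Q v \<and> continuous_on Q v \<and>
     convex (dgf_dom V Q v) \<and>
     (\<forall>x\<in>dgf_dom V Q v. gv x \<in> V \<and>
        (v has_derivative (\<lambda>h. gv x \<bullet> h)) (at x within dgf_dom V Q v)) \<and>
     continuous_on (dgf_dom V Q v) gv \<and>
     (\<forall>x\<in>dgf_dom V Q v. \<forall>x'\<in>dgf_dom V Q v. (x' - x) \<bullet> (gv x' - gv x) \<ge> (N (x' - x))\<^sup>2)"

definition bregman :: "('a::euclidean_space \<Rightarrow> real) \<Rightarrow> ('a \<Rightarrow> 'a) \<Rightarrow> 'a \<Rightarrow> 'a \<Rightarrow> real" where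
  "bregman v gv y x = v y - v x - gv x \<bullet> (y - x)"

text \<open>\<open>D\<^sub>v\<close> on the product space for \<open>v x = (\<Sum>t. v\<^sub>t x\<^sub>t)\<close>, with \<open>\<nabla>v x = (\<nabla>v\<^sub>t x\<^sub>t)\<^sub>t\<close>.\<close>

definition total_bregman ::
    "nat \<Rightarrow> (nat \<Rightarrow> 'a::euclidean_space \<Rightarrow> real) \<Rightarrow> (nat \<Rightarrow> 'a \<Rightarrow> 'a) \<Rightarrow> (nat \<Rightarrow> 'a) \<Rightarrow> (nat \<Rightarrow> 'a) \<Rightarrow> real" where
  "total_bregman T v gv y x =
     (\<Sum>t=1..T. v t (y t)) - (\<Sum>t=1..T. v t (x t)) - (\<Sum>t=1..T. gv t (x t) \<bullet> (y t - x t))"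


section \<open>Conditional scenario samplers\<close>

definition unif01 :: "real measure" where
  "unif01 = restrict_space lborel {0..1}"

definition TV :: "'b measure \<Rightarrow> 'b measure \<Rightarrow> real" where
  "TV P Q = (SUP A\<in>sets P. \<bar>measure P A - measure Q A\<bar>)"

text \<open>
  \<open>\<kappa>\<close> is a regular version of the conditional law of \<open>\<xi> t\<close> given \<open>\<xi> 1, \<dots>, \<xi> (t - 1)\<close>. Biasedness is
  required at every history, hence refers to such a version and not to an almost-everywhere class.
\<close>

definition cond_law ::
    "'w measure \<Rightarrow> (nat \<Rightarrow> 'b::euclidean_space set) \<Rightarrow> (nat \<Rightarrow> 'w \<Rightarrow> 'b) \<Rightarrow> nat
      \<Rightarrow> ((nat \<Rightarrow> 'b) \<Rightarrow> 'b measure) \<Rightarrow> bool" where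
  "cond_law M \<Xi> \<xi> t \<kappa> \<longleftrightarrow>
     \<kappa> \<in> measurable (hist_space \<Xi> (t - 1)) (prob_algebra (restrict_space borel (\<Xi> t))) \<and>
     (\<forall>A\<in>sets (hist_space \<Xi> (t - 1)). \<forall>C\<in>sets (restrict_space borel (\<Xi> t)).
        measure M {\<omega>\<in>space M. hist \<xi> (t - 1) \<omega> \<in> A \<and> \<xi> t \<omega> \<in> C}
          = (\<integral>\<omega>. indicator A (hist \<xi> (t - 1) \<omega>) * measure (\<kappa> (hist \<xi> (t - 1) \<omega>)) C \<partial>M))"

definition biased_sampler ::
    "(nat \<Rightarrow> 'b::euclidean_space set) \<Rightarrow> nat \<Rightarrow> ((nat \<Rightarrow> 'b) \<Rightarrow> 'b measure)
      \<Rightarrow> real \<Rightarrow> ((nat \<Rightarrow> 'b) \<Rightarrow> real \<Rightarrow> 'b) \<Rightarrow> bool" where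
  "biased_sampler \<Xi> t \<kappa> \<beta> sam \<longleftrightarrow>
     (\<lambda>(h, u). sam h u) \<in> measurable (hist_space \<Xi> (t - 1) \<Otimes>\<^sub>M restrict_space borel {0..1}) (restrict_space borel (\<Xi> t)) \<and>
     (\<forall>h\<in>space (hist_space \<Xi> (t - 1)). TV (distr unif01 (restrict_space borel (\<Xi> t)) (sam h)) (\<kappa> h) \<le> \<beta>)"

definition iid_seeds :: "'i measure \<Rightarrow> nat \<Rightarrow> nat \<Rightarrow> (nat \<Rightarrow> nat \<Rightarrow> 'i \<Rightarrow> real) \<Rightarrow> bool" where
  "iid_seeds Mi T L \<zeta> \<longleftrightarrow>
     prob_space.indep_vars Mi (\<lambda>_. unif01) (\<lambda>(t, l). \<zeta> t l) ({1..T} \<times> {0..L}) \<and>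
     (\<forall>t\<in>{1..T}. \<forall>l\<in>{0..L}. distr Mi unif01 (\<zeta> t l) = unif01)"


section \<open>The algorithm\<close>

text \<open>
  Stochastic conditional gradient of stage \<open>t\<close> at the history \<open>h\<close> for the current policy \<open>X\<close>; \<open>sam t\<close> is the
  sampler of stage \<open>t\<close> and \<open>u\<close> is the seed of stage \<open>t\<close> in the current iteration.
\<close>

definition stoch_grad ::
    "nat \<Rightarrow> (nat \<Rightarrow> 'a::euclidean_space set) \<Rightarrow> (nat \<Rightarrow> 'a \<Rightarrow> 'a \<Rightarrow> 'b \<Rightarrow> real)
      \<Rightarrow> (nat \<Rightarrow> (nat \<Rightarrow> 'b) \<Rightarrow> real \<Rightarrow> 'b) \<Rightarrow> (nat \<Rightarrow> (nat \<Rightarrow> 'b) \<Rightarrow> 'a) \<Rightarrow> real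
      \<Rightarrow> nat \<Rightarrow> (nat \<Rightarrow> 'b) \<Rightarrow> 'a" where
  "stoch_grad T V f sam X u t h =
     grad_curr V f t (if t = 1 then 0 else X (t - 1) (restrict h {1..t - 1})) (X t h) (h t)
     + (if t < T then
          (let s = sam (t + 1) h u
           in grad_prev V f (t + 1) (X t h) (X (t + 1) (h(t + 1 := s))) s)
        else 0)"

text \<open>Iterates \<open>X\<^sup>(\<^sup>l\<^sup>)\<close> for the realization \<open>z t l\<close> of the seeds.\<close>

primrec md_iter ::
    "nat \<Rightarrow> (nat \<Rightarrow> 'a::euclidean_space set) \<Rightarrow> (nat \<Rightarrow> 'a \<Rightarrow> 'a \<Rightarrow> 'b \<Rightarrow> real)
      \<Rightarrow> (nat \<Rightarrow> 'a set) \<Rightarrow> (nat \<Rightarrow> 'a \<Rightarrow> real) \<Rightarrow> (nat \<Rightarrow> 'a \<Rightarrow> 'a)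
      \<Rightarrow> (nat \<Rightarrow> (nat \<Rightarrow> 'b) \<Rightarrow> real \<Rightarrow> 'b) \<Rightarrow> (nat \<Rightarrow> real) \<Rightarrow> (nat \<Rightarrow> (nat \<Rightarrow> 'b) \<Rightarrow> 'a)
      \<Rightarrow> (nat \<Rightarrow> nat \<Rightarrow> real) \<Rightarrow> nat \<Rightarrow> nat \<Rightarrow> (nat \<Rightarrow> 'b) \<Rightarrow> 'a" where
  "md_iter T V f \<X> v gv sam \<gamma> X0 z 0 = X0"
| "md_iter T V f \<X> v gv sam \<gamma> X0 z (Suc l) =
     (\<lambda>t h. arg_min_on
        (\<lambda>x. (\<gamma> l *\<^sub>R stoch_grad T V f sam (md_iter T V f \<X> v gv sam \<gamma> X0 z l) (z t l) t h) \<bullet> x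
             + bregman (v t) (gv t) x (md_iter T V f \<X> v gv sam \<gamma> X0 z l t h))
        (\<X> t))"

definition md_output ::
    "nat \<Rightarrow> (nat \<Rightarrow> 'a::euclidean_space set) \<Rightarrow> (nat \<Rightarrow> 'a \<Rightarrow> 'a \<Rightarrow> 'b \<Rightarrow> real)
      \<Rightarrow> (nat \<Rightarrow> 'a set) \<Rightarrow> (nat \<Rightarrow> 'a \<Rightarrow> real) \<Rightarrow> (nat \<Rightarrow> 'a \<Rightarrow> 'a)
      \<Rightarrow> (nat \<Rightarrow> (nat \<Rightarrow> 'b) \<Rightarrow> real \<Rightarrow> 'b) \<Rightarrow> (nat \<Rightarrow> real) \<Rightarrow> (nat \<Rightarrow> (nat \<Rightarrow> 'b) \<Rightarrow> 'a)
      \<Rightarrow> (nat \<Rightarrow> nat \<Rightarrow> real) \<Rightarrow> nat \<Rightarrow> nat \<Rightarrow> (nat \<Rightarrow> 'b) \<Rightarrow> 'a" where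
  "md_output T V f \<X> v gv sam \<gamma> X0 z L t h =
     (\<Sum>l\<le>L. \<gamma> l *\<^sub>R md_iter T V f \<X> v gv sam \<gamma> X0 z l t h) /\<^sub>R (\<Sum>l\<le>L. \<gamma> l)"

end

theory Submission
  imports Defs
begin

text \<open>
  The algorithm is mirror descent run at all histories at once, and the proof follows the expected
  gap of the iterates \<open>x\<^sub>l\<close> towards the solution \<open>x\<^sup>*\<close> through four estimates.

  \<^item> \<^emph>\<open>Linearization.\<close> The total cost lies above its tangents. By Jensen's inequality the gap of the
    averaged policy is at most the average over \<open>l\<close> of
    \<open>\<Sum>t. E \<langle>\<partial>f/\<partial>x\<^sub>t(x\<^sub>l, \<xi>), x\<^sub>l\<^sub>,\<^sub>t - x\<^sup>*\<^sub>t\<rangle>\<close> (\<open>total_cost_Jensen\<close>, \<open>cost_gap_le_gradient_gap\<close>).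

  \<^item> \<^emph>\<open>Bias.\<close> The partial gradient of stage \<open>t\<close> depends on the history up to \<open>t\<close> and on \<open>\<xi>\<^sub>t\<^sub>+\<^sub>1\<close> only,
    while \<open>x\<^sub>l\<^sub>,\<^sub>t - x\<^sup>*\<^sub>t\<close> is a function of the history. So its expectation is an integral against
    the conditional law of \<open>\<xi>\<^sub>t\<^sub>+\<^sub>1\<close>. The integrand is bounded by \<open>Lip\<^sub>t \<parallel>x\<^sub>l\<^sub>,\<^sub>t - x\<^sup>*\<^sub>t\<parallel>\<close>, hence passing to the
    law of the sampler costs at most \<open>2 \<beta>\<^sub>t\<^sub>+\<^sub>1 Lip\<^sub>t \<parallel>x\<^sub>l\<^sub>,\<^sub>t - x\<^sup>*\<^sub>t\<parallel>\<close> (\<open>integral_diff_le_TV\<close>, \<open>expected_bias\<close>).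
    Cauchy-Schwarz over the stages turns the sum of these errors into \<open>b D\<close> (\<open>sum_bias_le\<close>).

  \<^item> \<^emph>\<open>Fresh seeds.\<close> The iterate \<open>x\<^sub>l\<close> uses seeds with index below \<open>l\<close> only. Integrating the sampled
    gradient over a fresh uniform variable therefore has the same expectation as inserting the seed
    that the algorithm uses (\<open>resample_coordinate\<close>, \<open>sampled_gap_fresh_seed\<close>).

  \<^item> \<^emph>\<open>Regret.\<close> For each realization of the seeds and each history, the usual telescoping argument
    bounds \<open>\<gamma> \<Sum>l. \<langle>G\<^sub>l, x\<^sub>l\<^sub>,\<^sub>t - x\<^sup>*\<^sub>t\<rangle>\<close> by the initial Bregman distance plus \<open>(L + 1) \<gamma>\<^sup>2 Lip\<^sub>t\<^sup>2 / 2\<close>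
    (\<open>mirror_step\<close>, \<open>mirror_descent_regret\<close>), because the stochastic gradient is the partial gradient
    at a feasible point and a possible scenario, so that its dual norm is at most \<open>Lip\<^sub>t\<close>.

  With the prescribed constant step the two terms of the regret bound are equal, which yields
  \<open>\<surd>2 Dt Lt / \<surd>(L + 1)\<close>.

  Exchanging the expectations needs iterates that are measurable jointly in seeds and history.
  A step of the algorithm applies to measurable data the map \<open>p \<mapsto> argmin (\<langle>p, x\<rangle> + v x)\<close>, which is Lipschitz
  continuous by strong monotonicity of the gradient of \<open>v\<close> (\<open>continuous_on_prox\<close>). Measurability is
  proved for an arbitrary parameter space that supplies both seeds and histories (\<open>measurable_iter\<close>),
  since the induction must also evaluate the iterate of the next stage at a sampled extension
  of the history.
\<close>

section \<open>Norms and gradients on subspaces\<close>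

text \<open>
  One half of the equivalence of norms, by expanding in an orthonormal basis. It makes \<open>N\<close> continuous,
  and then compactness of the unit sphere gives the other half.
\<close>

lemma norm_on_dominated:
  assumes "subspace V" "is_norm_on V N"
  shows "\<exists>c>0. \<forall>x\<in>V. N x \<le> c * norm x"
proof -
  obtain B where B: "B \<subseteq> V" "pairwise orthogonal B" "\<And>x. x \<in> B \<Longrightarrow> norm x = 1"
      "independent B" "span B = V"
    using orthonormal_basis_subspace[OF assms(1)] by metis
  have fin: "finite B" using B(4) by (simp add: independent_imp_finite)
  have N: "\<And>x. x \<in> V \<Longrightarrow> 0 \<le> N x" "\<And>c x. x \<in> V \<Longrightarrow> N (c *\<^sub>R x) = \<bar>c\<bar> * N x"
      "\<And>x y. x \<in> V \<Longrightarrow> y \<in> V \<Longrightarrow> N (x + y) \<le> N x + N y" "N 0 = 0"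
    using assms subspace_0[OF assms(1)] unfolding is_norm_on_def by auto
  have sum_le: "N (\<Sum>b\<in>C. c b *\<^sub>R b) \<le> (\<Sum>b\<in>C. \<bar>c b\<bar> * N b)" if "C \<subseteq> B" for C c
    using finite_subset[OF that fin] that
  proof (induction C)
    case (insert x F)
    have "(\<Sum>b\<in>F. c b *\<^sub>R b) \<in> V" "c x *\<^sub>R x \<in> V"
      using insert.prems B(1) assms(1) by (auto intro!: subspace_sum subspace_scale)
    then show ?case using insert N(2)[of x "c x"] N(3)[of "c x *\<^sub>R x" "\<Sum>b\<in>F. c b *\<^sub>R b"] B(1)
      by auto
  qed (simp add: N)
  have "N x \<le> ((\<Sum>b\<in>B. N b) + 1) * norm x" if "x \<in> V" for x
  proof -
    have "x = (\<Sum>b\<in>B. (x \<bullet> b) *\<^sub>R b)"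
      using orthonormal_basis_expand[OF B(2,3) _ fin] that B(5) by auto
    then have "N x \<le> (\<Sum>b\<in>B. \<bar>x \<bullet> b\<bar> * N b)" using sum_le[of B "\<lambda>b. x \<bullet> b"] by simp
    also have "\<dots> \<le> (\<Sum>b\<in>B. norm x * N b)"
    proof (intro sum_mono mult_right_mono)
      fix b assume "b \<in> B"
      then show "\<bar>x \<bullet> b\<bar> \<le> norm x" "0 \<le> N b"
        using B(1,3) N(1)[of b] Cauchy_Schwarz_ineq2[of x b] by auto
    qed
    also have "\<dots> = norm x * (\<Sum>b\<in>B. N b)" by (rule sum_distrib_left[symmetric])
    also have "\<dots> \<le> ((\<Sum>b\<in>B. N b) + 1) * norm x" by (simp add: algebra_simps)
    finally show ?thesis .
  qed
  moreover have "0 \<le> (\<Sum>b\<in>B. N b)" using B(1) N(1) by (intro sum_nonneg) auto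
  ultimately show ?thesis by (intro exI[of _ "(\<Sum>b\<in>B. N b) + 1"]) auto
qed

lemma continuous_on_norm_on:
  assumes "subspace V" "is_norm_on V N"
  shows "continuous_on V N"
proof -
  obtain c where c: "c > 0" "\<And>x. x \<in> V \<Longrightarrow> N x \<le> c * norm x"
    using norm_on_dominated[OF assms] by auto
  have tri: "N x - N y \<le> c * dist x y" if "x \<in> V" "y \<in> V" for x y
  proof -
    have d: "x - y \<in> V" using that assms(1) subspace_diff by blast
    have "N ((x - y) + y) \<le> N (x - y) + N y"
      using assms(2) d that unfolding is_norm_on_def by blast
    then show ?thesis using c(2)[OF d] by (simp add: dist_norm)
  qed
  have "c-lipschitz_on V N"
  proof (rule lipschitz_onI)
    fix x y assume "x \<in> V" "y \<in> V"
    then show "dist (N x) (N y) \<le> c * dist x y"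
      using tri[of x y] tri[of y x] by (simp add: dist_real_def abs_le_iff dist_commute)
  qed (use c in simp)
  then show ?thesis by (rule lipschitz_on_continuous_on)
qed

lemma norm_on_dominates:
  assumes "subspace V" "is_norm_on V N"
  shows "\<exists>c>0. \<forall>x\<in>V. norm x \<le> c * N x"
proof (cases "V = {0}")
  case True
  then show ?thesis using assms(2) by (intro exI[of _ 1]) (auto simp: is_norm_on_def)
next
  case False
  let ?K = "V \<inter> sphere 0 1"
  obtain w where w: "w \<in> V" "w \<noteq> 0" using False subspace_0[OF assms(1)] by blast
  have "w /\<^sub>R norm w \<in> ?K" using w assms(1) subspace_scale by fastforce
  then have ne: "?K \<noteq> {}" by blast
  have "compact ?K" using closed_subspace[OF assms(1)] by (intro closed_Int_compact) auto
  then obtain m where m: "m \<in> ?K" "\<And>x. x \<in> ?K \<Longrightarrow> N m \<le> N x"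
    using continuous_attains_inf[OF _ ne continuous_on_subset[OF continuous_on_norm_on[OF assms] Int_lower1]]
    by blast
  have "m \<noteq> 0" using m(1) by auto
  then have pos: "N m > 0"
    using assms(2) m(1) unfolding is_norm_on_def by (metis IntD1 less_eq_real_def)
  have "norm x \<le> (1 / N m) * N x" if x: "x \<in> V" for x
  proof (cases "x = 0")
    case True then show ?thesis using assms(2) x by (auto simp: is_norm_on_def)
  next
    case False
    have "x /\<^sub>R norm x \<in> ?K" using x False assms(1) subspace_scale by fastforce
    moreover have "N (x /\<^sub>R norm x) = N x / norm x"
      using assms(2) x unfolding is_norm_on_def by (simp add: divide_inverse mult.commute)
    ultimately have "N m \<le> N x / norm x" using m(2) by metis
    then show ?thesis using pos False by (simp add: field_simps)
  qed
  then show ?thesis using pos by (intro exI[of _ "1 / N m"]) auto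
qed

text \<open>
  The point is that the supremum defining the dual norm is finite, so that it really is an upper
  bound: the unit ball of \<open>N\<close> is bounded because \<open>N\<close> dominates the Euclidean norm.
\<close>

lemma inner_le_dual_norm:
  assumes "subspace V" "is_norm_on V N" "x \<in> V"
  shows "g \<bullet> x \<le> dual_norm V N g * N x"
proof -
  obtain c where c: "c > 0" "\<And>x. x \<in> V \<Longrightarrow> norm x \<le> c * N x"
    using norm_on_dominates[OF assms(1,2)] by auto
  have bdd: "bdd_above ((\<lambda>x. g \<bullet> x) ` {x \<in> V. N x \<le> 1})"
  proof (rule bdd_aboveI2)
    fix y assume "y \<in> {x \<in> V. N x \<le> 1}"
    then have "norm y \<le> c * 1" using c(1) order_trans[OF c(2) mult_left_mono[of "N y" 1 c]] by simp
    moreover have "g \<bullet> y \<le> norm g * norm y" by (rule norm_cauchy_schwarz)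
    ultimately show "g \<bullet> y \<le> norm g * c"
      using mult_left_mono[OF _ norm_ge_zero, of "norm y" "c" g] by simp
  qed
  show ?thesis
  proof (cases "x = 0")
    case True then show ?thesis using assms by (auto simp: is_norm_on_def)
  next
    case False
    then have pos: "N x > 0"
      using assms(2,3) unfolding is_norm_on_def by (metis less_eq_real_def)
    have "N (x /\<^sub>R N x) = \<bar>inverse (N x)\<bar> * N x"
      using assms(2,3) unfolding is_norm_on_def by blast
    then have "N (x /\<^sub>R N x) = 1" using pos by (simp add: less_imp_neq[THEN not_sym])
    moreover have "x /\<^sub>R N x \<in> V" using assms(1,3) subspace_scale by blast
    ultimately have "g \<bullet> (x /\<^sub>R N x) \<le> dual_norm V N g"
      unfolding dual_norm_def using bdd by (intro cSUP_upper) auto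
    then show ?thesis using pos by (simp add: field_simps)
  qed
qed

lemma abs_inner_le_dual_norm:
  assumes "subspace V" "is_norm_on V N" "x \<in> V"
  shows "\<bar>g \<bullet> x\<bar> \<le> dual_norm V N g * N x"
proof -
  have "- x \<in> V" using assms subspace_neg by blast
  moreover have "N (- x) = N x"
    using assms(2,3) unfolding is_norm_on_def by (metis abs_minus abs_one mult_1 scaleR_minus1_left)
  ultimately show ?thesis
    using inner_le_dual_norm[OF assms(1,2), of x g] inner_le_dual_norm[OF assms(1,2), of "- x" g] assms(3)
    by (auto simp: abs_le_iff)
qed

text \<open>
  Derivatives within convex sets that may have empty interior are only accessible along segments;
  this is the bridge from them to one-dimensional calculus on the unit interval.
\<close>

lemma has_derivative_segment:
  fixes F :: "'a::real_normed_vector \<Rightarrow> real"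
  assumes "convex S" "x \<in> S" "y \<in> S" "s \<in> {0..1}"
    and "(F has_derivative F') (at (x + s *\<^sub>R (y - x)) within S)"
  shows "((\<lambda>r. F (x + r *\<^sub>R (y - x))) has_real_derivative F' (y - x)) (at s within {0..1})"
proof -
  have sub: "(\<lambda>r. x + r *\<^sub>R (y - x)) ` {0..1} \<subseteq> S"
  proof clarify
    fix r :: real assume "r \<in> {0..1}"
    then have "(1 - r) *\<^sub>R x + r *\<^sub>R y \<in> S" using assms(1-3) by (intro convexD) auto
    then show "x + r *\<^sub>R (y - x) \<in> S" by (simp add: algebra_simps)
  qed
  have "((\<lambda>r. x + r *\<^sub>R (y - x)) has_derivative (\<lambda>r. r *\<^sub>R (y - x))) (at s within {0..1})"
    by (auto intro!: derivative_eq_intros)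
  from has_derivative_in_compose[OF this has_derivative_subset[OF assms(5) sub]]
  have *: "((\<lambda>r. F (x + r *\<^sub>R (y - x))) has_derivative (\<lambda>r. F' (r *\<^sub>R (y - x)))) (at s within {0..1})" .
  have "linear F'" using assms(5) has_derivative_linear by blast
  then have "(\<lambda>r. F' (r *\<^sub>R (y - x))) = (*) (F' (y - x))"
    by (auto simp: linear_scale mult.commute)
  then show ?thesis using * by (simp add: has_field_derivative_def)
qed

text \<open>
  The difference quotients of \<open>F\<close> along the segment from \<open>x\<close> to \<open>y\<close> are bounded by \<open>F y - F x\<close>.
\<close>

lemma convex_on_above_tangent:
  fixes F :: "'a::real_normed_vector \<Rightarrow> real"
  assumes "convex_on S F" "x \<in> S" "y \<in> S" "(F has_derivative F') (at x within S)"
  shows "F x + F' (y - x) \<le> F y"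
proof -
  let ?\<phi> = "\<lambda>r. F (x + r *\<^sub>R (y - x))"
  have "convex S" using assms(1) convex_on_imp_convex by blast
  then have "(?\<phi> has_real_derivative F' (y - x)) (at 0 within {0..1})"
    using assms by (intro has_derivative_segment[of S]) auto
  then have "((\<lambda>r. (?\<phi> r - ?\<phi> 0) / (r - 0)) \<longlongrightarrow> F' (y - x)) (at 0 within {0..1})"
    unfolding has_field_derivative_iff .
  moreover have "eventually (\<lambda>r. (?\<phi> r - ?\<phi> 0) / (r - 0) \<le> F y - F x) (at 0 within {0..1})"
    unfolding eventually_at_filter
  proof (intro always_eventually allI impI)
    fix r :: real assume r: "r \<noteq> 0" "r \<in> {0..1}"
    have "F ((1 - r) *\<^sub>R x + r *\<^sub>R y) \<le> (1 - r) * F x + r * F y"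
      using r assms by (intro convex_onD) auto
    moreover have "(1 - r) *\<^sub>R x + r *\<^sub>R y = x + r *\<^sub>R (y - x)" by (simp add: algebra_simps)
    ultimately have "?\<phi> r - F x \<le> r * (F y - F x)" by (simp add: algebra_simps)
    then show "(?\<phi> r - ?\<phi> 0) / (r - 0) \<le> F y - F x" using r by (simp add: field_simps)
  qed
  moreover have "at (0::real) within {0..1} \<noteq> bot"
    by (simp add: trivial_limit_within islimpt_Icc)
  ultimately have "F' (y - x) \<le> F y - F x" by (rule tendsto_upperbound)
  then show ?thesis by simp
qed

lemma has_derivative_transform_on_subspace:
  assumes "subspace V" "x \<in> V" "(F has_derivative F') (at x within V)"
    and "\<And>h. h \<in> V \<Longrightarrow> F' h = G' h" "bounded_linear G'"
  shows "(F has_derivative G') (at x within V)"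
proof -
  have "\<forall>\<^sub>F y in at x within V. (1 / norm (y - x)) *\<^sub>R (F y - (F x + F' (y - x)))
          = (1 / norm (y - x)) *\<^sub>R (F y - (F x + G' (y - x)))"
    unfolding eventually_at_filter using assms(1,2,4)
    by (intro always_eventually) (simp add: subspace_diff)
  moreover have "((\<lambda>y. (1 / norm (y - x)) *\<^sub>R (F y - (F x + F' (y - x)))) \<longlongrightarrow> 0) (at x within V)"
    using assms(3) unfolding has_derivative_within by blast
  ultimately have "((\<lambda>y. (1 / norm (y - x)) *\<^sub>R (F y - (F x + G' (y - x)))) \<longlongrightarrow> 0) (at x within V)"
    by (rule Lim_transform_eventually[rotated])
  then show ?thesis using assms(5) unfolding has_derivative_within by blast
qed

lemma has_derivative_unique_on_subspace:
  fixes F :: "'a::real_normed_vector \<Rightarrow> real"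
  assumes "subspace V" "x \<in> V" "h \<in> V"
    and "(F has_derivative F') (at x within V)" "(F has_derivative G') (at x within V)"
  shows "F' h = G' h"
proof -
  have y: "x + h \<in> V" using assms(1-3) by (rule subspace_add)
  have cv: "convex V" using assms(1) subspace_imp_convex by blast
  have der: "((\<lambda>r. F (x + r *\<^sub>R h)) has_real_derivative D h) (at 0 within {0..1})"
    if "(F has_derivative D) (at x within V)" for D
    using has_derivative_segment[OF cv assms(2) y, of 0 F D] that by simp
  have "at (0::real) within {0..1} \<noteq> bot"
    by (simp add: trivial_limit_within islimpt_Icc)
  then show ?thesis using der[OF assms(4)] der[OF assms(5)] has_field_derivative_unique by blast
qed

lemma grad_on_eq:
  assumes "subspace V" "x \<in> V" "g \<in> V" "(F has_derivative (\<lambda>h. g \<bullet> h)) (at x within V)"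
  shows "grad_on V F x = g"
  unfolding grad_on_def
proof (rule the_equality)
  fix g' assume g': "g' \<in> V \<and> (F has_derivative (\<lambda>h. g' \<bullet> h)) (at x within V)"
  then have "g' - g \<in> V" using assms by (simp add: subspace_diff)
  then have "g \<bullet> (g' - g) = g' \<bullet> (g' - g)"
    using has_derivative_unique_on_subspace[OF assms(1,2) _ assms(4)] g' by blast
  then have "(g' - g) \<bullet> (g' - g) = 0" by (simp add: inner_diff_left)
  then show "g' = g" by simp
qed (use assms in auto)

text \<open>
  Every linear functional is represented on \<open>V\<close> by a unique vector of \<open>V\<close>, so the definite description
  in \<open>grad_on\<close> is meaningful as soon as \<open>F\<close> is differentiable within \<open>V\<close>.
\<close>

lemma has_derivative_grad_on:
  assumes V: "subspace V" "x \<in> V" and F: "F differentiable (at x within V)"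
  shows "grad_on V F x \<in> V" "(F has_derivative (\<lambda>h. grad_on V F x \<bullet> h)) (at x within V)"
proof -
  obtain F' where F': "(F has_derivative F') (at x within V)"
    using F unfolding differentiable_def by blast
  obtain B where B: "B \<subseteq> V" "pairwise orthogonal B" "\<And>x. x \<in> B \<Longrightarrow> norm x = 1"
      "independent B" "span B = V"
    using orthonormal_basis_subspace[OF V(1)] by metis
  have fin: "finite B" using B(4) by (simp add: independent_imp_finite)
  have lin: "linear F'" using F' has_derivative_linear by blast
  define g where "g = (\<Sum>b\<in>B. F' b *\<^sub>R b)"
  have g: "g \<in> V" unfolding g_def using B(1) V(1) by (auto intro!: subspace_sum subspace_scale)
  have "F' h = g \<bullet> h" if "h \<in> V" for h
  proof -
    have "h = (\<Sum>b\<in>B. (h \<bullet> b) *\<^sub>R b)"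
      using orthonormal_basis_expand[OF B(2,3) _ fin] that B(5) by auto
    then have "F' h = F' (\<Sum>b\<in>B. (h \<bullet> b) *\<^sub>R b)" by simp
    also have "\<dots> = (\<Sum>b\<in>B. (h \<bullet> b) * F' b)" using lin by (simp add: linear_sum linear_scale)
    also have "\<dots> = g \<bullet> h"
      unfolding g_def by (simp add: inner_sum_left inner_commute[of h] mult.commute)
    finally show ?thesis .
  qed
  then have der: "(F has_derivative (\<lambda>h. g \<bullet> h)) (at x within V)"
    by (rule has_derivative_transform_on_subspace[OF V F']) (auto intro: bounded_linear_inner_right)
  have "grad_on V F x = g" by (rule grad_on_eq[OF V g der])
  then show "grad_on V F x \<in> V" "(F has_derivative (\<lambda>h. grad_on V F x \<bullet> h)) (at x within V)"
    using g der by auto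
qed

section \<open>Distance generating functions and the mirror step\<close>

lemma directional_derivative_nonneg_at_minimum:
  fixes F :: "'a::real_normed_vector \<Rightarrow> real"
  assumes "convex S" "x \<in> S" "y \<in> S" "(F has_derivative F') (at x within S)"
    and "\<And>z. z \<in> S \<Longrightarrow> F x \<le> F z"
  shows "0 \<le> F' (y - x)"
proof -
  let ?\<phi> = "\<lambda>r. F (x + r *\<^sub>R (y - x))"
  have "(?\<phi> has_real_derivative F' (y - x)) (at 0 within {0..1})"
    using assms by (intro has_derivative_segment[of S]) auto
  then have "((\<lambda>r. (?\<phi> r - ?\<phi> 0) / (r - 0)) \<longlongrightarrow> F' (y - x)) (at 0 within {0..1})"
    unfolding has_field_derivative_iff .
  moreover have "eventually (\<lambda>r. 0 \<le> (?\<phi> r - ?\<phi> 0) / (r - 0)) (at 0 within {0..1})"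
    unfolding eventually_at_filter
  proof (intro always_eventually allI impI)
    fix r :: real assume r: "r \<noteq> 0" "r \<in> {0..1}"
    have "(1 - r) *\<^sub>R x + r *\<^sub>R y \<in> S" using r assms(1-3) by (intro convexD) auto
    moreover have "(1 - r) *\<^sub>R x + r *\<^sub>R y = x + r *\<^sub>R (y - x)" by (simp add: algebra_simps)
    ultimately show "0 \<le> (?\<phi> r - ?\<phi> 0) / (r - 0)" using assms(5) r by simp
  qed
  moreover have "at (0::real) within {0..1} \<noteq> bot"
    by (simp add: trivial_limit_within islimpt_Icc)
  ultimately show ?thesis by (rule tendsto_lowerbound)
qed

text \<open>
  The mirror update started at \<open>x\<close> with step \<open>G\<close> is \<open>prox_map Q v (G - gv x)\<close>. This form separates the data of
  the update from an optimization problem that depends on one vector only.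
\<close>

definition prox_map :: "'a::euclidean_space set \<Rightarrow> ('a \<Rightarrow> real) \<Rightarrow> 'a \<Rightarrow> 'a" where
  "prox_map Q v p = arg_min_on (\<lambda>x. p \<bullet> x + v x) Q"

text \<open>
  The geometry of a single stage.
\<close>

locale dgf_setup =
  fixes V :: "'a::euclidean_space set" and N :: "'a \<Rightarrow> real" and Q :: "'a set"
    and v :: "'a \<Rightarrow> real" and gv :: "'a \<Rightarrow> 'a"
  assumes V: "subspace V" and N: "is_norm_on V N" and QV: "Q \<subseteq> V" and Q_ne: "Q \<noteq> {}"
    and Q_compact: "compact Q" and dgf: "is_dgf V N Q v gv"
begin

abbreviation Qo :: "'a set" where "Qo \<equiv> dgf_dom V Q v"

lemma Qo_subset: "Qo \<subseteq> Q" unfolding dgf_dom_def by auto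

lemma v_convex: "convex_on Q v" and v_cont: "continuous_on Q v" and Qo_convex: "convex Qo"
  using dgf unfolding is_dgf_def by auto

lemma gv_in: "x \<in> Qo \<Longrightarrow> gv x \<in> V"
  and gv_deriv: "x \<in> Qo \<Longrightarrow> (v has_derivative (\<lambda>h. gv x \<bullet> h)) (at x within Qo)"
  and gv_mono: "x \<in> Qo \<Longrightarrow> y \<in> Qo \<Longrightarrow> (N (y - x))\<^sup>2 \<le> (y - x) \<bullet> (gv y - gv x)"
  and gv_cont: "continuous_on Qo gv"
  using dgf unfolding is_dgf_def by auto

lemma N_scale: "x \<in> V \<Longrightarrow> N (c *\<^sub>R x) = \<bar>c\<bar> * N x"
  using N unfolding is_norm_on_def by auto

lemma N_minus_commute: "x \<in> V \<Longrightarrow> y \<in> V \<Longrightarrow> N (x - y) = N (y - x)"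
  using N_scale[of "x - y" "-1"] V by (simp add: subspace_diff)

lemma Q_diff: "x \<in> Q \<Longrightarrow> y \<in> Q \<Longrightarrow> x - y \<in> V"
  using QV V subspace_diff by blast

abbreviation prox :: "'a \<Rightarrow> 'a" where "prox \<equiv> prox_map Q v"

lemma prox_minimal: "prox p \<in> Q" "y \<in> Q \<Longrightarrow> p \<bullet> prox p + v (prox p) \<le> p \<bullet> y + v y"
proof -
  have "continuous_on Q (\<lambda>x. p \<bullet> x + v x)" by (intro continuous_intros v_cont)
  then obtain x where "x \<in> Q" "\<forall>y\<in>Q. p \<bullet> x + v x \<le> p \<bullet> y + v y"
    using continuous_attains_inf[OF Q_compact Q_ne] by blast
  then have "is_arg_min (\<lambda>x. p \<bullet> x + v x) (\<lambda>x. x \<in> Q) x"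
    unfolding is_arg_min_linorder by auto
  then have "is_arg_min (\<lambda>x. p \<bullet> x + v x) (\<lambda>x. x \<in> Q) (prox p)"
    unfolding prox_map_def arg_min_on_def arg_min_def by (rule someI)
  then show "prox p \<in> Q" "y \<in> Q \<Longrightarrow> p \<bullet> prox p + v (prox p) \<le> p \<bullet> y + v y"
    unfolding is_arg_min_linorder by auto
qed

lemma prox_in: "p \<in> V \<Longrightarrow> prox p \<in> Qo"
  unfolding dgf_dom_def using prox_minimal(1)[of p] prox_minimal(2)[of _ p] by (auto simp: add.commute)

text \<open>
  First-order condition for minimizing the sum of the convex \<open>v\<close> and a smooth quadratic:
  moving from \<open>u\<close> towards \<open>x\<close> by a fraction \<open>s\<close> changes the quadratic by its linear part plus a term of order
  \<open>s\<^sup>2\<close>. So \<open>u\<close> minimizes \<open>v\<close> plus the linear part, which is the membership condition of \<open>Qo\<close>.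
\<close>

lemma regularized_minimizer_in_Qo:
  assumes c: "c \<ge> 0" and u: "u \<in> Q" and y: "y \<in> Q"
    and min: "\<And>x. x \<in> Q \<Longrightarrow> v u + c * (norm (u - y))\<^sup>2 \<le> v x + c * (norm (x - y))\<^sup>2"
  shows "u \<in> Qo"
proof -
  let ?g = "(2 * c) *\<^sub>R (u - y)"
  have "v u + ?g \<bullet> u \<le> v x + ?g \<bullet> x" if x: "x \<in> Q" for x
  proof (rule field_le_epsilon)
    fix e :: real assume e: "e > 0"
    let ?K = "c * (norm (x - u))\<^sup>2"
    have K: "?K \<ge> 0" using c by simp
    \<comment> \<open>a fraction so small that the quadratic term \<open>s * ?K\<close> is at most \<open>e\<close>\<close>
    define s where "s = min 1 (e / (?K + 1))"
    have s: "0 < s" "s \<le> 1" using e K by (auto simp: s_def)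
    have "s * ?K \<le> (e / (?K + 1)) * ?K" using K by (intro mult_right_mono) (auto simp: s_def)
    also have "\<dots> \<le> e" using e K by (simp add: field_simps)
    finally have sK: "s * ?K \<le> e" .
    let ?z = "(1 - s) *\<^sub>R u + s *\<^sub>R x"
    have z: "?z \<in> Q" using s u x convex_on_imp_convex[OF v_convex] by (intro convexD) auto
    have "v ?z \<le> (1 - s) * v u + s * v x"
      using s u x by (intro convex_onD[OF v_convex]) auto
    moreover have "(norm (?z - y))\<^sup>2 = (norm (u - y))\<^sup>2 + 2 * s * ((u - y) \<bullet> (x - u)) + s\<^sup>2 * (norm (x - u))\<^sup>2"
    proof -
      have *: "?z - y = (u - y) + s *\<^sub>R (x - u)" by (simp add: algebra_simps)
      show ?thesis unfolding * power2_norm_eq_inner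
        by (simp add: inner_add_left inner_add_right inner_commute power2_eq_square algebra_simps)
    qed
    ultimately have "v u + c * (norm (u - y))\<^sup>2 \<le> (1 - s) * v u + s * v x
        + c * ((norm (u - y))\<^sup>2 + 2 * s * ((u - y) \<bullet> (x - u)) + s\<^sup>2 * (norm (x - u))\<^sup>2)"
      using min[OF z] by simp
    then have "s * v u \<le> s * (v x + 2 * c * ((u - y) \<bullet> (x - u)) + s * ?K)"
      by (simp add: algebra_simps power2_eq_square)
    then have "v u \<le> v x + 2 * c * ((u - y) \<bullet> (x - u)) + s * ?K" using s(1) by simp
    then show "v u + ?g \<bullet> u \<le> v x + ?g \<bullet> x + e"
      using sK by (simp add: inner_diff_right algebra_simps)
  qed
  moreover have "?g \<in> V" using V Q_diff[OF u y] subspace_scale by blast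
  ultimately show ?thesis using u unfolding dgf_dom_def by blast
qed

text \<open>
  \<open>Qo\<close> is dense in \<open>Q\<close>: the minimizers of \<open>v x + c \<parallel>x - y\<parallel>\<^sup>2\<close> lie in \<open>Qo\<close> and tend to \<open>y\<close> for large \<open>c\<close>, since \<open>v\<close> is
  bounded below. Density carries inequalities that use the gradient, hence make sense within
  \<open>Qo\<close>, to comparison points anywhere in \<open>Q\<close>; the solution need not take values in \<open>Qo\<close>.
\<close>

lemma Q_subset_closure_Qo: "Q \<subseteq> closure Qo"
proof
  fix y assume y: "y \<in> Q"
  obtain m where m: "\<And>x. x \<in> Q \<Longrightarrow> v m \<le> v x" "m \<in> Q"
    using continuous_attains_inf[OF Q_compact Q_ne v_cont] by blast
  show "y \<in> closure Qo" unfolding closure_approachable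
  proof (intro allI impI)
    fix e :: real assume e: "e > 0"
    \<comment> \<open>a penalty so large that staying at distance \<open>e\<close> from \<open>y\<close> costs more than \<open>v\<close> can gain\<close>
    define c where "c = (v y - v m + 1) / e\<^sup>2"
    have pos: "v y - v m + 1 > 0" using m(1)[OF y] by simp
    have c: "c > 0" unfolding c_def using pos e by simp
    have "continuous_on Q (\<lambda>x. v x + c * (norm (x - y))\<^sup>2)" by (intro continuous_intros v_cont)
    from continuous_attains_inf[OF Q_compact Q_ne this]
    obtain u where u: "u \<in> Q"
        "\<And>x. x \<in> Q \<Longrightarrow> v u + c * (norm (u - y))\<^sup>2 \<le> v x + c * (norm (x - y))\<^sup>2"
      by blast
    have "c * (norm (u - y))\<^sup>2 < c * e\<^sup>2"
    proof -
      have "c * (norm (u - y))\<^sup>2 \<le> v y - v m" using u(2)[OF y] m(1)[OF u(1)] by simp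
      also have "\<dots> < c * e\<^sup>2" unfolding c_def using e by simp
      finally show ?thesis .
    qed
    then have "(norm (u - y))\<^sup>2 < e\<^sup>2" using c by simp
    then have "dist u y < e" using e by (simp add: dist_norm power_less_imp_less_base)
    moreover have "u \<in> Qo"
      using c u y by (intro regularized_minimizer_in_Qo[of c _ y]) auto
    ultimately show "\<exists>x\<in>Qo. dist x y < e" by blast
  qed
qed

lemma nonneg_on_Q_if_on_Qo:
  assumes "continuous_on Q F" "\<And>x. x \<in> Qo \<Longrightarrow> (0::real) \<le> F x" "y \<in> Q"
  shows "0 \<le> F y"
proof -
  obtain u where u: "\<And>n. u n \<in> Qo" "u \<longlonglongrightarrow> y"
    using Q_subset_closure_Qo assms(3) closure_sequential by blast
  have "(\<lambda>n. F (u n)) \<longlonglongrightarrow> F y"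
    using continuous_on_tendsto_compose[OF assms(1) u(2) assms(3)] u(1) Qo_subset
    by (simp add: always_eventually subset_iff)
  then show ?thesis by (rule LIMSEQ_le_const) (use assms(2) u(1) in auto)
qed

lemma prox_optimality:
  assumes p: "p \<in> V" and y: "y \<in> Q"
  shows "0 \<le> (p + gv (prox p)) \<bullet> (y - prox p)"
proof (rule nonneg_on_Q_if_on_Qo[OF _ _ y])
  show "continuous_on Q (\<lambda>y. (p + gv (prox p)) \<bullet> (y - prox p))" by (intro continuous_intros)
  fix z assume z: "z \<in> Qo"
  have "((\<lambda>x. p \<bullet> x + v x) has_derivative (\<lambda>h. p \<bullet> h + gv (prox p) \<bullet> h)) (at (prox p) within Qo)"
    by (intro derivative_intros gv_deriv prox_in p)
  from directional_derivative_nonneg_at_minimum[OF Qo_convex prox_in[OF p] z this]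
  show "0 \<le> (p + gv (prox p)) \<bullet> (z - prox p)"
    using prox_minimal(2)[of _ p] Qo_subset by (auto simp: inner_add_left)
qed

text \<open>
  Strong monotonicity of the gradient makes \<open>v\<close> minus its tangent at \<open>x\<close> minus \<open>s\<^sup>2 N(y - x)\<^sup>2 / 2\<close> nondecreasing
  along the segment from \<open>x\<close> to \<open>y\<close>.
\<close>

lemma bregman_ge_half_norm_on_Qo:
  assumes x: "x \<in> Qo" and y: "y \<in> Qo"
  shows "(N (y - x))\<^sup>2 / 2 \<le> bregman v gv y x"
proof -
  let ?z = "\<lambda>s. x + s *\<^sub>R (y - x)" and ?n = "(N (y - x))\<^sup>2"
  let ?\<phi> = "\<lambda>s. v (?z s) - s * (gv x \<bullet> (y - x)) - s\<^sup>2 * ?n / 2"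
  have z: "?z s \<in> Qo" if "s \<in> {0..1}" for s
  proof -
    have "(1 - s) *\<^sub>R x + s *\<^sub>R y \<in> Qo" using that x y Qo_convex by (intro convexD) auto
    then show ?thesis by (simp add: algebra_simps)
  qed
  have der: "(?\<phi> has_real_derivative gv (?z s) \<bullet> (y - x) - gv x \<bullet> (y - x) - s * ?n) (at s within {0..1})"
    if s: "s \<in> {0..1}" for s
    using has_derivative_segment[OF Qo_convex x y s gv_deriv[OF z[OF s]]]
    by (auto intro!: derivative_eq_intros)
  have "?\<phi> 0 \<le> ?\<phi> 1"
  proof (rule DERIV_nonneg_imp_increasing_open[of 0 1 ?\<phi>])
    fix s :: real assume s: "0 < s" "s < 1"
    have "(N (?z s - x))\<^sup>2 \<le> (?z s - x) \<bullet> (gv (?z s) - gv x)"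
      using z[of s] s x by (intro gv_mono) auto
    moreover have "N (?z s - x) = s * N (y - x)"
    proof -
      have "y - x \<in> V" using Q_diff Qo_subset x y by blast
      then show ?thesis using N_scale[of "y - x" s] s by simp
    qed
    ultimately have "(s * N (y - x))\<^sup>2 \<le> (s *\<^sub>R (y - x)) \<bullet> (gv (?z s) - gv x)" by simp
    then have "s * (s * ?n) \<le> s * ((y - x) \<bullet> (gv (?z s) - gv x))"
      unfolding inner_scaleR_left power_mult_distrib by (simp only: power2_eq_square mult.assoc)
    then have "s * ?n \<le> (y - x) \<bullet> (gv (?z s) - gv x)" using s by simp
    then have "0 \<le> gv (?z s) \<bullet> (y - x) - gv x \<bullet> (y - x) - s * ?n"
      by (simp add: inner_diff_right inner_commute)
    then show "\<exists>d. (?\<phi> has_real_derivative d) (at s) \<and> 0 \<le> d"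
      using der[of s] s at_within_Icc_at[of 0 s 1] by auto
  next
    show "continuous_on {0..1} ?\<phi>"
      using DERIV_continuous[OF der] by (simp add: continuous_on_eq_continuous_within)
  qed simp
  then show ?thesis unfolding bregman_def by simp
qed

lemma bregman_ge_half_norm:
  assumes x: "x \<in> Qo" and y: "y \<in> Q"
  shows "(N (y - x))\<^sup>2 / 2 \<le> bregman v gv y x"
proof -
  have "continuous_on Q (\<lambda>y. N (y - x))"
    using Q_diff Qo_subset x
    by (intro continuous_on_compose2[OF continuous_on_norm_on[OF V N]] continuous_intros) auto
  then have "continuous_on Q (\<lambda>y. bregman v gv y x - (N (y - x))\<^sup>2 / 2)"
    unfolding bregman_def by (intro continuous_intros v_cont) auto
  from nonneg_on_Q_if_on_Qo[OF this _ y] bregman_ge_half_norm_on_Qo[OF x]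
  show ?thesis by simp
qed

lemma bregman_nonneg: "x \<in> Qo \<Longrightarrow> y \<in> Q \<Longrightarrow> 0 \<le> bregman v gv y x"
  using order_trans[OF _ bregman_ge_half_norm[of x y]] by simp

text \<open>
  Adding the optimality conditions of \<open>prox p\<close> and \<open>prox q\<close>, each tested at the other point, bounds
  \<open>N (prox p - prox q)\<^sup>2\<close> by \<open>\<langle>prox p - prox q, q - p\<rangle>\<close>. Hence \<open>prox\<close> is Lipschitz continuous.
\<close>

lemma continuous_on_prox: "continuous_on V prox"
proof -
  obtain c where c: "c > 0" "\<And>x. x \<in> V \<Longrightarrow> norm x \<le> c * N x"
    using norm_on_dominates[OF V N] by auto
  have "norm (prox p - prox q) \<le> c\<^sup>2 * norm (p - q)" if pq: "p \<in> V" "q \<in> V" for p q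
  proof -
    let ?d = "prox p - prox q"
    have d: "?d \<in> V" using Q_diff prox_minimal(1) by blast
    have "(N ?d)\<^sup>2 \<le> ?d \<bullet> (gv (prox p) - gv (prox q))"
      using gv_mono prox_in pq by blast
    also have "\<dots> \<le> ?d \<bullet> (q - p)"
      using prox_optimality[OF pq(1) prox_minimal(1)[of q]] prox_optimality[OF pq(2) prox_minimal(1)[of p]]
      by (simp add: inner_diff_left inner_diff_right inner_add_left inner_add_right inner_commute)
    also have "\<dots> \<le> norm ?d * norm (p - q)"
      using norm_cauchy_schwarz[of ?d "q - p"] by (simp add: norm_minus_commute)
    finally have N2: "(N ?d)\<^sup>2 \<le> norm ?d * norm (p - q)" .
    have "norm ?d * norm ?d \<le> (c * N ?d)\<^sup>2"
      using power_mono[OF c(2)[OF d] norm_ge_zero, of 2] by (simp add: power2_eq_square)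
    also have "\<dots> \<le> c\<^sup>2 * (norm ?d * norm (p - q))"
      using N2 by (simp add: power_mult_distrib mult_left_mono)
    finally have "norm ?d * norm ?d \<le> norm ?d * (c\<^sup>2 * norm (p - q))" by (simp add: mult_ac)
    then show ?thesis
      by (cases "norm ?d = 0") (simp_all add: mult_le_cancel_left zero_less_norm_iff)
  qed
  then have "(c\<^sup>2)-lipschitz_on V prox" by (intro lipschitz_onI) (auto simp: dist_norm)
  then show ?thesis by (rule lipschitz_on_continuous_on)
qed

text \<open>
  Three Bregman distances combine to an inner product with the difference of the gradients, which the
  optimality condition of the update controls. The movement from \<open>x\<close> to the new point costs at most
  \<open>l N(x' - x)\<close>, and the Bregman distance \<open>bregman v gv x' x\<close> absorbs it up to \<open>l\<^sup>2 / 2\<close>.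
\<close>

lemma mirror_step:
  assumes x: "x \<in> Qo" and y: "y \<in> Q" and G: "G \<in> V"
    and bound: "\<And>d. d \<in> V \<Longrightarrow> \<bar>G \<bullet> d\<bar> \<le> l * N d"
  shows "G \<bullet> (x - y) \<le> bregman v gv y x - bregman v gv y (prox (G - gv x)) + l\<^sup>2 / 2"
proof -
  let ?x' = "prox (G - gv x)"
  have p: "G - gv x \<in> V" using G gv_in[OF x] V subspace_diff by blast
  have x': "?x' \<in> Qo" "?x' \<in> Q" using prox_in[OF p] Qo_subset by auto
  have xQ: "x \<in> Q" using x Qo_subset by auto
  have opt: "0 \<le> (G - gv x + gv ?x') \<bullet> (y - ?x')" by (rule prox_optimality[OF p y])
  have three_point: "bregman v gv y x - bregman v gv y ?x' - bregman v gv ?x' x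
      = (gv ?x' - gv x) \<bullet> (y - ?x')"
    unfolding bregman_def by (simp add: inner_diff_left inner_diff_right)
  have "G \<bullet> (x - y) = G \<bullet> (x - ?x') - G \<bullet> (y - ?x')" by (simp add: inner_diff_right)
  moreover have "- (G \<bullet> (y - ?x')) \<le> (gv ?x' - gv x) \<bullet> (y - ?x')"
    using opt by (simp add: inner_add_left inner_diff_left)
  moreover have "G \<bullet> (x - ?x') \<le> l * N (?x' - x)"
  proof -
    have d: "x - ?x' \<in> V" using Q_diff xQ x'(2) by blast
    have "N (x - ?x') = N (?x' - x)" using QV xQ x'(2) by (intro N_minus_commute) auto
    then show ?thesis using bound[OF d] by auto
  qed
  moreover have "(N (?x' - x))\<^sup>2 / 2 \<le> bregman v gv ?x' x" by (rule bregman_ge_half_norm[OF x x'(2)])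
  moreover have "l * N (?x' - x) \<le> l\<^sup>2 / 2 + (N (?x' - x))\<^sup>2 / 2"
    using zero_le_power2[of "l - N (?x' - x)"] by (simp add: power2_diff)
  ultimately show ?thesis using three_point by linarith
qed

lemma mirror_update_eq_prox:
  "arg_min_on (\<lambda>z. G \<bullet> z + bregman v gv z x) Q = prox (G - gv x)"
proof -
  have "G \<bullet> z + bregman v gv z x = ((G - gv x) \<bullet> z + v z) + (gv x \<bullet> x - v x)" for z
    unfolding bregman_def by (simp add: inner_diff_left inner_diff_right)
  then show ?thesis
    unfolding prox_map_def arg_min_on_def arg_min_def is_arg_min_linorder by simp
qed

end

section \<open>Total variation, conditional laws and seeds\<close>

lemma prob_space_unif01: "prob_space unif01"
  unfolding unif01_def by (rule prob_space_restrict_space) auto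

lemma sets_unif01 [measurable_cong]: "sets unif01 = sets (restrict_space borel {0..1})"
  unfolding unif01_def by (rule sets_restrict_space_cong) simp

lemma space_unif01 [simp]: "space unif01 = {0..1}"
  by (simp add: unif01_def space_restrict_space)

lemma measurable_unif01_iff: "g \<in> measurable K unif01 \<longleftrightarrow> g \<in> measurable K (restrict_space borel {0..1})"
  by (simp add: measurable_cong_sets[OF refl sets_unif01])

lemma measure_unif01_initial_segment:
  assumes "0 \<le> c" "c \<le> 1"
  shows "measure unif01 {0..c} = c"
  unfolding unif01_def using assms by (subst measure_restrict_space) auto

lemma integrable_bounded:
  fixes f :: "'a \<Rightarrow> real"
  assumes "prob_space M" "f \<in> borel_measurable M" "\<And>x. x \<in> space M \<Longrightarrow> \<bar>f x\<bar> \<le> B"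
  shows "integrable M f"
proof -
  interpret prob_space M by fact
  show ?thesis using assms by (intro integrable_const_bound[of f B]) auto
qed

text \<open>
  Without integrability the integral is \<open>0\<close>, and the bound holds because \<open>B\<close> is nonnegative.
\<close>

lemma abs_integral_le:
  fixes f :: "'a \<Rightarrow> real"
  assumes "prob_space M" and bound: "\<And>x. x \<in> space M \<Longrightarrow> \<bar>f x\<bar> \<le> B"
  shows "\<bar>\<integral>x. f x \<partial>M\<bar> \<le> B"
proof -
  interpret prob_space M by fact
  show ?thesis
  proof (cases "integrable M f")
    case True
    then have "\<bar>\<integral>x. f x \<partial>M\<bar> \<le> (\<integral>x. B \<partial>M)"
      using bound by (intro order_trans[OF integral_abs_bound integral_mono]) auto
    then show ?thesis using prob_space by simp
  next
    case False
    obtain x where "x \<in> space M" using not_empty by blast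
    from order_trans[OF abs_ge_zero bound[OF this]] show ?thesis
      using False by (simp add: not_integrable_integral_eq)
  qed
qed

lemma abs_measure_diff_le_TV:
  assumes "prob_space P" "prob_space Q" "sets P = sets Q" "A \<in> sets P"
  shows "\<bar>measure P A - measure Q A\<bar> \<le> TV P Q"
proof -
  interpret P: prob_space P by fact
  interpret Q: prob_space Q by fact
  have "\<bar>measure P A - measure Q A\<bar> \<le> 1" for A
    using P.prob_le_1[of A] Q.prob_le_1[of A] measure_nonneg[of P A] measure_nonneg[of Q A]
    by arith
  then have "bdd_above ((\<lambda>A. \<bar>measure P A - measure Q A\<bar>) ` sets P)" by (intro bdd_aboveI2)
  then show ?thesis unfolding TV_def using assms(4) by (intro cSUP_upper)
qed

text \<open>
  A number in \<open>[0, 1]\<close> is the probability that a uniform variable does not exceed it. By Fubini's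
  theorem the integral of a function with values in \<open>[0, 1]\<close> becomes an average of probabilities of events.
\<close>

lemma layer_cake_unif01:
  assumes P: "prob_space P" and f: "f \<in> borel_measurable P"
    and range: "\<And>x. x \<in> space P \<Longrightarrow> 0 \<le> f x \<and> f x \<le> (1::real)"
  shows "(\<integral>x. f x \<partial>P) = (\<integral>s. measure P {x \<in> space P. s \<le> f x} \<partial>unif01)"
    and "integrable unif01 (\<lambda>s. measure P {x \<in> space P. s \<le> f x})"
proof -
  interpret P: prob_space P by fact
  interpret U: prob_space unif01 by (rule prob_space_unif01)
  interpret PU: pair_prob_space P unif01 ..
  note f[measurable]
  let ?F = "\<lambda>x s. indicator {s. s \<le> f x} s :: real"
  have meas: "case_prod ?F \<in> borel_measurable (P \<Otimes>\<^sub>M unif01)"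
  proof -
    have [measurable]: "(\<lambda>s. s) \<in> borel_measurable unif01"
      by (simp add: sets_unif01 measurable_restrict_space1 cong: measurable_cong_sets)
    show ?thesis by measurable
  qed
  have int: "integrable (P \<Otimes>\<^sub>M unif01) (case_prod ?F)"
    by (rule integrable_bounded[OF _ meas, of 1]) (auto simp: indicator_def intro: PU.prob_space_axioms)
  have in1: "(\<integral>s. ?F x s \<partial>unif01) = f x" if "x \<in> space P" for x
  proof -
    have "(\<integral>s. ?F x s \<partial>unif01) = (\<integral>s. indicator {0..f x} s \<partial>unif01)"
      by (rule Bochner_Integration.integral_cong) (auto simp: indicator_def)
    also have "\<dots> = measure unif01 {0..f x}"
      using range[OF that] by (simp add: inf_absorb1 subset_iff)
    also have "\<dots> = f x" using range[OF that] by (simp add: measure_unif01_initial_segment)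
    finally show ?thesis .
  qed
  have in2: "(\<integral>x. ?F x s \<partial>P) = measure P {x \<in> space P. s \<le> f x}" for s
  proof -
    have "(\<integral>x. ?F x s \<partial>P) = (\<integral>x. indicator {x \<in> space P. s \<le> f x} x \<partial>P)"
      by (rule Bochner_Integration.integral_cong) (auto simp: indicator_def)
    then show ?thesis by simp
  qed
  have "(\<integral>x. f x \<partial>P) = (\<integral>x. (\<integral>s. ?F x s \<partial>unif01) \<partial>P)"
    using in1 by (intro Bochner_Integration.integral_cong) auto
  also have "\<dots> = (\<integral>s. (\<integral>x. ?F x s \<partial>P) \<partial>unif01)" using PU.Fubini_integral[OF int] by simp
  finally show "(\<integral>x. f x \<partial>P) = (\<integral>s. measure P {x \<in> space P. s \<le> f x} \<partial>unif01)"
    unfolding in2 .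
  show "integrable unif01 (\<lambda>s. measure P {x \<in> space P. s \<le> f x})"
    using PU.integrable_snd[OF int] unfolding in2 .
qed

text \<open>
  Rescaling \<open>f\<close> to take values in \<open>[0, 1]\<close> divides the difference of the integrals by \<open>2 B\<close>, and the layer cake formula writes the
  difference of the rescaled integrals as an average of differences of probabilities.
\<close>

lemma integral_diff_le_TV:
  assumes P: "prob_space P" and Q: "prob_space Q" and sets: "sets P = sets Q"
    and f: "f \<in> borel_measurable P" and bound: "\<And>x. x \<in> space P \<Longrightarrow> \<bar>f x\<bar> \<le> B"
  shows "\<bar>(\<integral>x. f x \<partial>P) - (\<integral>x. f x \<partial>Q)\<bar> \<le> 2 * B * TV P Q"
proof -
  interpret P: prob_space P by fact
  interpret Q: prob_space Q by fact
  have space: "space P = space Q" using sets by (rule sets_eq_imp_space_eq)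
  have fQ: "f \<in> borel_measurable Q" using f sets by (simp cong: measurable_cong_sets)
  obtain x0 where x0: "x0 \<in> space P" using P.not_empty by blast
  have B: "B \<ge> 0" using bound[OF x0] by simp
  show ?thesis
  proof (cases "B = 0")
    case True
    have "f x = 0" if "x \<in> space P" for x using bound[OF that] True by simp
    then have "(\<integral>x. f x \<partial>P) = 0" "(\<integral>x. f x \<partial>Q) = 0"
      using space by (auto intro!: integral_eq_zero_AE)
    then show ?thesis using True by simp
  next
    case False
    then have B: "B > 0" using B by simp
    let ?g = "\<lambda>x. (f x + B) / (2 * B)"
    have gP: "?g \<in> borel_measurable P" and gQ: "?g \<in> borel_measurable Q" using f fQ by measurable
    have range: "0 \<le> ?g x \<and> ?g x \<le> 1" if "x \<in> space P" for x
      using bound[OF that] B by (simp add: abs_le_iff field_simps)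
    have range': "0 \<le> ?g x \<and> ?g x \<le> 1" if "x \<in> space Q" for x using range that space by simp
    let ?h = "\<lambda>s. measure P {x \<in> space P. s \<le> ?g x} - measure Q {x \<in> space Q. s \<le> ?g x}"
    have h: "\<bar>?h s\<bar> \<le> TV P Q" for s
    proof -
      have "{x \<in> space P. s \<le> ?g x} \<in> sets P" using gP by measurable
      from abs_measure_diff_le_TV[OF P Q sets this] show ?thesis using space by simp
    qed
    have "(\<integral>x. ?g x \<partial>P) - (\<integral>x. ?g x \<partial>Q) = (\<integral>s. ?h s \<partial>unif01)"
      using layer_cake_unif01[OF P gP range] layer_cake_unif01[OF Q gQ range'] by simp
    then have g: "\<bar>(\<integral>x. ?g x \<partial>P) - (\<integral>x. ?g x \<partial>Q)\<bar> \<le> TV P Q"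
      using abs_integral_le[OF prob_space_unif01, of ?h "TV P Q"] h by simp
    have iP: "integrable P f" and iQ: "integrable Q f"
      using integrable_bounded[OF P f bound] integrable_bounded[OF Q fQ] bound space by auto
    have "(\<integral>x. ?g x \<partial>P) = ((\<integral>x. f x \<partial>P) + B) / (2 * B)"
      using iP by (simp add: P.prob_space)
    moreover have "(\<integral>x. ?g x \<partial>Q) = ((\<integral>x. f x \<partial>Q) + B) / (2 * B)"
      using iQ by (simp add: Q.prob_space)
    ultimately have "(\<integral>x. f x \<partial>P) - (\<integral>x. f x \<partial>Q) = 2 * B * ((\<integral>x. ?g x \<partial>P) - (\<integral>x. ?g x \<partial>Q))"
      using B by (simp add: field_simps)
    then show ?thesis using g B by (simp add: abs_mult)
  qed
qed

text \<open>
  Both sides integrate \<open>\<Phi>\<close> against a measure on pairs of a history and a next observation: the joint law of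
  the two, and the composition of the law of the history with the kernel. The definition of the
  conditional law says that these measures agree on rectangles, hence they are equal.
\<close>

lemma cond_law_integral:
  fixes \<Phi> :: "(nat \<Rightarrow> 'b::euclidean_space) \<Rightarrow> 'b \<Rightarrow> real"
  assumes M: "prob_space M" and law: "cond_law M \<Xi> \<xi> (Suc t) \<kappa>"
    and hist: "hist \<xi> t \<in> measurable M (hist_space \<Xi> t)"
    and xi: "\<xi> (Suc t) \<in> measurable M (restrict_space borel (\<Xi> (Suc t)))"
    and \<Phi>: "case_prod \<Phi> \<in> borel_measurable (hist_space \<Xi> t \<Otimes>\<^sub>M restrict_space borel (\<Xi> (Suc t)))"
    and bound: "\<And>h s. h \<in> space (hist_space \<Xi> t) \<Longrightarrow> s \<in> \<Xi> (Suc t) \<Longrightarrow> \<bar>\<Phi> h s\<bar> \<le> B"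
  shows "(\<integral>\<omega>. \<Phi> (hist \<xi> t \<omega>) (\<xi> (Suc t) \<omega>) \<partial>M) = (\<integral>\<omega>. (\<integral>s. \<Phi> (hist \<xi> t \<omega>) s \<partial>\<kappa> (hist \<xi> t \<omega>)) \<partial>M)"
    and "(\<lambda>h. \<integral>s. \<Phi> h s \<partial>\<kappa> h) \<in> borel_measurable (hist_space \<Xi> t)"
proof -
  define H where "H = hist_space \<Xi> t"
  define S where "S = restrict_space borel (\<Xi> (Suc t))"
  have spS: "space S = \<Xi> (Suc t)" by (simp add: S_def space_restrict_space)
  note hist[folded H_def, measurable] xi[folded S_def, measurable] \<Phi>[folded H_def S_def, measurable]
  interpret M: prob_space M by fact
  have \<kappa>: "\<kappa> \<in> measurable H (prob_algebra S)"
    and rect: "\<And>A C. A \<in> sets H \<Longrightarrow> C \<in> sets S \<Longrightarrow>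
      measure M {\<omega>\<in>space M. hist \<xi> t \<omega> \<in> A \<and> \<xi> (Suc t) \<omega> \<in> C}
          = (\<integral>\<omega>. indicator A (hist \<xi> t \<omega>) * measure (\<kappa> (hist \<xi> t \<omega>)) C \<partial>M)"
    using law unfolding cond_law_def H_def S_def by auto
  have \<kappa>s[measurable]: "\<kappa> \<in> measurable H (subprob_algebra S)" by (rule measurable_prob_algebraD[OF \<kappa>])
  have sets_\<kappa>: "sets (\<kappa> h) = sets S" and prob_\<kappa>: "prob_space (\<kappa> h)" if "h \<in> space H" for h
    using measurable_space[OF \<kappa> that] by (auto simp: space_prob_algebra)
  define K where "K h = distr (\<kappa> h) (H \<Otimes>\<^sub>M S) (Pair h)" for h
  have K[measurable]: "K \<in> measurable H (subprob_algebra (H \<Otimes>\<^sub>M S))"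
    unfolding K_def by (rule measurable_distr2[where M=S]) auto
  have pair_h: "Pair h \<in> measurable (\<kappa> h) (H \<Otimes>\<^sub>M S)" if "h \<in> space H" for h
    using that sets_\<kappa>[OF that] by (simp cong: measurable_cong_sets)
  have prob_K: "prob_space (K h)" if "h \<in> space H" for h
    unfolding K_def by (intro prob_space.prob_space_distr prob_\<kappa> that pair_h)
  define P where "P = distr M H (hist \<xi> t)"
  interpret P: prob_space P unfolding P_def by (rule M.prob_space_distr) measurable
  have KP[measurable]: "K \<in> measurable P (subprob_algebra (H \<Otimes>\<^sub>M S))" unfolding P_def by simp
  let ?\<mu> = "distr M (H \<Otimes>\<^sub>M S) (\<lambda>\<omega>. (hist \<xi> t \<omega>, \<xi> (Suc t) \<omega>))"
  interpret mu: prob_space ?\<mu> by (rule M.prob_space_distr) measurable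
  have prob_b: "prob_space (P \<bind> K)"
    by (rule P.prob_space_bind[OF _ KP]) (auto intro!: AE_I2 prob_K simp: P_def)
  interpret nu: prob_space "P \<bind> K" by (rule prob_b)
  have sets_b: "sets (P \<bind> K) = sets (H \<Otimes>\<^sub>M S)"
    by (rule sets_bind[OF sets_kernel[OF KP]]) (auto simp: P.not_empty)
  have int_K: "(\<integral>x. case_prod \<Phi> x \<partial>K h) = (\<integral>s. \<Phi> h s \<partial>\<kappa> h)" if "h \<in> space H" for h
    unfolding K_def using integral_distr[OF pair_h[OF that] \<Phi>[folded H_def S_def]] by simp
  have "?\<mu> = P \<bind> K"
  proof (rule measure_eqI_generator_eq[OF Int_stable_pair_measure_generator[of H S]])
    show "{a \<times> b |a b. a \<in> sets H \<and> b \<in> sets S} \<subseteq> Pow (space H \<times> space S)"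
      using sets.sets_into_space[of _ H] sets.sets_into_space[of _ S] by blast
    show "sets ?\<mu> = sigma_sets (space H \<times> space S) {a \<times> b |a b. a \<in> sets H \<and> b \<in> sets S}"
      by (simp add: sets_pair_measure)
    show "sets (P \<bind> K) = sigma_sets (space H \<times> space S) {a \<times> b |a b. a \<in> sets H \<and> b \<in> sets S}"
      by (simp add: sets_b sets_pair_measure)
    show "range (\<lambda>_::nat. space H \<times> space S) \<subseteq> {a \<times> b |a b. a \<in> sets H \<and> b \<in> sets S}" by auto
    show "emeasure ?\<mu> (space H \<times> space S) \<noteq> \<infinity>" by simp
    fix X assume "X \<in> {a \<times> b |a b. a \<in> sets H \<and> b \<in> sets S}"
    then obtain A C where X: "X = A \<times> C" and A[measurable]: "A \<in> sets H" and C[measurable]: "C \<in> sets S"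
      by auto
    have "measure ?\<mu> X = measure M {\<omega>\<in>space M. hist \<xi> t \<omega> \<in> A \<and> \<xi> (Suc t) \<omega> \<in> C}"
      unfolding X by (subst measure_distr) (auto intro!: arg_cong[where f="measure M"])
    also have "\<dots> = (\<integral>\<omega>. indicator A (hist \<xi> t \<omega>) * measure (\<kappa> (hist \<xi> t \<omega>)) C \<partial>M)"
      by (rule rect) fact+
    also have "\<dots> = (\<integral>h. indicator A h * measure (\<kappa> h) C \<partial>P)"
      unfolding P_def by (subst integral_distr) auto
    also have "\<dots> = (\<integral>h. measure (K h) X \<partial>P)"
    proof (rule Bochner_Integration.integral_cong[OF refl])
      fix h assume "h \<in> space P"
      then have h: "h \<in> space H" by (simp add: P_def)
      have "measure (K h) X = measure (\<kappa> h) (Pair h -` X \<inter> space (\<kappa> h))"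
        unfolding K_def X by (rule measure_distr[OF pair_h[OF h]]) auto
      also have "Pair h -` X \<inter> space (\<kappa> h) = (if h \<in> A then C else {})"
        using sets.sets_into_space[OF C] sets_eq_imp_space_eq[OF sets_\<kappa>[OF h]] by (auto simp: X)
      finally show "indicator A h * measure (\<kappa> h) C = measure (K h) X" by simp
    qed
    also have "\<dots> = measure (P \<bind> K) X"
      by (rule P.measure_bind[OF KP, symmetric]) (auto simp: X)
    finally show "emeasure ?\<mu> X = emeasure (P \<bind> K) X"
      by (simp add: mu.emeasure_eq_measure nu.emeasure_eq_measure)
  qed (auto simp: space_pair_measure)
  then have "(\<integral>x. case_prod \<Phi> x \<partial>?\<mu>) = (\<integral>x. case_prod \<Phi> x \<partial>(P \<bind> K))" by simp
  also have "\<dots> = (\<integral>h. (\<integral>x. case_prod \<Phi> x \<partial>K h) \<partial>P)"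
  proof (rule integral_bind[OF _ _ KP, where B=B and B'=1])
    show "finite_measure P" by unfold_locales
    show "AE x in P. emeasure (K x) (space (K x)) \<le> ennreal 1"
      using prob_space.emeasure_space_1[OF prob_K] by (intro AE_I2) (simp add: P_def)
  qed (use bound[folded H_def] spS \<Phi>[folded H_def S_def] in \<open>auto simp: space_pair_measure\<close>)
  also have "\<dots> = (\<integral>h. (\<integral>s. \<Phi> h s \<partial>\<kappa> h) \<partial>P)"
    using int_K by (intro Bochner_Integration.integral_cong) (auto simp: P_def)
  finally have eq: "(\<integral>x. case_prod \<Phi> x \<partial>?\<mu>) = (\<integral>h. (\<integral>s. \<Phi> h s \<partial>\<kappa> h) \<partial>P)" .
  have meas: "(\<lambda>h. \<integral>s. \<Phi> h s \<partial>\<kappa> h) \<in> borel_measurable H"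
  proof -
    have "(\<lambda>h. \<integral>x. case_prod \<Phi> x \<partial>K h) \<in> borel_measurable H" by measurable
    then show ?thesis using int_K by (simp cong: measurable_cong)
  qed
  then show "(\<lambda>h. \<integral>s. \<Phi> h s \<partial>\<kappa> h) \<in> borel_measurable (hist_space \<Xi> t)" by (simp add: H_def)
  have "(\<integral>x. case_prod \<Phi> x \<partial>?\<mu>) = (\<integral>\<omega>. \<Phi> (hist \<xi> t \<omega>) (\<xi> (Suc t) \<omega>) \<partial>M)"
    by (subst integral_distr) auto
  moreover have "(\<integral>h. (\<integral>s. \<Phi> h s \<partial>\<kappa> h) \<partial>P) = (\<integral>\<omega>. (\<integral>s. \<Phi> (hist \<xi> t \<omega>) s \<partial>\<kappa> (hist \<xi> t \<omega>)) \<partial>M)"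
    unfolding P_def using meas by (subst integral_distr) auto
  ultimately show "(\<integral>\<omega>. \<Phi> (hist \<xi> t \<omega>) (\<xi> (Suc t) \<omega>) \<partial>M) = (\<integral>\<omega>. (\<integral>s. \<Phi> (hist \<xi> t \<omega>) s \<partial>\<kappa> (hist \<xi> t \<omega>)) \<partial>M)"
    using eq by simp
qed

text \<open>
  If \<open>\<Psi> z\<close> does not depend on the coordinate \<open>i\<close> of \<open>z\<close>, then that coordinate may serve as the
  independent second argument.
\<close>

lemma resample_coordinate:
  fixes \<Psi> :: "('i \<Rightarrow> 'c) \<Rightarrow> 'c \<Rightarrow> real"
  assumes prob_P: "\<And>j. prob_space (P j)" and I: "finite I" "i \<in> I"
    and meas: "case_prod \<Psi> \<in> borel_measurable (PiM I P \<Otimes>\<^sub>M P i)"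
    and bound: "\<And>z u. z \<in> space (PiM I P) \<Longrightarrow> u \<in> space (P i) \<Longrightarrow> \<bar>\<Psi> z u\<bar> \<le> B"
    and indep: "\<And>z a u. \<Psi> (z(i := a)) u = \<Psi> z u"
  shows "(\<integral>z. (\<integral>u. \<Psi> z u \<partial>P i) \<partial>PiM I P) = (\<integral>z. \<Psi> z (z i) \<partial>PiM I P)"
proof -
  interpret product_prob_space P using prob_P by (simp add: product_prob_space_def
      product_sigma_finite_def product_prob_space_axioms_def prob_space_imp_sigma_finite)
  have prob_PI: "prob_space (PiM I P)" by (rule prob_space_PiM) (rule prob_P)
  note meas[measurable]
  have I': "I = insert i (I - {i})" "finite (I - {i})" "i \<notin> I - {i}" using I by auto
  have avg_le: "\<bar>\<integral>u. \<Psi> z u \<partial>P i\<bar> \<le> B" if "z \<in> space (PiM I P)" for z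
    by (rule abs_integral_le[OF prob_P bound[OF that]])
  have i1: "integrable (PiM I P) (\<lambda>z. \<integral>u. \<Psi> z u \<partial>P i)"
    using avg_le by (intro integrable_bounded[of _ _ B] prob_PI) auto
  have i2: "integrable (PiM I P) (\<lambda>z. \<Psi> z (z i))"
  proof (rule integrable_bounded[of _ _ B])
    show "(\<lambda>z. \<Psi> z (z i)) \<in> borel_measurable (PiM I P)"
      using I by measurable
  qed (use bound I in \<open>auto intro: prob_PI simp: space_PiM PiE_mem\<close>)
  have "(\<integral>z. (\<integral>u. \<Psi> z u \<partial>P i) \<partial>PiM I P)
      = (\<integral>x. (\<integral>y. (\<integral>u. \<Psi> (x(i := y)) u \<partial>P i) \<partial>P i) \<partial>PiM (I - {i}) P)"
    using product_integral_insert[OF I'(2,3), of "\<lambda>z. \<integral>u. \<Psi> z u \<partial>P i"] i1 I'(1) by simp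
  also have "\<dots> = (\<integral>x. (\<integral>y. \<Psi> (x(i := y)) ((x(i := y)) i) \<partial>P i) \<partial>PiM (I - {i}) P)"
    by (simp add: indep prob_space.prob_space[OF prob_P])
  also have "\<dots> = (\<integral>z. \<Psi> z (z i) \<partial>PiM I P)"
    using product_integral_insert[OF I'(2,3), of "\<lambda>z. \<Psi> z (z i)"] i2 I'(1) by simp
  finally show ?thesis .
qed

lemma distr_iid_seeds:
  assumes Mi: "prob_space Mi" and seeds: "iid_seeds Mi T L \<zeta>" and T: "1 \<le> T"
  shows "distr Mi (PiM ({1..T} \<times> {0..L}) (\<lambda>_. unif01)) (\<lambda>\<omega>. \<lambda>(t, l)\<in>{1..T} \<times> {0..L}. \<zeta> t l \<omega>)
      = PiM ({1..T} \<times> {0..L}) (\<lambda>_. unif01)"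
proof -
  interpret prob_space Mi by fact
  let ?I = "{1..T} \<times> {0..L}"
  have "?I \<noteq> {}" using T by auto
  moreover have ind: "indep_vars (\<lambda>_. unif01) (\<lambda>(t, l). \<zeta> t l) ?I"
    using seeds unfolding iid_seeds_def by blast
  moreover have "random_variable unif01 ((\<lambda>(t, l). \<zeta> t l) i)" if "i \<in> ?I" for i
    using ind that unfolding indep_vars_def by auto
  ultimately have "distr Mi (PiM ?I (\<lambda>_. unif01)) (\<lambda>\<omega>. \<lambda>i\<in>?I. (\<lambda>(t, l). \<zeta> t l) i \<omega>)
      = PiM ?I (\<lambda>i. distr Mi unif01 ((\<lambda>(t, l). \<zeta> t l) i))"
    using indep_vars_iff_distr_eq_PiM'[where I="?I" and M'="\<lambda>_. unif01" and X="\<lambda>(t, l). \<zeta> t l"] by blast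
  moreover have "PiM ?I (\<lambda>i. distr Mi unif01 ((\<lambda>(t, l). \<zeta> t l) i)) = PiM ?I (\<lambda>_. unif01)"
    using seeds unfolding iid_seeds_def by (intro PiM_cong) auto
  moreover have "(\<lambda>\<omega>. \<lambda>i\<in>?I. (\<lambda>(t, l). \<zeta> t l) i \<omega>) = (\<lambda>\<omega>. \<lambda>(t, l)\<in>?I. \<zeta> t l \<omega>)"
    by (auto simp: fun_eq_iff restrict_def)
  ultimately show ?thesis by simp
qed

section \<open>Gradients of the total cost\<close>

text \<open>
  The partial gradient of the total cost with respect to the decision of stage \<open>t\<close>, as a function of the
  only quantities that it involves: the decisions \<open>a\<close>, \<open>y\<close>, \<open>w\<close> of the stages \<open>t - 1\<close>, \<open>t\<close>, \<open>t + 1\<close> and the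
  observations \<open>s\<close>, \<open>s'\<close> of the stages \<open>t\<close>, \<open>t + 1\<close>. Both the true gradient and the sampled one have this form.
\<close>

definition local_grad ::
    "nat \<Rightarrow> (nat \<Rightarrow> 'a::euclidean_space set) \<Rightarrow> (nat \<Rightarrow> 'a \<Rightarrow> 'a \<Rightarrow> 'b \<Rightarrow> real)
      \<Rightarrow> nat \<Rightarrow> 'a \<Rightarrow> 'a \<Rightarrow> 'a \<Rightarrow> 'b \<Rightarrow> 'b \<Rightarrow> 'a" where
  "local_grad T V f t a y w s s' =
     grad_curr V f t a y s + (if t < T then grad_prev V f (t + 1) y w s' else 0)"

text \<open>
  Stage \<open>1\<close> has no predecessor; reading \<open>0\<close> there lets all stages be summed uniformly.
\<close>

definition pred_stage :: "(nat \<Rightarrow> 'a::zero) \<Rightarrow> nat \<Rightarrow> 'a" where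
  "pred_stage x t = (if t = 1 then 0 else x (t - 1))"

lemma total_cost_eq_sum:
  assumes "1 \<le> T"
  shows "total_cost T f x s = (\<Sum>t=1..T. f t (pred_stage x t) (x t) (s t))"
proof -
  have "(\<Sum>t=1..T. f t (pred_stage x t) (x t) (s t))
      = f 1 (pred_stage x 1) (x 1) (s 1) + (\<Sum>t=Suc 1..T. f t (pred_stage x t) (x t) (s t))"
    using assms by (rule sum.atLeast_Suc_atMost)
  also have "(\<Sum>t=Suc 1..T. f t (pred_stage x t) (x t) (s t)) = (\<Sum>t=2..T. f t (x (t - 1)) (x t) (s t))"
    by (intro sum.cong) (auto simp: pred_stage_def)
  finally show ?thesis by (simp add: total_cost_def pred_stage_def)
qed

text \<open>
  Regroups the derivatives with respect to the preceding decision: each of them is collected at the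
  stage whose decision is varied.
\<close>

lemma sum_shift_stage:
  fixes P :: "nat \<Rightarrow> real"
  assumes "P 1 = 0"
  shows "(\<Sum>t=1..T. if t < T then P (t + 1) else 0) = (\<Sum>t=1..T. P t)"
proof (cases T)
  case (Suc n)
  have "(\<Sum>t=1..Suc n. if t < Suc n then P (t + 1) else 0) = (\<Sum>t=1..n. P (Suc t))" by simp
  also have "\<dots> = (\<Sum>t=Suc 1..Suc n. P t)" by (rule sum.shift_bounds_cl_Suc_ivl[symmetric])
  also have "\<dots> = (\<Sum>t=1..Suc n. P t)"
    using assms by (subst (2) sum.atLeast_Suc_atMost) auto
  finally show ?thesis using Suc by simp
qed simp

text \<open>
  The deterministic part of the problem: costs, feasible sets, gradient bounds and diameter.
\<close>

locale multistage =
  fixes T :: nat and V :: "nat \<Rightarrow> 'a::euclidean_space set" and \<Xi> :: "nat \<Rightarrow> 'b::euclidean_space set"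
    and f :: "nat \<Rightarrow> 'a \<Rightarrow> 'a \<Rightarrow> 'b \<Rightarrow> real" and \<X> :: "nat \<Rightarrow> 'a set"
    and N :: "nat \<Rightarrow> 'a \<Rightarrow> real" and Lip :: "nat \<Rightarrow> real" and D :: real
  assumes T: "1 \<le> T"
    and Xi_ne: "\<And>t. t \<in> {1..T} \<Longrightarrow> \<Xi> t \<noteq> {}"
    and V0: "V 0 = {0}"
    and V: "\<And>t. t \<in> {1..T} \<Longrightarrow> coord_subspace (V t)"
    and f: "\<And>t. t \<in> {1..T} \<Longrightarrow> stage_cost V \<Xi> f t"
    and X: "\<And>t. t \<in> {1..T} \<Longrightarrow> \<X> t \<subseteq> V t \<and> \<X> t \<noteq> {} \<and> compact (\<X> t) \<and> convex (\<X> t)"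
    and norms: "\<And>t. t \<in> {1..T} \<Longrightarrow> is_norm_on (V t) (N t)"
    and lip: "\<And>t x s. t \<in> {1..T} \<Longrightarrow> x \<in> PiE {1..T} \<X> \<Longrightarrow> s \<in> PiE {1..T} \<Xi> \<Longrightarrow>
           dual_norm (V t) (N t) (grad_total T V f t x s) \<le> Lip t"
    and diam: "\<And>x x'. x \<in> PiE {1..T} \<X> \<Longrightarrow> x' \<in> PiE {1..T} \<X> \<Longrightarrow> total_norm T N (\<lambda>t. x t - x' t) \<le> D"
begin

lemma subspace_V: "t \<le> T \<Longrightarrow> subspace (V t)"
  using V[of t] V0 unfolding coord_subspace_def by (cases "t = 0") (auto simp: subspace_span)

lemma X_in_V: "t \<in> {1..T} \<Longrightarrow> x \<in> \<X> t \<Longrightarrow> x \<in> V t"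
  using X by blast

lemma X_diff: "t \<in> {1..T} \<Longrightarrow> x \<in> \<X> t \<Longrightarrow> y \<in> \<X> t \<Longrightarrow> x - y \<in> V t"
  by (rule subspace_diff[OF subspace_V X_in_V X_in_V]) auto

context
  fixes t a y s
  assumes t: "t \<in> {1..T}" and a: "a \<in> V (t - 1)" and y: "y \<in> V t" and s: "s \<in> \<Xi> t"
begin

text \<open>
  The derivative of a stage cost on the product space restricts to partial derivatives in each of the
  two decisions.
\<close>

lemma stage_derivative:
  obtains F' where "((\<lambda>(x, y). f t x y s) has_derivative F') (at (a, y) within V (t - 1) \<times> V t)"
    "((\<lambda>z. f t z y s) has_derivative (\<lambda>h. F' (h, 0))) (at a within V (t - 1))"
    "((\<lambda>z. f t a z s) has_derivative (\<lambda>h. F' (0, h))) (at y within V t)"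
proof -
  have "(\<lambda>(x, y). f t x y s) differentiable (at (a, y) within V (t - 1) \<times> V t)"
    using f[OF t] s a y unfolding stage_cost_def differentiable_on_def by blast
  then obtain F' where F': "((\<lambda>(x, y). f t x y s) has_derivative F') (at (a, y) within V (t - 1) \<times> V t)"
    unfolding differentiable_def by blast
  have "((\<lambda>z. (\<lambda>(x, y). f t x y s) (z, y)) has_derivative (\<lambda>h. F' (h, 0))) (at a within V (t - 1))"
    by (rule has_derivative_in_compose[of "\<lambda>z. (z, y)" "\<lambda>h. (h, 0)"])
      (use y in \<open>auto intro!: derivative_eq_intros has_derivative_subset[OF F']\<close>)
  moreover have "((\<lambda>z. (\<lambda>(x, y). f t x y s) (a, z)) has_derivative (\<lambda>h. F' (0, h))) (at y within V t)"
    by (rule has_derivative_in_compose[of "\<lambda>z. (a, z)" "\<lambda>h. (0, h)"])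
      (use a in \<open>auto intro!: derivative_eq_intros has_derivative_subset[OF F']\<close>)
  ultimately show ?thesis using that[OF F'] by simp
qed

lemma grad_curr_derivative:
  "grad_curr V f t a y s \<in> V t"
  "((\<lambda>z. f t a z s) has_derivative (\<lambda>h. grad_curr V f t a y s \<bullet> h)) (at y within V t)"
proof -
  have d: "(\<lambda>z. f t a z s) differentiable (at y within V t)"
    using stage_derivative unfolding differentiable_def by metis
  show "grad_curr V f t a y s \<in> V t"
    "((\<lambda>z. f t a z s) has_derivative (\<lambda>h. grad_curr V f t a y s \<bullet> h)) (at y within V t)"
    unfolding grad_curr_def using has_derivative_grad_on[OF subspace_V y d] t by auto
qed

lemma grad_prev_derivative:
  "grad_prev V f t a y s \<in> V (t - 1)"
  "((\<lambda>z. f t z y s) has_derivative (\<lambda>h. grad_prev V f t a y s \<bullet> h)) (at a within V (t - 1))"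
proof -
  have d: "(\<lambda>z. f t z y s) differentiable (at a within V (t - 1))"
    using stage_derivative unfolding differentiable_def by metis
  have "t - 1 \<le> T" using t by auto
  from has_derivative_grad_on[OF subspace_V[OF this] a d]
  show "grad_prev V f t a y s \<in> V (t - 1)"
    "((\<lambda>z. f t z y s) has_derivative (\<lambda>h. grad_prev V f t a y s \<bullet> h)) (at a within V (t - 1))"
    unfolding grad_prev_def by auto
qed

lemma stage_gradient_inequality:
  assumes a': "a' \<in> V (t - 1)" and y': "y' \<in> V t"
  shows "f t a y s + grad_prev V f t a y s \<bullet> (a' - a) + grad_curr V f t a y s \<bullet> (y' - y) \<le> f t a' y' s"
proof -
  obtain F' where F': "((\<lambda>(x, y). f t x y s) has_derivative F') (at (a, y) within V (t - 1) \<times> V t)"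
    "((\<lambda>z. f t z y s) has_derivative (\<lambda>h. F' (h, 0))) (at a within V (t - 1))"
    "((\<lambda>z. f t a z s) has_derivative (\<lambda>h. F' (0, h))) (at y within V t)"
    by (rule stage_derivative)
  have sub: "subspace (V (t - 1))" "subspace (V t)" using t by (auto intro!: subspace_V)
  have d: "a' - a \<in> V (t - 1)" "y' - y \<in> V t"
    using sub a a' y y' by (auto intro: subspace_diff)
  have "F' (a' - a, 0) = grad_prev V f t a y s \<bullet> (a' - a)"
    using has_derivative_unique_on_subspace[OF sub(1) a d(1) F'(2) grad_prev_derivative(2)] .
  moreover have "F' (0, y' - y) = grad_curr V f t a y s \<bullet> (y' - y)"
    using has_derivative_unique_on_subspace[OF sub(2) y d(2) F'(3) grad_curr_derivative(2)] .
  moreover have "F' (a' - a, y' - y) = F' (a' - a, 0) + F' (0, y' - y)"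
  proof -
    have "linear F'" using F'(1) has_derivative_linear by blast
    from linear_add[OF this, of "(a' - a, 0)" "(0, y' - y)"] show ?thesis by simp
  qed
  moreover have "convex_on (V (t - 1) \<times> V t) (\<lambda>(x, y). f t x y s)"
    using f[OF t] s unfolding stage_cost_def by blast
  from convex_on_above_tangent[OF this _ _ F'(1), of "(a', y')"]
  have "f t a y s + F' (a' - a, y' - y) \<le> f t a' y' s" using a a' y y' by simp
  ultimately show ?thesis by simp
qed

end

lemma pred_in_stages: "t \<in> {1..T} \<Longrightarrow> t \<noteq> 1 \<Longrightarrow> t - 1 \<in> {1..T}"
  by auto

lemma pred_stage_in_V: "(\<And>j. j \<in> {1..T} \<Longrightarrow> x j \<in> V j) \<Longrightarrow> t \<in> {1..T} \<Longrightarrow> pred_stage x t \<in> V (t - 1)"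
  using V0 pred_in_stages[of t] by (cases "t = 1") (simp_all add: pred_stage_def)

lemma pred_stage_in_X:
  "(\<And>j. j \<in> {1..T} \<Longrightarrow> x j \<in> \<X> j) \<Longrightarrow> t \<in> {1..T} \<Longrightarrow>
    if t = 1 then pred_stage x t = 0 else pred_stage x t \<in> \<X> (t - 1)"
  using pred_in_stages[of t] by (cases "t = 1") (simp_all add: pred_stage_def)

abbreviation stage_grad :: "nat \<Rightarrow> (nat \<Rightarrow> 'a) \<Rightarrow> (nat \<Rightarrow> 'b) \<Rightarrow> 'a" where
  "stage_grad t x s \<equiv> local_grad T V f t (pred_stage x t) (x t) (x (t + 1)) (s t) (s (t + 1))"

lemma total_cost_gradient_inequality:
  assumes x: "\<And>t. t \<in> {1..T} \<Longrightarrow> x t \<in> V t" and x': "\<And>t. t \<in> {1..T} \<Longrightarrow> x' t \<in> V t"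
    and s: "\<And>t. t \<in> {1..T} \<Longrightarrow> s t \<in> \<Xi> t"
  shows "total_cost T f x s + (\<Sum>t=1..T. stage_grad t x s \<bullet> (x' t - x t)) \<le> total_cost T f x' s"
proof -
  let ?p = "\<lambda>t. grad_prev V f t (pred_stage x t) (x t) (s t) \<bullet> (pred_stage x' t - pred_stage x t)"
  let ?c = "\<lambda>t. grad_curr V f t (pred_stage x t) (x t) (s t) \<bullet> (x' t - x t)"
  have "(\<Sum>t=1..T. stage_grad t x s \<bullet> (x' t - x t))
      = (\<Sum>t=1..T. ?c t) + (\<Sum>t=1..T. if t < T then ?p (t + 1) else 0)"
    unfolding sum.distrib[symmetric]
    by (intro sum.cong) (auto simp: local_grad_def inner_add_left pred_stage_def)
  also have "\<dots> = (\<Sum>t=1..T. ?c t) + (\<Sum>t=1..T. ?p t)"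
    by (subst sum_shift_stage) (auto simp: pred_stage_def)
  finally have "total_cost T f x s + (\<Sum>t=1..T. stage_grad t x s \<bullet> (x' t - x t))
      = (\<Sum>t=1..T. f t (pred_stage x t) (x t) (s t) + ?p t + ?c t)"
    by (simp add: total_cost_eq_sum[OF T] sum.distrib)
  also have "\<dots> \<le> (\<Sum>t=1..T. f t (pred_stage x' t) (x' t) (s t))"
    by (intro sum_mono stage_gradient_inequality pred_stage_in_V x x' s) auto
  finally show ?thesis by (simp add: total_cost_eq_sum[OF T])
qed

text \<open>
  Averaging the tangent inequality at the mean point, where the linear terms cancel. This avoids
  stating convexity on a space of tuples.
\<close>

lemma total_cost_Jensen:
  assumes x: "\<And>l t. l \<in> I \<Longrightarrow> t \<in> {1..T} \<Longrightarrow> x l t \<in> V t"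
    and w: "finite I" "\<And>l. l \<in> I \<Longrightarrow> (0::real) \<le> w l" "(\<Sum>l\<in>I. w l) = 1"
    and s: "\<And>t. t \<in> {1..T} \<Longrightarrow> s t \<in> \<Xi> t"
  shows "total_cost T f (\<lambda>t. \<Sum>l\<in>I. w l *\<^sub>R x l t) s \<le> (\<Sum>l\<in>I. w l * total_cost T f (x l) s)"
proof -
  let ?m = "\<lambda>t. \<Sum>l\<in>I. w l *\<^sub>R x l t"
  have m: "?m t \<in> V t" if "t \<in> {1..T}" for t
    using x that subspace_V[of t] by (intro subspace_sum subspace_scale) auto
  have "(\<Sum>l\<in>I. w l * (\<Sum>t=1..T. stage_grad t ?m s \<bullet> (x l t - ?m t)))
      = (\<Sum>l\<in>I. \<Sum>t=1..T. w l * (stage_grad t ?m s \<bullet> (x l t - ?m t)))"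
    by (simp add: sum_distrib_left)
  also have "\<dots> = (\<Sum>t=1..T. \<Sum>l\<in>I. w l * (stage_grad t ?m s \<bullet> (x l t - ?m t)))" by (rule sum.swap)
  also have "\<dots> = (\<Sum>t=1..T. stage_grad t ?m s \<bullet> (\<Sum>l\<in>I. w l *\<^sub>R (x l t - ?m t)))"
    by (simp add: inner_sum_right)
  also have "\<dots> = 0"
    using w(3) by (simp add: scaleR_diff_right sum_subtractf scaleR_sum_left[symmetric])
  finally have "total_cost T f ?m s = (\<Sum>l\<in>I. w l) * total_cost T f ?m s
      + (\<Sum>l\<in>I. w l * (\<Sum>t=1..T. stage_grad t ?m s \<bullet> (x l t - ?m t)))" using w(3) by simp
  also have "\<dots> = (\<Sum>l\<in>I. w l * (total_cost T f ?m s + (\<Sum>t=1..T. stage_grad t ?m s \<bullet> (x l t - ?m t))))"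
    by (simp add: sum_distrib_right distrib_left sum.distrib)
  also have "\<dots> \<le> (\<Sum>l\<in>I. w l * total_cost T f (x l) s)"
    by (intro sum_mono mult_left_mono total_cost_gradient_inequality x m s w) auto
  finally show ?thesis .
qed

lemma local_grad_in_V:
  assumes "t \<in> {1..T}" "a \<in> V (t - 1)" "y \<in> V t" "t < T \<Longrightarrow> w \<in> V (t + 1)" "s \<in> \<Xi> t"
    "t < T \<Longrightarrow> s' \<in> \<Xi> (t + 1)"
  shows "local_grad T V f t a y w s s' \<in> V t"
proof -
  have "grad_curr V f t a y s \<in> V t" using assms by (intro grad_curr_derivative)
  moreover have "grad_prev V f (t + 1) y w s' \<in> V t" if "t < T"
    using grad_prev_derivative(1)[of "t + 1" y w s'] assms that by simp
  moreover have "subspace (V t)" using assms(1) by (intro subspace_V) auto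
  ultimately show ?thesis by (auto simp: local_grad_def subspace_add)
qed

lemma grad_total_eq_stage_grad:
  assumes t: "t \<in> {1..T}" and x: "\<And>t. t \<in> {1..T} \<Longrightarrow> x t \<in> V t" and s: "\<And>t. t \<in> {1..T} \<Longrightarrow> s t \<in> \<Xi> t"
  shows "grad_total T V f t x s = stage_grad t x s"
  unfolding grad_total_def
proof (rule grad_on_eq)
  show "subspace (V t)" using t by (intro subspace_V) auto
  show "x t \<in> V t" using x t by blast
  show "stage_grad t x s \<in> V t"
    using t x s by (intro local_grad_in_V pred_stage_in_V) auto
  let ?D = "\<lambda>j h. if j = t then grad_curr V f t (pred_stage x t) (x t) (s t) \<bullet> h
      else if j = t + 1 then grad_prev V f (t + 1) (x t) (x (t + 1)) (s (t + 1)) \<bullet> h else 0"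
  have "((\<lambda>z. \<Sum>j=1..T. f j (pred_stage (x(t := z)) j) ((x(t := z)) j) (s j)) has_derivative
      (\<lambda>h. \<Sum>j=1..T. ?D j h)) (at (x t) within V t)"
  proof (rule has_derivative_sum)
    fix j assume j: "j \<in> {1..T}"
    consider "j = t" | "j = t + 1" | "j \<noteq> t" "j \<noteq> t + 1" by blast
    then show "((\<lambda>z. f j (pred_stage (x(t := z)) j) ((x(t := z)) j) (s j)) has_derivative ?D j) (at (x t) within V t)"
    proof cases
      case 1
      then have "pred_stage (x(t := z)) j = pred_stage x t" for z using j by (auto simp: pred_stage_def)
      then show ?thesis
        using grad_curr_derivative(2)[OF t pred_stage_in_V[OF x t] x[OF t] s[OF t]] 1 by simp
    next
      case 2
      then have "pred_stage (x(t := z)) j = z" for z using t by (auto simp: pred_stage_def)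
      then show ?thesis
        using grad_prev_derivative(2)[of j "x t" "x j" "s j"] x s t j 2 by simp
    next
      case 3
      then have "pred_stage (x(t := z)) j = pred_stage x j" for z using j by (auto simp: pred_stage_def)
      then show ?thesis using 3 by simp
    qed
  qed
  moreover have "(\<Sum>j=1..T. ?D j h) = stage_grad t x s \<bullet> h" for h
  proof -
    have "(\<Sum>j=1..T. ?D j h) = (\<Sum>j=1..T. (if j = t then grad_curr V f t (pred_stage x t) (x t) (s t) \<bullet> h else 0)
        + (if j = t + 1 then grad_prev V f (t + 1) (x t) (x (t + 1)) (s (t + 1)) \<bullet> h else 0))"
      by (intro sum.cong) auto
    then show ?thesis
      using t by (simp add: sum.distrib local_grad_def inner_add_left)
  qed
  ultimately show "((\<lambda>z. total_cost T f (x(t := z)) s) has_derivative (\<bullet>) (stage_grad t x s)) (at (x t) within V t)"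
    by (simp add: total_cost_eq_sum[OF T])
qed

text \<open>
  The bound on the gradient is assumed at complete decision and scenario tuples. The values of
  the stages near \<open>t\<close> are completed to such tuples by arbitrary feasible values.
\<close>

lemma local_grad_bound:
  assumes t: "t \<in> {1..T}" and a: "if t = 1 then a = 0 else a \<in> \<X> (t - 1)" and y: "y \<in> \<X> t"
    and w: "t < T \<Longrightarrow> w \<in> \<X> (t + 1)" and s: "s \<in> \<Xi> t" and s': "t < T \<Longrightarrow> s' \<in> \<Xi> (t + 1)"
    and d: "d \<in> V t"
  shows "\<bar>local_grad T V f t a y w s s' \<bullet> d\<bar> \<le> Lip t * N t d"
proof -
  \<comment> \<open>for \<open>t = 1\<close> the case \<open>j = t - 1\<close> does not occur in the index set, and for \<open>t = T\<close> the case \<open>j = t + 1\<close> does not\<close>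
  define x where "x = (\<lambda>j\<in>{1..T}. if j = t then y else if j = t + 1 then w
      else if j = t - 1 then a else (SOME x. x \<in> \<X> j))"
  define r where "r = (\<lambda>j\<in>{1..T}. if j = t then s else if j = t + 1 then s' else (SOME x. x \<in> \<Xi> j))"
  have pick: "(SOME x. x \<in> \<X> j) \<in> \<X> j" "(SOME x. x \<in> \<Xi> j) \<in> \<Xi> j" if "j \<in> {1..T}" for j
    using X[OF that] Xi_ne[OF that] by (auto simp: some_in_eq)
  have x: "x \<in> PiE {1..T} \<X>" and r: "r \<in> PiE {1..T} \<Xi>"
    using t a y w s s' pick by (auto simp: x_def r_def split: if_splits)
  have xV: "x j \<in> V j" and rj: "r j \<in> \<Xi> j" if "j \<in> {1..T}" for j
    using x r X_in_V that by (auto simp: PiE_mem)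
  have "stage_grad t x r = local_grad T V f t a y w s s'"
    using t a by (auto simp: local_grad_def pred_stage_def x_def r_def split: if_splits)
  then have "grad_total T V f t x r = local_grad T V f t a y w s s'"
    using grad_total_eq_stage_grad[OF t xV rj] by simp
  then have "dual_norm (V t) (N t) (local_grad T V f t a y w s s') \<le> Lip t" using lip[OF t x r] by simp
  moreover have sub: "subspace (V t)" using t by (intro subspace_V) auto
  have "\<bar>local_grad T V f t a y w s s' \<bullet> d\<bar> \<le> dual_norm (V t) (N t) (local_grad T V f t a y w s s') * N t d"
    by (rule abs_inner_le_dual_norm[OF sub norms[OF t] d])
  moreover have "0 \<le> N t d" using norms[OF t] d by (auto simp: is_norm_on_def)
  ultimately show ?thesis by (meson mult_right_mono order_trans)
qed

lemma weighted_distance_le: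
  assumes x: "\<And>t. t \<in> {1..T} \<Longrightarrow> x t \<in> \<X> t" and x': "\<And>t. t \<in> {1..T} \<Longrightarrow> x' t \<in> \<X> t"
  shows "(\<Sum>t=1..T. (N t (x t - x' t))\<^sup>2) \<le> D\<^sup>2" "0 \<le> D"
proof -
  let ?r = "\<lambda>x. restrict x {1..T}"
  have le: "total_norm T N (\<lambda>t. ?r x t - ?r x' t) \<le> D"
    using x x' by (intro diam) auto
  have eq: "total_norm T N (\<lambda>t. ?r x t - ?r x' t) = sqrt (\<Sum>t=1..T. (N t (x t - x' t))\<^sup>2)"
    unfolding total_norm_def by (intro arg_cong[where f=sqrt] sum.cong) auto
  have nn: "0 \<le> (\<Sum>t=1..T. (N t (x t - x' t))\<^sup>2)" by (intro sum_nonneg) auto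
  show D: "0 \<le> D" using le eq real_sqrt_ge_zero[OF nn] by linarith
  show "(\<Sum>t=1..T. (N t (x t - x' t))\<^sup>2) \<le> D\<^sup>2"
    using le eq by (metis real_sqrt_le_iff D real_sqrt_abs abs_of_nonneg)
qed

lemma N_le_D:
  assumes t: "t \<in> {1..T}" and x: "x \<in> \<X> t" and y: "y \<in> \<X> t"
  shows "0 \<le> N t (x - y)" "N t (x - y) \<le> D"
proof -
  show nn: "0 \<le> N t (x - y)" using norms[OF t] X_diff[OF t x y] by (auto simp: is_norm_on_def)
  define z where "z j = (SOME x. x \<in> \<X> j)" for j
  have z: "z j \<in> \<X> j" if "j \<in> {1..T}" for j using X[OF that] by (auto simp: z_def some_in_eq)
  have *: "(\<Sum>j=1..T. (N j ((z(t := x)) j - (z(t := y)) j))\<^sup>2) \<le> D\<^sup>2" "0 \<le> D"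
    using weighted_distance_le[of "z(t := x)" "z(t := y)"] x y z by auto
  have "(N t ((z(t := x)) t - (z(t := y)) t))\<^sup>2 \<le> (\<Sum>j=1..T. (N j ((z(t := x)) j - (z(t := y)) j))\<^sup>2)"
    using t by (intro member_le_sum) auto
  then have "(N t (x - y))\<^sup>2 \<le> D\<^sup>2" using *(1) by simp
  then show "N t (x - y) \<le> D" using *(2) by (rule power2_le_imp_le)
qed

lemma local_grad_inner_le:
  assumes "t \<in> {1..T}" and "if t = 1 then a = 0 else a \<in> \<X> (t - 1)" and "y \<in> \<X> t"
    and "t < T \<Longrightarrow> w \<in> \<X> (t + 1)" and "s \<in> \<Xi> t" and "t < T \<Longrightarrow> s' \<in> \<Xi> (t + 1)"
    and "x \<in> \<X> t" "x' \<in> \<X> t"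
  shows "\<bar>local_grad T V f t a y w s s' \<bullet> (x - x')\<bar> \<le> \<bar>Lip t\<bar> * D"
proof -
  have "\<bar>local_grad T V f t a y w s s' \<bullet> (x - x')\<bar> \<le> Lip t * N t (x - x')"
    using assms X_diff by (intro local_grad_bound) auto
  also have "\<dots> \<le> \<bar>Lip t\<bar> * D"
    using N_le_D[OF assms(1,7,8)] by (intro mult_mono) auto
  finally show ?thesis .
qed

text \<open>
  The tangent inequality at either point bounds the cost difference from one side. The costs of two
  feasible policies thus differ by a bounded amount, which makes all gaps integrable.
\<close>

lemma total_cost_diff_bound:
  assumes x: "\<And>t. t \<in> {1..T} \<Longrightarrow> x t \<in> \<X> t" and x': "\<And>t. t \<in> {1..T} \<Longrightarrow> x' t \<in> \<X> t"
    and s: "\<And>t. t \<in> {1..T} \<Longrightarrow> s t \<in> \<Xi> t"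
  shows "\<bar>total_cost T f x s - total_cost T f x' s\<bar> \<le> (\<Sum>t=1..T. \<bar>Lip t\<bar> * D)"
proof -
  have lower: "total_cost T f x s - (\<Sum>t=1..T. \<bar>Lip t\<bar> * D) \<le> total_cost T f x' s"
    if x: "\<And>t. t \<in> {1..T} \<Longrightarrow> x t \<in> \<X> t" and x': "\<And>t. t \<in> {1..T} \<Longrightarrow> x' t \<in> \<X> t" for x x'
  proof -
    have "\<bar>\<Sum>t=1..T. stage_grad t x s \<bullet> (x' t - x t)\<bar> \<le> (\<Sum>t=1..T. \<bar>Lip t\<bar> * D)"
    proof (intro order_trans[OF sum_abs] sum_mono)
      fix t assume t: "t \<in> {1..T}"
      show "\<bar>stage_grad t x s \<bullet> (x' t - x t)\<bar> \<le> \<bar>Lip t\<bar> * D"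
        by (rule local_grad_inner_le[OF t pred_stage_in_X[OF x t]]) (use x x' s t in auto)
    qed
    moreover have "total_cost T f x s + (\<Sum>t=1..T. stage_grad t x s \<bullet> (x' t - x t)) \<le> total_cost T f x' s"
      using x x' s X_in_V by (intro total_cost_gradient_inequality) auto
    ultimately show ?thesis by linarith
  qed
  show ?thesis using lower[OF x x'] lower[OF x' x] by linarith
qed

end

section \<open>Measurability and regret of the iterates\<close>

lemma measurable_into_subset:
  assumes "g \<in> measurable K (restrict_space borel A)" "A \<subseteq> B"
  shows "g \<in> measurable K (restrict_space borel B)"
  using assms unfolding measurable_restrict_space2_iff by auto

lemma space_hist_space: "space (hist_space \<Xi> t) = PiE {1..t} \<Xi>"
  by (simp add: hist_space_def space_PiM space_restrict_space)

lemma measurable_history_component: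
  assumes "q \<in> measurable K (hist_space \<Xi> t)" "j \<in> {1..t}"
  shows "(\<lambda>k. q k j) \<in> measurable K (restrict_space borel (\<Xi> j))"
  using measurable_compose[OF assms(1)[unfolded hist_space_def] measurable_component_singleton[OF assms(2)]] .

lemma measurable_history_restrict:
  assumes "q \<in> measurable K (hist_space \<Xi> t)" "j \<le> t"
  shows "(\<lambda>k. restrict (q k) {1..j}) \<in> measurable K (hist_space \<Xi> j)"
  using measurable_compose[OF assms(1)[unfolded hist_space_def] measurable_restrict_subset[of "{1..j}" "{1..t}"]] assms(2)
  by (simp add: hist_space_def)

lemma measurable_history_extend:
  assumes "q \<in> measurable K (hist_space \<Xi> t)" "s \<in> measurable K (restrict_space borel (\<Xi> (t + 1)))"
  shows "(\<lambda>k. (q k)(t + 1 := s k)) \<in> measurable K (hist_space \<Xi> (t + 1))"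
  unfolding hist_space_def
  by (rule measurable_fun_upd[where J="{1..t}"]) (use assms in \<open>auto simp: hist_space_def\<close>)

lemma measurable_hist:
  assumes "\<And>j. j \<in> {1..t} \<Longrightarrow> \<xi> j \<in> measurable M (restrict_space borel (\<Xi> j))"
  shows "hist \<xi> t \<in> measurable M (hist_space \<Xi> t)"
  unfolding hist_def hist_space_def by (rule measurable_restrict) (rule assms)

lemma hist_extend: "hist \<xi> (t + 1) \<omega> = (hist \<xi> t \<omega>)(t + 1 := \<xi> (t + 1) \<omega>)"
  by (auto simp: hist_def fun_eq_iff)

lemma hist_restrict: "j \<le> t \<Longrightarrow> restrict (hist \<xi> t \<omega>) {1..j} = hist \<xi> j \<omega>"
  by (auto simp: hist_def fun_eq_iff)

context multistage
begin

lemma measurable_stage_cost: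
  assumes t: "t \<in> {1..T}" and "a \<in> measurable K (restrict_space borel (V (t - 1)))"
    "y \<in> measurable K (restrict_space borel (V t))" "s \<in> measurable K (restrict_space borel (\<Xi> t))"
  shows "(\<lambda>k. f t (a k) (y k) (s k)) \<in> borel_measurable K"
    and "(\<lambda>k. grad_prev V f t (a k) (y k) (s k)) \<in> borel_measurable K"
    and "(\<lambda>k. grad_curr V f t (a k) (y k) (s k)) \<in> borel_measurable K"
proof -
  let ?A = "restrict_space borel (V (t - 1)) \<Otimes>\<^sub>M (restrict_space borel (V t) \<Otimes>\<^sub>M restrict_space borel (\<Xi> t))"
  have p: "(\<lambda>k. (a k, y k, s k)) \<in> measurable K ?A"
    using assms by (intro measurable_Pair)
  have F: "(\<lambda>(x, y, s). f t x y s) \<in> borel_measurable ?A"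
    "(\<lambda>(x, y, s). grad_prev V f t x y s) \<in> borel_measurable ?A"
    "(\<lambda>(x, y, s). grad_curr V f t x y s) \<in> borel_measurable ?A"
    using f[OF t] unfolding stage_cost_def Let_def by blast+
  show "(\<lambda>k. f t (a k) (y k) (s k)) \<in> borel_measurable K"
    using measurable_compose[OF p F(1)] by simp
  show "(\<lambda>k. grad_prev V f t (a k) (y k) (s k)) \<in> borel_measurable K"
    using measurable_compose[OF p F(2)] by simp
  show "(\<lambda>k. grad_curr V f t (a k) (y k) (s k)) \<in> borel_measurable K"
    using measurable_compose[OF p F(3)] by simp
qed

text \<open>
  Policies \<open>W k\<close> depending on a parameter \<open>k\<close>, measurable in the sense that evaluating them at any
  measurably chosen history gives a measurable feasible decision. With \<open>K\<close> a product, this is joint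
  measurability in parameter and history; quantifying over \<open>q\<close> covers restricted and extended histories
  without changing the parameter space.
\<close>

definition policy_family :: "'k measure \<Rightarrow> ('k \<Rightarrow> nat \<Rightarrow> (nat \<Rightarrow> 'b) \<Rightarrow> 'a) \<Rightarrow> bool" where
  "policy_family K W \<longleftrightarrow> (\<forall>t\<in>{1..T}. \<forall>q\<in>measurable K (hist_space \<Xi> t).
     (\<lambda>k. W k t (q k)) \<in> measurable K (restrict_space borel (\<X> t)))"

definition valid_policy :: "(nat \<Rightarrow> (nat \<Rightarrow> 'b) \<Rightarrow> 'a) \<Rightarrow> bool" where
  "valid_policy W \<longleftrightarrow> (\<forall>t\<in>{1..T}. \<forall>h\<in>PiE {1..t} \<Xi>. W t h \<in> \<X> t)"

lemma valid_policyD: "valid_policy W \<Longrightarrow> t \<in> {1..T} \<Longrightarrow> h \<in> PiE {1..t} \<Xi> \<Longrightarrow> W t h \<in> \<X> t"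
  unfolding valid_policy_def by blast

lemma policy_familyD:
  "policy_family K W \<Longrightarrow> t \<in> {1..T} \<Longrightarrow> q \<in> measurable K (hist_space \<Xi> t) \<Longrightarrow>
    (\<lambda>k. W k t (q k)) \<in> measurable K (restrict_space borel (\<X> t))"
  unfolding policy_family_def by blast

lemma valid_policy_member:
  assumes "policy_family K W" "k \<in> space K"
  shows "valid_policy (W k)"
  unfolding valid_policy_def
proof (intro ballI)
  fix t h assume t: "t \<in> {1..T}" and h: "h \<in> PiE {1..t} \<Xi>"
  have "(\<lambda>_. h) \<in> measurable K (hist_space \<Xi> t)" using h by (simp add: space_hist_space)
  from measurable_space[OF policy_familyD[OF assms(1) t this] assms(2)]
  show "W k t h \<in> \<X> t" by (simp add: space_restrict_space)
qed

lemma policy_family_const: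
  assumes "\<And>t. t \<in> {1..T} \<Longrightarrow> W t \<in> policies \<Xi> t (\<X> t)"
  shows "policy_family K (\<lambda>_. W)"
  unfolding policy_family_def
proof (intro ballI)
  fix t q assume "t \<in> {1..T}" "q \<in> measurable K (hist_space \<Xi> t)"
  then show "(\<lambda>k. W t (q k)) \<in> measurable K (restrict_space borel (\<X> t))"
    using measurable_compose[of q K _ "W t"] assms unfolding policies_def by blast
qed

text \<open>
  The partial gradient of stage \<open>t\<close> along a policy, at the history \<open>h\<close> continued by the observation \<open>s\<close>. Inserting
  the true next observation gives the gradient of the cost, inserting a sampled one gives the
  stochastic gradient.
\<close>

definition history_grad ::
    "(nat \<Rightarrow> (nat \<Rightarrow> 'b) \<Rightarrow> 'a) \<Rightarrow> nat \<Rightarrow> (nat \<Rightarrow> 'b) \<Rightarrow> 'b \<Rightarrow> 'a" where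
  "history_grad W t h s = local_grad T V f t (if t = 1 then 0 else W (t - 1) (restrict h {1..t - 1}))
     (W t h) (W (t + 1) (h(t + 1 := s))) (h t) s"

lemma stoch_grad_eq_history_grad:
  "stoch_grad T V f sam W u t h = history_grad W t h (sam (t + 1) h u)"
  by (simp add: stoch_grad_def history_grad_def local_grad_def Let_def)

lemma stage_grad_induced:
  assumes "t \<in> {1..T}"
  shows "stage_grad t (induced \<xi> W \<omega>) (\<lambda>t. \<xi> t \<omega>) = history_grad W t (hist \<xi> t \<omega>) (\<xi> (t + 1) \<omega>)"
proof -
  have "pred_stage (induced \<xi> W \<omega>) t
      = (if t = 1 then 0 else W (t - 1) (restrict (hist \<xi> t \<omega>) {1..t - 1}))"
    using hist_restrict[of "t - 1" t \<xi> \<omega>] by (simp add: pred_stage_def induced_def)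
  moreover have "hist \<xi> t \<omega> t = \<xi> t \<omega>" using assms by (simp add: hist_def)
  moreover have "induced \<xi> W \<omega> (t + 1) = W (t + 1) ((hist \<xi> t \<omega>)(t + 1 := \<xi> (t + 1) \<omega>))"
    unfolding induced_def hist_extend ..
  moreover have "induced \<xi> W \<omega> t = W t (hist \<xi> t \<omega>)" by (simp add: induced_def)
  ultimately show ?thesis unfolding history_grad_def by simp
qed

lemma measurable_history_grad:
  assumes W: "policy_family K W" and t: "t \<in> {1..T}" and q: "q \<in> measurable K (hist_space \<Xi> t)"
    and s: "t < T \<Longrightarrow> s \<in> measurable K (restrict_space borel (\<Xi> (t + 1)))"
  shows "(\<lambda>k. history_grad (W k) t (q k) (s k)) \<in> borel_measurable K"
proof -
  have VT: "(\<lambda>k. W k j (p k)) \<in> measurable K (restrict_space borel (V j))"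
    if "j \<in> {1..T}" "p \<in> measurable K (hist_space \<Xi> j)" for j p
    using measurable_into_subset[OF policy_familyD[OF W that]] X[OF that(1)] by blast
  have a: "(\<lambda>k. if t = 1 then 0 else W k (t - 1) (restrict (q k) {1..t - 1}))
      \<in> measurable K (restrict_space borel (V (t - 1)))"
  proof (cases "t = 1")
    case True then show ?thesis using V0 by (simp add: space_restrict_space)
  next
    case False
    have "(\<lambda>k. W k (t - 1) (restrict (q k) {1..t - 1})) \<in> measurable K (restrict_space borel (V (t - 1)))"
      by (rule VT[OF pred_in_stages[OF t False] measurable_history_restrict[OF q]]) simp
    then show ?thesis using False by simp
  qed
  have "(\<lambda>k. grad_curr V f t (if t = 1 then 0 else W k (t - 1) (restrict (q k) {1..t - 1})) (W k t (q k)) (q k t))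
      \<in> borel_measurable K"
    by (rule measurable_stage_cost(3)[OF t a VT[OF t q] measurable_history_component[OF q]])
      (use t in auto)
  moreover have "(\<lambda>k. grad_prev V f (t + 1) (W k t (q k)) (W k (t + 1) ((q k)(t + 1 := s k))) (s k))
      \<in> borel_measurable K" if tT: "t < T"
  proof (rule measurable_stage_cost(2))
    show t1: "t + 1 \<in> {1..T}" using tT by simp
    show "(\<lambda>k. W k t (q k)) \<in> measurable K (restrict_space borel (V (t + 1 - 1)))" using VT[OF t q] by simp
    show "(\<lambda>k. W k (t + 1) ((q k)(t + 1 := s k))) \<in> measurable K (restrict_space borel (V (t + 1)))"
      by (rule VT[OF t1 measurable_history_extend[OF q s[OF tT]]])
    show "s \<in> measurable K (restrict_space borel (\<Xi> (t + 1)))" by (rule s[OF tT])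
  qed
  ultimately show ?thesis
    unfolding history_grad_def local_grad_def by (cases "t < T") auto
qed

lemma history_neighbours:
  assumes W: "valid_policy W" and t: "t \<in> {1..T}" and h: "h \<in> PiE {1..t} \<Xi>" and s: "t < T \<Longrightarrow> s \<in> \<Xi> (t + 1)"
  shows "if t = 1 then (if t = 1 then 0 else W (t - 1) (restrict h {1..t - 1})) = 0
      else (if t = 1 then 0 else W (t - 1) (restrict h {1..t - 1})) \<in> \<X> (t - 1)"
    and "W t h \<in> \<X> t" and "t < T \<Longrightarrow> W (t + 1) (h(t + 1 := s)) \<in> \<X> (t + 1)" and "h t \<in> \<Xi> t"
proof -
  have "restrict h {1..t - 1} \<in> PiE {1..t - 1} \<Xi>" using h t by (auto simp: PiE_mem)
  then show "if t = 1 then (if t = 1 then 0 else W (t - 1) (restrict h {1..t - 1})) = 0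
      else (if t = 1 then 0 else W (t - 1) (restrict h {1..t - 1})) \<in> \<X> (t - 1)"
    using valid_policyD[OF W pred_in_stages[OF t]] by simp
  show "W t h \<in> \<X> t" by (rule valid_policyD[OF W t h])
  show "h t \<in> \<Xi> t" using h t by (auto simp: PiE_mem)
  assume tT: "t < T"
  have "h(t + 1 := s) \<in> PiE {1..t + 1} \<Xi>"
    using h s[OF tT] by (auto simp: PiE_iff extensional_def)
  then show "W (t + 1) (h(t + 1 := s)) \<in> \<X> (t + 1)"
    using tT by (intro valid_policyD[OF W]) auto
qed

lemma history_grad_in_V:
  assumes "valid_policy W" "t \<in> {1..T}" "h \<in> PiE {1..t} \<Xi>" "t < T \<Longrightarrow> s \<in> \<Xi> (t + 1)"
  shows "history_grad W t h s \<in> V t"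
  unfolding history_grad_def
proof (rule local_grad_in_V)
  note nb = history_neighbours[OF assms]
  show "(if t = 1 then 0 else W (t - 1) (restrict h {1..t - 1})) \<in> V (t - 1)"
    using nb(1) X_in_V[OF pred_in_stages[OF assms(2)]] V0 by (cases "t = 1") auto
  show "W t h \<in> V t" using nb(2) X_in_V assms(2) by blast
  show "W (t + 1) (h(t + 1 := s)) \<in> V (t + 1)" if "t < T"
    using nb(3)[OF that] X_in_V[of "t + 1"] that by simp
  show "h t \<in> \<Xi> t" by (rule nb(4))
qed (use assms in auto)

lemma history_grad_bound:
  assumes "valid_policy W" "t \<in> {1..T}" "h \<in> PiE {1..t} \<Xi>" "t < T \<Longrightarrow> s \<in> \<Xi> (t + 1)" "d \<in> V t"
  shows "\<bar>history_grad W t h s \<bullet> d\<bar> \<le> Lip t * N t d"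
  unfolding history_grad_def
  by (rule local_grad_bound[OF assms(2) history_neighbours(1)[OF assms(1-4)]])
    (use history_neighbours(2-4)[OF assms(1-4)] assms in auto)

lemma history_grad_inner_le:
  assumes "valid_policy W" "t \<in> {1..T}" "h \<in> PiE {1..t} \<Xi>" "t < T \<Longrightarrow> s \<in> \<Xi> (t + 1)" "x \<in> \<X> t" "y \<in> \<X> t"
  shows "\<bar>history_grad W t h s \<bullet> (x - y)\<bar> \<le> \<bar>Lip t\<bar> * D"
proof -
  have "\<bar>history_grad W t h s \<bullet> (x - y)\<bar> \<le> Lip t * N t (x - y)"
    using assms X_diff by (intro history_grad_bound) auto
  also have "\<dots> \<le> \<bar>Lip t\<bar> * D"
    using N_le_D[OF assms(2,5,6)] by (intro mult_mono) auto
  finally show ?thesis .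
qed

lemma measurable_policy_cost:
  assumes W: "policy_family K W" and r: "r \<in> measurable K M"
    and xi: "\<And>t. t \<in> {1..T} \<Longrightarrow> \<xi> t \<in> measurable M (restrict_space borel (\<Xi> t))"
  shows "(\<lambda>k. policy_cost T f \<xi> (W k) (r k)) \<in> borel_measurable K"
proof -
  have h: "(\<lambda>k. hist \<xi> j (r k)) \<in> measurable K (hist_space \<Xi> j)" if "j \<in> {1..T}" for j
    by (rule measurable_compose[OF r measurable_hist]) (use xi that in auto)
  have VT: "(\<lambda>k. induced \<xi> (W k) (r k) j) \<in> measurable K (restrict_space borel (V j))" if "j \<in> {1..T}" for j
    unfolding induced_def using measurable_into_subset[OF policy_familyD[OF W that h[OF that]]] X[OF that] by blast
  have "(\<lambda>k. f t (pred_stage (induced \<xi> (W k) (r k)) t) (induced \<xi> (W k) (r k) t) (\<xi> t (r k))) \<in> borel_measurable K"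
    if t: "t \<in> {1..T}" for t
  proof (rule measurable_stage_cost(1)[OF t _ VT[OF t] measurable_compose[OF r xi[OF t]]])
    show "(\<lambda>k. pred_stage (induced \<xi> (W k) (r k)) t) \<in> measurable K (restrict_space borel (V (t - 1)))"
      using V0 VT[OF pred_in_stages[OF t]] by (cases "t = 1") (simp_all add: pred_stage_def space_restrict_space)
  qed
  then show ?thesis unfolding policy_cost_def total_cost_eq_sum[OF T] by (intro borel_measurable_sum)
qed

lemma measurable_N_diff:
  assumes t: "t \<in> {1..T}" and "x \<in> measurable K (restrict_space borel (\<X> t))" "y \<in> measurable K (restrict_space borel (\<X> t))"
  shows "(\<lambda>k. N t (x k - y k)) \<in> borel_measurable K"
proof -
  have "x \<in> borel_measurable K" "y \<in> borel_measurable K" "x \<in> space K \<rightarrow> \<X> t" "y \<in> space K \<rightarrow> \<X> t"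
    using assms unfolding measurable_restrict_space2_iff by auto
  then have "(\<lambda>k. x k - y k) \<in> measurable K (restrict_space borel (V t))"
    unfolding measurable_restrict_space2_iff using X_diff[OF t] by auto
  moreover have "subspace (V t)" using t by (intro subspace_V) auto
  then have "N t \<in> borel_measurable (restrict_space borel (V t))"
    by (intro borel_measurable_continuous_on_restrict continuous_on_norm_on norms[OF t])
  ultimately show ?thesis by (rule measurable_compose)
qed

lemma policy_family_average:
  assumes W: "\<And>l. l \<in> I \<Longrightarrow> policy_family K (\<lambda>k. W k l)"
    and w: "finite I" "\<And>l. l \<in> I \<Longrightarrow> (0::real) \<le> w l" "(\<Sum>l\<in>I. w l) = 1"
  shows "policy_family K (\<lambda>k t h. \<Sum>l\<in>I. w l *\<^sub>R W k l t h)"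
  unfolding policy_family_def
proof (intro ballI)
  fix t q assume t: "t \<in> {1..T}" and q: "q \<in> measurable K (hist_space \<Xi> t)"
  have Wl: "(\<lambda>k. W k l t (q k)) \<in> measurable K (restrict_space borel (\<X> t))" if "l \<in> I" for l
    by (rule policy_familyD[OF W[OF that] t q])
  then have "(\<lambda>k. \<Sum>l\<in>I. w l *\<^sub>R W k l t (q k)) \<in> borel_measurable K"
    unfolding measurable_restrict_space2_iff by (intro borel_measurable_sum borel_measurable_scaleR) auto
  moreover have "(\<Sum>l\<in>I. w l *\<^sub>R W k l t (q k)) \<in> \<X> t" if "k \<in> space K" for k
  proof (rule convex_sum[OF w(1)])
    show "convex (\<X> t)" using X[OF t] by blast
    show "W k l t (q k) \<in> \<X> t" if "l \<in> I" for l
      using measurable_space[OF Wl[OF that] \<open>k \<in> space K\<close>] by (simp add: space_restrict_space)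
  qed (use w in auto)
  ultimately show "(\<lambda>k. \<Sum>l\<in>I. w l *\<^sub>R W k l t (q k)) \<in> measurable K (restrict_space borel (\<X> t))"
    unfolding measurable_restrict_space2_iff by auto
qed

end

text \<open>
  The algorithm, still without a law for the scenarios: the sampler only has to produce possible
  observations in a measurable way.
\<close>

locale stochastic_mirror_descent = multistage T V \<Xi> f \<X> N Lip D
  for T and V :: "nat \<Rightarrow> 'a::euclidean_space set" and \<Xi> :: "nat \<Rightarrow> 'b::euclidean_space set"
    and f and \<X> and N and Lip and D +
  fixes v :: "nat \<Rightarrow> 'a \<Rightarrow> real" and gv :: "nat \<Rightarrow> 'a \<Rightarrow> 'a"
    and sam :: "nat \<Rightarrow> (nat \<Rightarrow> 'b) \<Rightarrow> real \<Rightarrow> 'b" and X0 :: "nat \<Rightarrow> (nat \<Rightarrow> 'b) \<Rightarrow> 'a"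
    and \<gamma> :: "nat \<Rightarrow> real"
  assumes dgf: "\<And>t. t \<in> {1..T} \<Longrightarrow> is_dgf (V t) (N t) (\<X> t) (v t) (gv t)"
    and sampler: "\<And>t. t \<in> {1..T} \<Longrightarrow> t < T \<Longrightarrow> (\<lambda>(h, u). sam (t + 1) h u)
        \<in> measurable (hist_space \<Xi> t \<Otimes>\<^sub>M restrict_space borel {0..1}) (restrict_space borel (\<Xi> (t + 1)))"
    and initial: "\<And>t. t \<in> {1..T} \<Longrightarrow> X0 t \<in> policies \<Xi> t (dgf_dom (V t) (\<X> t) (v t))"
begin

abbreviation iter :: "(nat \<Rightarrow> nat \<Rightarrow> real) \<Rightarrow> nat \<Rightarrow> nat \<Rightarrow> (nat \<Rightarrow> 'b) \<Rightarrow> 'a" where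
  "iter \<equiv> md_iter T V f \<X> v gv sam \<gamma> X0"

abbreviation Xo :: "nat \<Rightarrow> 'a set" where "Xo t \<equiv> dgf_dom (V t) (\<X> t) (v t)"

lemma dgf_stage: "t \<in> {1..T} \<Longrightarrow> dgf_setup (V t) (N t) (\<X> t) (v t) (gv t)"
  using X norms dgf subspace_V[of t] by unfold_locales auto

lemma Xo_subset: "Xo t \<subseteq> \<X> t"
  by (auto simp: dgf_dom_def)

lemma measurable_sample:
  assumes "t \<in> {1..T}" "t < T" "q \<in> measurable K (hist_space \<Xi> t)" "u \<in> measurable K (restrict_space borel {0..1})"
  shows "(\<lambda>k. sam (t + 1) (q k) (u k)) \<in> measurable K (restrict_space borel (\<Xi> (t + 1)))"
  using measurable_compose[OF measurable_Pair[OF assms(3,4)] sampler[OF assms(1,2)]] by simp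

lemma sample_in:
  assumes "t \<in> {1..T}" "t < T" "h \<in> PiE {1..t} \<Xi>" "u \<in> {0..1}"
  shows "sam (t + 1) h u \<in> \<Xi> (t + 1)"
  using measurable_space[OF sampler[OF assms(1,2)], of "(h, u)"] assms(3,4)
  by (simp add: space_pair_measure space_hist_space space_restrict_space)

lemma measurable_stoch_grad:
  assumes W: "policy_family K W" and t: "t \<in> {1..T}" and q: "q \<in> measurable K (hist_space \<Xi> t)"
    and u: "u \<in> measurable K (restrict_space borel {0..1})"
  shows "(\<lambda>k. stoch_grad T V f sam (W k) (u k) t (q k)) \<in> borel_measurable K"
  unfolding stoch_grad_eq_history_grad
  by (rule measurable_history_grad[OF W t q]) (rule measurable_sample[OF t _ q u])

lemma stoch_grad_in_V:
  assumes "valid_policy W" "t \<in> {1..T}" "h \<in> PiE {1..t} \<Xi>" "u \<in> {0..1}"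
  shows "stoch_grad T V f sam W u t h \<in> V t"
  unfolding stoch_grad_eq_history_grad using assms by (intro history_grad_in_V sample_in)

lemma stoch_grad_bound:
  assumes "valid_policy W" "t \<in> {1..T}" "h \<in> PiE {1..t} \<Xi>" "u \<in> {0..1}" "d \<in> V t"
  shows "\<bar>stoch_grad T V f sam W u t h \<bullet> d\<bar> \<le> Lip t * N t d"
  unfolding stoch_grad_eq_history_grad using assms by (intro history_grad_bound sample_in)

lemma iter_Suc:
  "t \<in> {1..T} \<Longrightarrow> iter z (Suc l) t h = prox_map (\<X> t) (v t)
     (\<gamma> l *\<^sub>R stoch_grad T V f sam (iter z l) (z t l) t h - gv t (iter z l t h))"
  by (simp only: md_iter.simps dgf_setup.mirror_update_eq_prox[OF dgf_stage])

text \<open>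
  By induction on the iteration, simultaneously for all stages and all measurable choices of the history:
  the update of stage \<open>t\<close> is the continuous map \<open>prox_map\<close> applied to the stochastic gradient, which
  evaluates the previous iterate at the histories of the stages \<open>t - 1\<close>, \<open>t\<close> and \<open>t + 1\<close>.
\<close>

lemma measurable_iter:
  assumes "\<And>t j. t \<in> {1..T} \<Longrightarrow> j < l \<Longrightarrow> (\<lambda>k. z k t j) \<in> measurable K (restrict_space borel {0..1})"
    and "t \<in> {1..T}" and "q \<in> measurable K (hist_space \<Xi> t)"
  shows "(\<lambda>k. iter (z k) l t (q k)) \<in> measurable K (restrict_space borel (Xo t))"
  using assms
proof (induction l arbitrary: t q)
  case 0
  then show ?case using measurable_compose[OF 0(3)] initial[OF 0(2)] by (simp add: policies_def)
next
  case (Suc l)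
  note t = Suc.prems(2) and q = Suc.prems(3)
  interpret dgf_setup "V t" "N t" "\<X> t" "v t" "gv t" by (rule dgf_stage[OF t])
  have IH: "(\<lambda>k. iter (z k) l j (p k)) \<in> measurable K (restrict_space borel (Xo j))"
    if "j \<in> {1..T}" "p \<in> measurable K (hist_space \<Xi> j)" for j p
    using Suc.IH[OF _ that] Suc.prems(1) by simp
  have fam: "policy_family K (\<lambda>k. iter (z k) l)"
    unfolding policy_family_def using measurable_into_subset[OF IH Xo_subset] by blast
  have seed: "(\<lambda>k. z k t l) \<in> measurable K (restrict_space borel {0..1})" using Suc.prems(1) t by simp
  let ?G = "\<lambda>k. stoch_grad T V f sam (iter (z k) l) (z k t l) t (q k)"
  let ?p = "\<lambda>k. \<gamma> l *\<^sub>R ?G k - gv t (iter (z k) l t (q k))"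
  have x: "(\<lambda>k. iter (z k) l t (q k)) \<in> measurable K (restrict_space borel (Xo t))" by (rule IH[OF t q])
  have "gv t \<in> borel_measurable (restrict_space borel (Xo t))"
    by (rule borel_measurable_continuous_on_restrict[OF gv_cont])
  from measurable_compose[OF x this]
  have "?p \<in> borel_measurable K"
    by (intro borel_measurable_diff borel_measurable_scaleR measurable_stoch_grad[OF fam t q seed]) auto
  moreover have "?p k \<in> V t" if k: "k \<in> space K" for k
  proof -
    have "q k \<in> PiE {1..t} \<Xi>" using measurable_space[OF q k] by (simp add: space_hist_space)
    moreover have "z k t l \<in> {0..1}" using measurable_space[OF seed k] by (simp add: space_restrict_space)
    ultimately have "?G k \<in> V t" by (intro stoch_grad_in_V[OF valid_policy_member[OF fam k] t])
    moreover have "gv t (iter (z k) l t (q k)) \<in> V t"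
      using gv_in measurable_space[OF x k] by (simp add: space_restrict_space)
    ultimately show ?thesis using V by (intro subspace_diff subspace_scale)
  qed
  ultimately have p: "?p \<in> measurable K (restrict_space borel (V t))"
    unfolding measurable_restrict_space2_iff by auto
  have "prox \<in> measurable (restrict_space borel (V t)) (restrict_space borel (Xo t))"
    unfolding measurable_restrict_space2_iff
    using borel_measurable_continuous_on_restrict[OF continuous_on_prox] prox_in by (auto simp: space_restrict_space)
  from measurable_compose[OF p this] show ?case unfolding iter_Suc[OF t] .
qed

lemma policy_family_iter:
  assumes "\<And>t j. t \<in> {1..T} \<Longrightarrow> j < l \<Longrightarrow> (\<lambda>k. z k t j) \<in> measurable K (restrict_space borel {0..1})"
  shows "policy_family K (\<lambda>k. iter (z k) l)"
  unfolding policy_family_def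
proof (intro ballI)
  fix t q assume "t \<in> {1..T}" "q \<in> measurable K (hist_space \<Xi> t)"
  then show "(\<lambda>k. iter (z k) l t (q k)) \<in> measurable K (restrict_space borel (\<X> t))"
    by (intro measurable_into_subset[OF _ Xo_subset] measurable_iter assms)
qed

lemma iter_in_Xo:
  assumes "\<And>t j. t \<in> {1..T} \<Longrightarrow> j < l \<Longrightarrow> z t j \<in> {0..1}" and "t \<in> {1..T}" "h \<in> PiE {1..t} \<Xi>"
  shows "iter z l t h \<in> Xo t"
proof -
  have "(\<lambda>h. iter z l t h) \<in> measurable (hist_space \<Xi> t) (restrict_space borel (Xo t))"
    using assms(1,2) by (intro measurable_iter) (auto simp: space_restrict_space)
  from measurable_space[OF this] show ?thesis using assms(3) by (simp add: space_hist_space space_restrict_space)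
qed

lemma iter_valid:
  assumes "\<And>t j. t \<in> {1..T} \<Longrightarrow> j < l \<Longrightarrow> z t j \<in> {0..1}"
  shows "valid_policy (iter z l)"
  unfolding valid_policy_def
proof (intro ballI)
  fix t h assume "t \<in> {1..T}" "h \<in> PiE {1..t} \<Xi>"
  then have "iter z l t h \<in> Xo t" by (intro iter_in_Xo assms)
  then show "iter z l t h \<in> \<X> t" using Xo_subset by blast
qed

text \<open>
  This is what makes the seeds of iteration \<open>l\<close> independent of the iterate \<open>l\<close>.
\<close>

lemma iter_depends_on_past:
  assumes "\<And>t j. t \<in> {1..T} \<Longrightarrow> j < l \<Longrightarrow> z t j = z' t j" and "t \<in> {1..T}"
  shows "iter z l t h = iter z' l t h"
  using assms
proof (induction l arbitrary: t h)
  case (Suc l)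
  have IH: "iter z l j h = iter z' l j h" if "j \<in> {1..T}" for j h
    using Suc.IH[OF _ that] Suc.prems(1) by simp
  have "stoch_grad T V f sam (iter z l) (z t l) t h = stoch_grad T V f sam (iter z' l) (z t l) t h"
    using Suc.prems(2) IH[OF pred_in_stages[OF Suc.prems(2)]] IH[OF Suc.prems(2)] IH[of "t + 1"]
    by (simp add: stoch_grad_def Let_def)
  then show ?case
    unfolding iter_Suc[OF Suc.prems(2)] using Suc.prems IH by simp
qed simp

text \<open>
  Summing \<open>mirror_step\<close> telescopes the Bregman distances to the comparison point, and the last one is
  nonnegative. The estimate holds at each history separately.
\<close>

lemma mirror_descent_regret:
  assumes z: "\<And>t j. t \<in> {1..T} \<Longrightarrow> j < n \<Longrightarrow> z t j \<in> {0..1}"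
    and \<gamma>: "\<And>l. l < n \<Longrightarrow> \<gamma> l = c" and c: "0 \<le> c"
    and t: "t \<in> {1..T}" and h: "h \<in> PiE {1..t} \<Xi>" and y: "y \<in> \<X> t"
  shows "(\<Sum>l<n. c * (stoch_grad T V f sam (iter z l) (z t l) t h \<bullet> (iter z l t h - y)))
    \<le> bregman (v t) (gv t) y (X0 t h) + real n * c\<^sup>2 * (Lip t)\<^sup>2 / 2"
proof -
  interpret dgf_setup "V t" "N t" "\<X> t" "v t" "gv t" by (rule dgf_stage[OF t])
  let ?D = "\<lambda>l. bregman (v t) (gv t) y (iter z l t h)"
  have "(\<Sum>l<m. c * (stoch_grad T V f sam (iter z l) (z t l) t h \<bullet> (iter z l t h - y)))
    \<le> ?D 0 - ?D m + real m * c\<^sup>2 * (Lip t)\<^sup>2 / 2" if "m \<le> n" for m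
    using that
  proof (induction m)
    case (Suc m)
    let ?G = "stoch_grad T V f sam (iter z m) (z t m) t h"
    have zm: "\<And>t j. t \<in> {1..T} \<Longrightarrow> j < m \<Longrightarrow> z t j \<in> {0..1}" and ztm: "z t m \<in> {0..1}"
      using z Suc.prems t by auto
    have x: "iter z m t h \<in> Xo t" by (rule iter_in_Xo[OF zm t h])
    have "(\<gamma> m *\<^sub>R ?G) \<bullet> (iter z m t h - y)
        \<le> ?D m - bregman (v t) (gv t) y (prox (\<gamma> m *\<^sub>R ?G - gv t (iter z m t h))) + (c * Lip t)\<^sup>2 / 2"
    proof (rule mirror_step[OF x y])
      have "?G \<in> V t" by (rule stoch_grad_in_V[OF iter_valid[OF zm] t h ztm])
      then show "\<gamma> m *\<^sub>R ?G \<in> V t" using V subspace_scale by blast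
      fix d assume "d \<in> V t"
      then have "\<bar>?G \<bullet> d\<bar> \<le> Lip t * N t d"
        by (intro stoch_grad_bound iter_valid zm t h ztm)
      then have "c * \<bar>?G \<bullet> d\<bar> \<le> c * (Lip t * N t d)" using c by (rule mult_left_mono)
      then show "\<bar>(\<gamma> m *\<^sub>R ?G) \<bullet> d\<bar> \<le> c * Lip t * N t d"
        using \<gamma>[of m] Suc.prems c by (simp add: abs_mult mult.assoc)
    qed
    then have "c * (?G \<bullet> (iter z m t h - y)) \<le> ?D m - ?D (Suc m) + c\<^sup>2 * (Lip t)\<^sup>2 / 2"
      unfolding iter_Suc[OF t] using \<gamma>[of m] Suc.prems by (simp add: power_mult_distrib)
    moreover have "real (Suc m) * c\<^sup>2 * (Lip t)\<^sup>2 / 2 = real m * c\<^sup>2 * (Lip t)\<^sup>2 / 2 + c\<^sup>2 * (Lip t)\<^sup>2 / 2"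
      by (simp add: distrib_right add_divide_distrib)
    moreover have "m \<le> n" using Suc.prems by simp
    note Suc.IH[OF this]
    ultimately show ?case unfolding sum.lessThan_Suc by linarith
  qed simp
  from this[of n] have "(\<Sum>l<n. c * (stoch_grad T V f sam (iter z l) (z t l) t h \<bullet> (iter z l t h - y)))
    \<le> ?D 0 - ?D n + real n * c\<^sup>2 * (Lip t)\<^sup>2 / 2" by simp
  moreover have "0 \<le> ?D n" by (rule bregman_nonneg[OF iter_in_Xo[OF z t h] y])
  ultimately show ?thesis by simp
qed

end

section \<open>Bias of the sampled gradients\<close>

text \<open>
  The algorithm together with the law of the scenarios, the bias of the samplers and a feasible
  comparison policy \<open>Xs\<close>.
\<close>

locale stochastic_program = stochastic_mirror_descent T V \<Xi> f \<X> N Lip D v gv sam X0 \<gamma>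
  for T and V :: "nat \<Rightarrow> 'a::euclidean_space set" and \<Xi> :: "nat \<Rightarrow> 'b::euclidean_space set"
    and f and \<X> and N and Lip and D and v gv sam X0 \<gamma> +
  fixes M :: "'w measure" and \<xi> :: "nat \<Rightarrow> 'w \<Rightarrow> 'b" and \<kappa> :: "nat \<Rightarrow> (nat \<Rightarrow> 'b) \<Rightarrow> 'b measure"
    and \<beta> :: "nat \<Rightarrow> real" and Xs :: "nat \<Rightarrow> (nat \<Rightarrow> 'b) \<Rightarrow> 'a"
  assumes prob_M: "prob_space M"
    and xi: "\<And>t. t \<in> {1..T} \<Longrightarrow> \<xi> t \<in> measurable M (restrict_space borel (\<Xi> t))"
    and kernel: "\<And>t. t \<in> {2..T} \<Longrightarrow> cond_law M \<Xi> \<xi> t (\<kappa> t)"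
    and biased: "\<And>t. t \<in> {2..T} \<Longrightarrow> biased_sampler \<Xi> t (\<kappa> t) (\<beta> t) (sam t)"
    and Xs: "\<And>t. t \<in> {1..T} \<Longrightarrow> Xs t \<in> policies \<Xi> t (\<X> t)"
begin

sublocale M: prob_space M by (rule prob_M)

abbreviation H :: "nat \<Rightarrow> 'w \<Rightarrow> nat \<Rightarrow> 'b" where "H \<equiv> hist \<xi>"

abbreviation bias :: "nat \<Rightarrow> real" where
  "bias t \<equiv> (if t < T then 2 * \<beta> (t + 1) * Lip t else 0)"

lemma measurable_H: "t \<in> {1..T} \<Longrightarrow> H t \<in> measurable M (hist_space \<Xi> t)"
  by (rule measurable_hist, rule xi) auto

lemma H_in: "t \<in> {1..T} \<Longrightarrow> \<omega> \<in> space M \<Longrightarrow> H t \<omega> \<in> PiE {1..t} \<Xi>"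
  using measurable_space[OF measurable_H] by (simp add: space_hist_space)

lemma xi_in: "t \<in> {1..T} \<Longrightarrow> \<omega> \<in> space M \<Longrightarrow> \<xi> t \<omega> \<in> \<Xi> t"
  using measurable_space[OF xi] by (simp add: space_restrict_space)

lemma policies_valid:
  assumes "\<And>t. t \<in> {1..T} \<Longrightarrow> W t \<in> policies \<Xi> t (\<X> t)"
  shows "valid_policy W"
  unfolding valid_policy_def
proof (intro ballI)
  fix t h assume t: "t \<in> {1..T}" and h: "h \<in> PiE {1..t} \<Xi>"
  show "W t h \<in> \<X> t"
    using measurable_space[OF assms[OF t, unfolded policies_def], of h] h
    by (simp add: space_hist_space space_restrict_space)
qed

lemma Xs_valid: "valid_policy Xs"
  by (rule policies_valid[OF Xs])

lemma iter_policies: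
  assumes "\<And>t j. t \<in> {1..T} \<Longrightarrow> j < l \<Longrightarrow> z t j \<in> {0..1}" "t \<in> {1..T}"
  shows "iter z l t \<in> policies \<Xi> t (\<X> t)"
proof -
  have "(\<lambda>h. iter z l t h) \<in> measurable (hist_space \<Xi> t) (restrict_space borel (Xo t))"
    using assms by (intro measurable_iter) (auto simp: space_restrict_space)
  from measurable_into_subset[OF this Xo_subset] show ?thesis by (simp add: policies_def)
qed

lemma induced_in_X:
  "valid_policy W \<Longrightarrow> \<omega> \<in> space M \<Longrightarrow> t \<in> {1..T} \<Longrightarrow> induced \<xi> W \<omega> t \<in> \<X> t"
  unfolding induced_def by (intro valid_policyD H_in)

lemma policy_cost_diff_bound:
  assumes "valid_policy W" "valid_policy W'" "\<omega> \<in> space M"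
  shows "\<bar>policy_cost T f \<xi> W \<omega> - policy_cost T f \<xi> W' \<omega>\<bar> \<le> (\<Sum>t=1..T. \<bar>Lip t\<bar> * D)"
  unfolding policy_cost_def using assms
  by (intro total_cost_diff_bound induced_in_X xi_in) auto

lemma integrable_policy_cost_diff:
  assumes "\<And>t. t \<in> {1..T} \<Longrightarrow> W t \<in> policies \<Xi> t (\<X> t)" "\<And>t. t \<in> {1..T} \<Longrightarrow> W' t \<in> policies \<Xi> t (\<X> t)"
  shows "integrable M (\<lambda>\<omega>. policy_cost T f \<xi> W \<omega> - policy_cost T f \<xi> W' \<omega>)"
proof (rule integrable_bounded[OF prob_M])
  have "policy_cost T f \<xi> U \<in> borel_measurable M"
    if U: "\<And>t. t \<in> {1..T} \<Longrightarrow> U t \<in> policies \<Xi> t (\<X> t)" for U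
    by (rule measurable_policy_cost[OF policy_family_const[OF U] measurable_ident_sets[OF refl] xi])
  from borel_measurable_diff[OF this[OF assms(1)] this[OF assms(2)]]
  show "(\<lambda>\<omega>. policy_cost T f \<xi> W \<omega> - policy_cost T f \<xi> W' \<omega>) \<in> borel_measurable M" .
qed (use policy_cost_diff_bound policies_valid assms in blast)

lemma measurable_policy_diff:
  assumes W: "policy_family K W" and t: "t \<in> {1..T}" and q: "q \<in> measurable K (hist_space \<Xi> t)"
  shows "(\<lambda>k. W k t (q k) - Xs t (q k)) \<in> borel_measurable K"
  using policy_familyD[OF W t q] policy_familyD[OF policy_family_const[OF Xs] t q]
  unfolding measurable_restrict_space2_iff by (intro borel_measurable_diff) auto

lemma measurable_distance:
  assumes W: "policy_family K W" and t: "t \<in> {1..T}" and q: "q \<in> measurable K (hist_space \<Xi> t)"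
  shows "(\<lambda>k. N t (W k t (q k) - Xs t (q k))) \<in> borel_measurable K"
  using measurable_N_diff[OF t policy_familyD[OF W t q] policy_familyD[OF policy_family_const[OF Xs] t q]] by simp

lemma integrable_distance:
  assumes W: "\<And>t. t \<in> {1..T} \<Longrightarrow> W t \<in> policies \<Xi> t (\<X> t)" and t: "t \<in> {1..T}"
  shows "integrable M (\<lambda>\<omega>. N t (W t (H t \<omega>) - Xs t (H t \<omega>)))"
proof (rule integrable_bounded[OF prob_M, of _ D])
  show "(\<lambda>\<omega>. N t (W t (H t \<omega>) - Xs t (H t \<omega>))) \<in> borel_measurable M"
    using measurable_distance[OF policy_family_const[OF W] t measurable_H[OF t]] .
  fix \<omega> assume \<omega>: "\<omega> \<in> space M"
  show "\<bar>N t (W t (H t \<omega>) - Xs t (H t \<omega>))\<bar> \<le> D"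
    using N_le_D[OF t valid_policyD[OF policies_valid[OF W] t H_in[OF t \<omega>]]
        valid_policyD[OF Xs_valid t H_in[OF t \<omega>]]] by simp
qed

lemma measurable_gradient_gap:
  assumes W: "policy_family K W" and t: "t \<in> {1..T}" and q: "q \<in> measurable K (hist_space \<Xi> t)"
    and s: "t < T \<Longrightarrow> s \<in> measurable K (restrict_space borel (\<Xi> (t + 1)))"
  shows "(\<lambda>k. history_grad (W k) t (q k) (s k) \<bullet> (W k t (q k) - Xs t (q k))) \<in> borel_measurable K"
  by (intro borel_measurable_inner measurable_history_grad[OF W t q s] measurable_policy_diff[OF W t q])

lemma gradient_gap_bound:
  assumes "valid_policy W" "t \<in> {1..T}" "h \<in> PiE {1..t} \<Xi>" "t < T \<Longrightarrow> s \<in> \<Xi> (t + 1)"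
  shows "\<bar>history_grad W t h s \<bullet> (W t h - Xs t h)\<bar> \<le> \<bar>Lip t\<bar> * D"
  using assms Xs_valid by (intro history_grad_inner_le valid_policyD) auto

lemma integrable_gradient_gap:
  assumes W: "\<And>t. t \<in> {1..T} \<Longrightarrow> W t \<in> policies \<Xi> t (\<X> t)" and t: "t \<in> {1..T}"
  shows "integrable M (\<lambda>\<omega>. history_grad W t (H t \<omega>) (\<xi> (t + 1) \<omega>) \<bullet> (W t (H t \<omega>) - Xs t (H t \<omega>)))"
proof (rule integrable_bounded[OF prob_M])
  show "(\<lambda>\<omega>. history_grad W t (H t \<omega>) (\<xi> (t + 1) \<omega>) \<bullet> (W t (H t \<omega>) - Xs t (H t \<omega>))) \<in> borel_measurable M"
    by (rule measurable_gradient_gap[OF policy_family_const[OF W] t measurable_H[OF t]]) (auto intro: xi)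
  fix \<omega> assume "\<omega> \<in> space M"
  then show "\<bar>history_grad W t (H t \<omega>) (\<xi> (t + 1) \<omega>) \<bullet> (W t (H t \<omega>) - Xs t (H t \<omega>))\<bar> \<le> \<bar>Lip t\<bar> * D"
    using t by (intro gradient_gap_bound policies_valid W H_in xi_in) auto
qed

lemma integrable_sampled_gap:
  assumes W: "\<And>t. t \<in> {1..T} \<Longrightarrow> W t \<in> policies \<Xi> t (\<X> t)" and t: "t \<in> {1..T}" and u: "u \<in> {0..1}"
  shows "integrable M (\<lambda>\<omega>. stoch_grad T V f sam W u t (H t \<omega>) \<bullet> (W t (H t \<omega>) - Xs t (H t \<omega>)))"
  unfolding stoch_grad_eq_history_grad
proof (rule integrable_bounded[OF prob_M])
  show "(\<lambda>\<omega>. history_grad W t (H t \<omega>) (sam (t + 1) (H t \<omega>) u) \<bullet> (W t (H t \<omega>) - Xs t (H t \<omega>))) \<in> borel_measurable M"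
    using u by (intro measurable_gradient_gap[OF policy_family_const[OF W] t measurable_H[OF t]]
        measurable_sample[OF t _ measurable_H[OF t]]) (auto simp: space_restrict_space)
  fix \<omega> assume "\<omega> \<in> space M"
  then show "\<bar>history_grad W t (H t \<omega>) (sam (t + 1) (H t \<omega>) u) \<bullet> (W t (H t \<omega>) - Xs t (H t \<omega>))\<bar> \<le> \<bar>Lip t\<bar> * D"
    using t u by (intro gradient_gap_bound policies_valid W H_in sample_in) auto
qed

text \<open>
  The tangent inequality at the current policy, tested at the comparison policy.
\<close>

lemma cost_gap_le_gradient_gap:
  assumes W: "valid_policy W" and \<omega>: "\<omega> \<in> space M"
  shows "policy_cost T f \<xi> W \<omega> - policy_cost T f \<xi> Xs \<omega>
    \<le> (\<Sum>t=1..T. history_grad W t (H t \<omega>) (\<xi> (t + 1) \<omega>) \<bullet> (W t (H t \<omega>) - Xs t (H t \<omega>)))"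
proof -
  let ?x = "induced \<xi> W \<omega>" and ?y = "induced \<xi> Xs \<omega>" and ?s = "\<lambda>t. \<xi> t \<omega>"
  have "total_cost T f ?x ?s + (\<Sum>t=1..T. stage_grad t ?x ?s \<bullet> (?y t - ?x t)) \<le> total_cost T f ?y ?s"
    using W Xs_valid \<omega> by (intro total_cost_gradient_inequality X_in_V induced_in_X xi_in) auto
  moreover have "(\<Sum>t=1..T. stage_grad t ?x ?s \<bullet> (?y t - ?x t))
      = - (\<Sum>t=1..T. history_grad W t (H t \<omega>) (\<xi> (t + 1) \<omega>) \<bullet> (W t (H t \<omega>) - Xs t (H t \<omega>)))"
    unfolding sum_negf[symmetric]
  proof (rule sum.cong[OF refl])
    fix t assume t: "t \<in> {1..T}"
    have eq: "stage_grad t ?x ?s = history_grad W t (H t \<omega>) (\<xi> (t + 1) \<omega>)"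
      by (rule stage_grad_induced[OF t])
    show "stage_grad t ?x ?s \<bullet> (?y t - ?x t)
        = - (history_grad W t (H t \<omega>) (\<xi> (t + 1) \<omega>) \<bullet> (W t (H t \<omega>) - Xs t (H t \<omega>)))"
      unfolding eq by (simp add: induced_def inner_diff_right)
  qed
  ultimately show ?thesis unfolding policy_cost_def by linarith
qed

lemma measurable_kernel:
  assumes "t \<in> {1..T}" "t < T"
  shows "\<kappa> (t + 1) \<in> measurable (hist_space \<Xi> t) (prob_algebra (restrict_space borel (\<Xi> (t + 1))))"
  using kernel[of "t + 1"] assms unfolding cond_law_def by simp

text \<open>
  Replacing the conditional law by the law of the sampler changes the integral by at most twice the bound of
  the integrand times the total variation distance. The integrand has to include the gradient of the current
  stage cost: it is the whole partial gradient that the Lipschitz constant bounds.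
\<close>

lemma conditional_bias:
  assumes W: "\<And>t. t \<in> {1..T} \<Longrightarrow> W t \<in> policies \<Xi> t (\<X> t)" and t: "t \<in> {1..T}"
    and tT: "t < T" and h: "h \<in> space (hist_space \<Xi> t)"
  shows "(\<integral>s. history_grad W t h s \<bullet> (W t h - Xs t h) \<partial>\<kappa> (t + 1) h)
    \<le> (\<integral>u. stoch_grad T V f sam W u t h \<bullet> (W t h - Xs t h) \<partial>unif01) + bias t * N t (W t h - Xs t h)"
proof -
  let ?S = "restrict_space borel (\<Xi> (t + 1))" and ?d = "W t h - Xs t h"
  let ?P = "distr unif01 ?S (sam (t + 1) h)"
  have t1: "t + 1 \<in> {2..T}" using t tT by auto
  have h': "h \<in> PiE {1..t} \<Xi>" using h by (simp add: space_hist_space)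
  have d: "?d \<in> V t"
    by (intro X_diff t valid_policyD[OF policies_valid[OF W] t h'] valid_policyD[OF Xs_valid t h'])
  have sam: "sam (t + 1) h \<in> measurable unif01 ?S"
  proof -
    have "(\<lambda>u. sam (t + 1) h u) \<in> measurable unif01 ?S"
      by (rule measurable_sample[OF t tT]) (use h measurable_unif01_iff in auto)
    then show ?thesis by simp
  qed
  have P: "prob_space ?P" by (rule prob_space.prob_space_distr[OF prob_space_unif01 sam])
  have "\<kappa> (t + 1) h \<in> space (prob_algebra ?S)"
    by (rule measurable_space[OF measurable_kernel[OF t tT] h])
  then have \<kappa>: "prob_space (\<kappa> (t + 1) h)" "sets (\<kappa> (t + 1) h) = sets ?S"
    by (auto simp: space_prob_algebra)
  have g: "(\<lambda>s. history_grad W t h s \<bullet> ?d) \<in> borel_measurable ?S"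
    using measurable_gradient_gap[OF policy_family_const[OF W] t, of "\<lambda>_. h" ?S "\<lambda>s. s"] h by simp
  have bound: "\<bar>history_grad W t h s \<bullet> ?d\<bar> \<le> Lip t * N t ?d" if "s \<in> \<Xi> (t + 1)" for s
    by (rule history_grad_bound[OF policies_valid[OF W] t h' that d])
  have "\<bar>(\<integral>s. history_grad W t h s \<bullet> ?d \<partial>?P) - (\<integral>s. history_grad W t h s \<bullet> ?d \<partial>\<kappa> (t + 1) h)\<bar>
      \<le> 2 * (Lip t * N t ?d) * TV ?P (\<kappa> (t + 1) h)"
    by (rule integral_diff_le_TV[OF P \<kappa>(1)]) (use \<kappa>(2) g bound in \<open>auto simp: space_restrict_space\<close>)
  also have "\<dots> \<le> 2 * (Lip t * N t ?d) * \<beta> (t + 1)"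
  proof (rule mult_left_mono)
    show "TV ?P (\<kappa> (t + 1) h) \<le> \<beta> (t + 1)"
      using biased[OF t1] h unfolding biased_sampler_def by simp
    obtain s where "s \<in> \<Xi> (t + 1)" using Xi_ne[of "t + 1"] tT by auto
    from bound[OF this] show "0 \<le> 2 * (Lip t * N t ?d)" by simp
  qed
  also have "\<dots> = bias t * N t ?d" using tT by simp
  finally have "(\<integral>s. history_grad W t h s \<bullet> ?d \<partial>\<kappa> (t + 1) h)
      \<le> (\<integral>s. history_grad W t h s \<bullet> ?d \<partial>?P) + bias t * N t ?d" by linarith
  also have "(\<integral>s. history_grad W t h s \<bullet> ?d \<partial>?P) = (\<integral>u. stoch_grad T V f sam W u t h \<bullet> ?d \<partial>unif01)"
    unfolding stoch_grad_eq_history_grad by (rule integral_distr[OF sam g])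
  finally show ?thesis .
qed

text \<open>
  Before the last stage this integrates \<open>conditional_bias\<close> over the history and exchanges the history with
  the sampling variable by Fubini's theorem. At the last stage nothing is sampled and both gradients
  agree.
\<close>

lemma expected_bias:
  assumes W: "\<And>t. t \<in> {1..T} \<Longrightarrow> W t \<in> policies \<Xi> t (\<X> t)" and t: "t \<in> {1..T}"
  shows "(\<integral>\<omega>. history_grad W t (H t \<omega>) (\<xi> (t + 1) \<omega>) \<bullet> (W t (H t \<omega>) - Xs t (H t \<omega>)) \<partial>M)
    \<le> (\<integral>u. (\<integral>\<omega>. stoch_grad T V f sam W u t (H t \<omega>) \<bullet> (W t (H t \<omega>) - Xs t (H t \<omega>)) \<partial>M) \<partial>unif01)
      + bias t * (\<integral>\<omega>. N t (W t (H t \<omega>) - Xs t (H t \<omega>)) \<partial>M)"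
proof (cases "t < T")
  case False
  have indep: "history_grad W t h s = history_grad W t h s'" for h s s'
    using False by (simp add: history_grad_def local_grad_def)
  interpret U: prob_space unif01 by (rule prob_space_unif01)
  have "stoch_grad T V f sam W u t (H t \<omega>) = history_grad W t (H t \<omega>) (\<xi> (t + 1) \<omega>)" for u \<omega>
    unfolding stoch_grad_eq_history_grad by (rule indep)
  then show ?thesis using False U.prob_space by simp
next
  case True
  interpret UM: pair_prob_space unif01 M
    using prob_space_unif01 prob_M by (simp add: pair_prob_space_def pair_sigma_finite_def prob_space_imp_sigma_finite)
  let ?S = "restrict_space borel (\<Xi> (t + 1))" and ?d = "\<lambda>h. W t h - Xs t h"
  let ?g = "\<lambda>h u. stoch_grad T V f sam W u t h \<bullet> ?d h"
  have t1: "t + 1 \<in> {1..T}" "t + 1 \<in> {2..T}" using t True by auto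
  note fam = policy_family_const[OF W] and HM = measurable_H[OF t]
  have \<Phi>: "case_prod (\<lambda>h s. history_grad W t h s \<bullet> ?d h) \<in> borel_measurable (hist_space \<Xi> t \<Otimes>\<^sub>M ?S)"
    using measurable_gradient_gap[OF fam t, of fst "hist_space \<Xi> t \<Otimes>\<^sub>M ?S" snd]
    by (simp add: case_prod_unfold)
  have bound: "\<bar>history_grad W t h s \<bullet> ?d h\<bar> \<le> \<bar>Lip t\<bar> * D" if "h \<in> space (hist_space \<Xi> t)" "s \<in> \<Xi> (t + 1)" for h s
    using that t by (intro gradient_gap_bound policies_valid W) (auto simp: space_hist_space)
  have law: "cond_law M \<Xi> \<xi> (Suc t) (\<kappa> (t + 1))" using kernel[OF t1(2)] by simp
  have xi1: "\<xi> (Suc t) \<in> measurable M (restrict_space borel (\<Xi> (Suc t)))" using xi[OF t1(1)] by simp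
  note cli = cond_law_integral[OF prob_M law HM xi1 \<Phi>[simplified Suc_eq_plus1[symmetric]]
      bound[simplified Suc_eq_plus1[symmetric]]]
  have g_meas: "case_prod (\<lambda>u \<omega>. ?g (H t \<omega>) u) \<in> borel_measurable (unif01 \<Otimes>\<^sub>M M)"
  proof -
    have "(\<lambda>p. H t (snd p)) \<in> measurable (unif01 \<Otimes>\<^sub>M M) (hist_space \<Xi> t)"
      by (rule measurable_compose[OF measurable_snd HM])
    moreover have "fst \<in> measurable (unif01 \<Otimes>\<^sub>M M) (restrict_space borel {0..1})"
      using measurable_fst measurable_unif01_iff by blast
    ultimately show ?thesis unfolding stoch_grad_eq_history_grad case_prod_unfold
      by (intro measurable_gradient_gap[OF fam t] measurable_sample[OF t True])
  qed
  have g_bound: "\<bar>?g (H t \<omega>) u\<bar> \<le> \<bar>Lip t\<bar> * D" if "\<omega> \<in> space M" "u \<in> {0..1}" for \<omega> u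
    unfolding stoch_grad_eq_history_grad
    using that t by (intro gradient_gap_bound policies_valid W H_in sample_in) auto
  have g_int: "integrable (unif01 \<Otimes>\<^sub>M M) (case_prod (\<lambda>u \<omega>. ?g (H t \<omega>) u))"
    by (rule integrable_bounded[OF _ g_meas, of "\<bar>Lip t\<bar> * D"])
      (use g_bound in \<open>auto simp: space_pair_measure intro: UM.prob_space_axioms\<close>)
  have "(\<integral>\<omega>. history_grad W t (H t \<omega>) (\<xi> (t + 1) \<omega>) \<bullet> ?d (H t \<omega>) \<partial>M)
      = (\<integral>\<omega>. (\<integral>s. history_grad W t (H t \<omega>) s \<bullet> ?d (H t \<omega>) \<partial>\<kappa> (t + 1) (H t \<omega>)) \<partial>M)"
    using cli(1) by simp
  also have "\<dots> \<le> (\<integral>\<omega>. (\<integral>u. ?g (H t \<omega>) u \<partial>unif01) + bias t * N t (?d (H t \<omega>)) \<partial>M)"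
  proof (rule integral_mono)
    show "integrable M (\<lambda>\<omega>. (\<integral>u. ?g (H t \<omega>) u \<partial>unif01) + bias t * N t (?d (H t \<omega>)))"
      using UM.integrable_snd[OF g_int] integrable_distance[OF W t] by simp
    show "integrable M (\<lambda>\<omega>. \<integral>s. history_grad W t (H t \<omega>) s \<bullet> ?d (H t \<omega>) \<partial>\<kappa> (t + 1) (H t \<omega>))"
    proof (rule integrable_bounded[OF prob_M, of _ "\<bar>Lip t\<bar> * D"])
      show "(\<lambda>\<omega>. \<integral>s. history_grad W t (H t \<omega>) s \<bullet> ?d (H t \<omega>) \<partial>\<kappa> (t + 1) (H t \<omega>)) \<in> borel_measurable M"
        using measurable_compose[OF HM cli(2)] by simp
      fix \<omega> assume \<omega>: "\<omega> \<in> space M"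
      let ?k = "\<kappa> (t + 1) (H t \<omega>)"
      have h: "H t \<omega> \<in> space (hist_space \<Xi> t)" using measurable_space[OF HM \<omega>] .
      have "?k \<in> space (prob_algebra ?S)"
        by (rule measurable_space[OF measurable_kernel[OF t True] h])
      then have k: "prob_space ?k" "sets ?k = sets ?S" by (auto simp: space_prob_algebra)
      have sp: "space ?k = \<Xi> (t + 1)" using sets_eq_imp_space_eq[OF k(2)] by (simp add: space_restrict_space)
      show "\<bar>\<integral>s. history_grad W t (H t \<omega>) s \<bullet> ?d (H t \<omega>) \<partial>?k\<bar> \<le> \<bar>Lip t\<bar> * D"
        by (rule abs_integral_le[OF k(1)]) (use bound[OF h] sp in blast)
    qed
    fix \<omega> assume "\<omega> \<in> space M"
    note h = measurable_space[OF HM this]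
    show "(\<integral>s. history_grad W t (H t \<omega>) s \<bullet> ?d (H t \<omega>) \<partial>\<kappa> (t + 1) (H t \<omega>))
        \<le> (\<integral>u. ?g (H t \<omega>) u \<partial>unif01) + bias t * N t (?d (H t \<omega>))"
      by (rule conditional_bias[OF W t True h])
  qed
  also have "\<dots> = (\<integral>\<omega>. (\<integral>u. ?g (H t \<omega>) u \<partial>unif01) \<partial>M) + bias t * (\<integral>\<omega>. N t (?d (H t \<omega>)) \<partial>M)"
    using UM.integrable_snd[OF g_int] integrable_distance[OF W t] by simp
  also have "(\<integral>\<omega>. (\<integral>u. ?g (H t \<omega>) u \<partial>unif01) \<partial>M) = (\<integral>u. (\<integral>\<omega>. ?g (H t \<omega>) u \<partial>M) \<partial>unif01)"
    by (rule UM.Fubini_integral[OF g_int])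
  finally show ?thesis .
qed

end

section \<open>Expected gap of the averaged policy\<close>

lemma policy_cost_cong:
  assumes "1 \<le> T" "\<And>t h. t \<in> {1..T} \<Longrightarrow> W t h = W' t h"
  shows "policy_cost T f \<xi> W \<omega> = policy_cost T f \<xi> W' \<omega>"
proof -
  have ind: "induced \<xi> W \<omega> t = induced \<xi> W' \<omega> t" if "t \<in> {1..T}" for t
    unfolding induced_def by (rule assms(2)[OF that])
  have "pred_stage (induced \<xi> W \<omega>) t = pred_stage (induced \<xi> W' \<omega>) t" if "t \<in> {1..T}" for t
  proof (cases "t = 1")
    case False
    then have "t - 1 \<in> {1..T}" using that by auto
    then show ?thesis unfolding pred_stage_def by (simp only: ind)
  qed (simp add: pred_stage_def)
  then show ?thesis unfolding policy_cost_def total_cost_eq_sum[OF assms(1)]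
    using ind by (intro sum.cong) simp_all
qed

lemma GapU_cong:
  assumes "1 \<le> T" "\<And>t h. t \<in> {1..T} \<Longrightarrow> W t h = W' t h"
  shows "GapU M T f \<xi> Xs W = GapU M T f \<xi> Xs W'"
  unfolding GapU_def by (simp only: policy_cost_cong[of T W W', OF assms])

lemma total_bregman_eq_sum:
  "total_bregman T v gv y x = (\<Sum>t=1..T. bregman (v t) (gv t) (y t) (x t))"
  by (simp add: total_bregman_def bregman_def sum_subtractf)

text \<open>
  The setting of the bound: all step sizes up to iteration \<open>L\<close> are equal, so the output is the plain average
  of the iterates.
\<close>

locale constant_step_program = stochastic_program T V \<Xi> f \<X> N Lip D v gv sam X0 \<gamma> M \<xi> \<kappa> \<beta> Xs
  for T and V :: "nat \<Rightarrow> 'a::euclidean_space set" and \<Xi> :: "nat \<Rightarrow> 'b::euclidean_space set"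
    and f and \<X> and N and Lip and D and v gv sam X0 \<gamma>
    and M :: "'w measure" and \<xi> and \<kappa> and \<beta> and Xs +
  fixes L :: nat and c :: real
  assumes step: "\<And>l. l \<le> L \<Longrightarrow> \<gamma> l = c" and c: "0 < c"
begin

abbreviation weight :: real where "weight \<equiv> 1 / (real L + 1)"

abbreviation avg :: "(nat \<Rightarrow> nat \<Rightarrow> real) \<Rightarrow> nat \<Rightarrow> (nat \<Rightarrow> 'b) \<Rightarrow> 'a" where
  "avg z \<equiv> \<lambda>t h. \<Sum>l\<le>L. weight *\<^sub>R iter z l t h"

definition gap :: "(nat \<Rightarrow> nat \<Rightarrow> real) \<Rightarrow> real" where
  "gap z = GapU M T f \<xi> Xs (avg z)"

text \<open>
  The linearized gap of stage \<open>t\<close> at iterate \<open>l\<close> with the gradient sampled by \<open>u\<close>. The variable \<open>u\<close> is kept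
  apart from the seeds \<open>z\<close>, so that it can be integrated out or replaced by \<open>z t l\<close>.
\<close>

definition sampled_gap :: "nat \<Rightarrow> nat \<Rightarrow> (nat \<Rightarrow> nat \<Rightarrow> real) \<Rightarrow> real \<Rightarrow> real" where
  "sampled_gap t l z u =
     (\<integral>\<omega>. stoch_grad T V f sam (iter z l) u t (H t \<omega>) \<bullet> (iter z l t (H t \<omega>) - Xs t (H t \<omega>)) \<partial>M)"

definition mean_dist :: "nat \<Rightarrow> nat \<Rightarrow> (nat \<Rightarrow> nat \<Rightarrow> real) \<Rightarrow> real" where
  "mean_dist t l z = (\<integral>\<omega>. N t (iter z l t (H t \<omega>) - Xs t (H t \<omega>)) \<partial>M)"

definition seeds_in_unit :: "(nat \<Rightarrow> nat \<Rightarrow> real) \<Rightarrow> bool" where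
  "seeds_in_unit z \<longleftrightarrow> (\<forall>t\<in>{1..T}. \<forall>l\<le>L. z t l \<in> {0..1})"

lemma weights: "(\<Sum>l\<le>L. weight) = 1" "0 \<le> weight"
  by (auto simp: add.commute)

lemma md_output_eq_avg: "md_output T V f \<X> v gv sam \<gamma> X0 z L t h = avg z t h"
proof -
  have "(\<Sum>l\<le>L. \<gamma> l) = (real L + 1) * c" using step by simp
  moreover have "(\<Sum>l\<le>L. \<gamma> l *\<^sub>R iter z l t h) = c *\<^sub>R (\<Sum>l\<le>L. iter z l t h)"
    using step by (simp add: scaleR_sum_right)
  ultimately show ?thesis
    unfolding md_output_def using c by (simp add: scaleR_sum_right[symmetric] divide_inverse)
qed

lemma iter_policies_unit:
  assumes "seeds_in_unit z" "l \<le> L" "t \<in> {1..T}"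
  shows "iter z l t \<in> policies \<Xi> t (\<X> t)"
  using assms by (intro iter_policies) (auto simp: seeds_in_unit_def)

lemma avg_policies:
  assumes z: "seeds_in_unit z" and t: "t \<in> {1..T}"
  shows "avg z t \<in> policies \<Xi> t (\<X> t)"
proof -
  have "policy_family (hist_space \<Xi> t) (\<lambda>_. avg z)"
    by (rule policy_family_average[where W="\<lambda>_ l. iter z l" and I="{..L}"])
      (use weights z in \<open>auto intro!: policy_family_const iter_policies_unit\<close>)
  from policy_familyD[OF this t measurable_ident_sets[OF refl]] show ?thesis
    by (simp add: policies_def)
qed

lemma gap_le_sampled_gaps:
  assumes z: "seeds_in_unit z"
  shows "gap z \<le> (\<Sum>l\<le>L. weight * (\<Sum>t=1..T. (\<integral>u. sampled_gap t l z u \<partial>unif01) + bias t * mean_dist t l z))"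
proof -
  note pol = iter_policies_unit[OF z]
  let ?A = "\<lambda>l t \<omega>. history_grad (iter z l) t (H t \<omega>) (\<xi> (t + 1) \<omega>) \<bullet> (iter z l t (H t \<omega>) - Xs t (H t \<omega>))"
  have A: "integrable M (?A l t)" if "l \<le> L" "t \<in> {1..T}" for l t
    by (rule integrable_gradient_gap[OF pol that(2)]) (use that in auto)
  have "gap z = (\<integral>\<omega>. policy_cost T f \<xi> (avg z) \<omega> - policy_cost T f \<xi> Xs \<omega> \<partial>M)"
    by (simp add: gap_def GapU_def)
  also have "\<dots> \<le> (\<integral>\<omega>. (\<Sum>l\<le>L. weight * (\<Sum>t=1..T. ?A l t \<omega>)) \<partial>M)"
  proof (rule integral_mono)
    show "integrable M (\<lambda>\<omega>. policy_cost T f \<xi> (avg z) \<omega> - policy_cost T f \<xi> Xs \<omega>)"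
      by (rule integrable_policy_cost_diff[OF avg_policies[OF z] Xs])
    show "integrable M (\<lambda>\<omega>. \<Sum>l\<le>L. weight * (\<Sum>t=1..T. ?A l t \<omega>))"
      by (intro Bochner_Integration.integrable_sum integrable_mult_right A) auto
    fix \<omega> assume \<omega>: "\<omega> \<in> space M"
    have val: "valid_policy (iter z l)" if "l \<le> L" for l
      by (rule policies_valid[OF pol[OF that]])
    have "policy_cost T f \<xi> (avg z) \<omega> \<le> (\<Sum>l\<le>L. weight * policy_cost T f \<xi> (iter z l) \<omega>)"
    proof -
      have "total_cost T f (\<lambda>t. \<Sum>l\<le>L. weight *\<^sub>R induced \<xi> (iter z l) \<omega> t) (\<lambda>t. \<xi> t \<omega>)
          \<le> (\<Sum>l\<le>L. weight * total_cost T f (induced \<xi> (iter z l) \<omega>) (\<lambda>t. \<xi> t \<omega>))"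
        by (rule total_cost_Jensen) (use weights val \<omega> in \<open>auto intro!: X_in_V induced_in_X xi_in\<close>)
      moreover have "induced \<xi> (avg z) \<omega> = (\<lambda>t. \<Sum>l\<le>L. weight *\<^sub>R induced \<xi> (iter z l) \<omega> t)"
        by (simp add: induced_def fun_eq_iff)
      ultimately show ?thesis by (simp add: policy_cost_def)
    qed
    then have "policy_cost T f \<xi> (avg z) \<omega> - policy_cost T f \<xi> Xs \<omega>
        \<le> (\<Sum>l\<le>L. weight * policy_cost T f \<xi> (iter z l) \<omega>) - (\<Sum>l\<le>L. weight) * policy_cost T f \<xi> Xs \<omega>"
      unfolding weights(1) by simp
    also have "\<dots> = (\<Sum>l\<le>L. weight * (policy_cost T f \<xi> (iter z l) \<omega> - policy_cost T f \<xi> Xs \<omega>))"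
      by (simp only: sum_distrib_right sum_subtractf[symmetric] right_diff_distrib)
    also have "\<dots> \<le> (\<Sum>l\<le>L. weight * (\<Sum>t=1..T. ?A l t \<omega>))"
      by (intro sum_mono mult_left_mono cost_gap_le_gradient_gap val \<omega> weights(2)) auto
    finally show "policy_cost T f \<xi> (avg z) \<omega> - policy_cost T f \<xi> Xs \<omega> \<le> (\<Sum>l\<le>L. weight * (\<Sum>t=1..T. ?A l t \<omega>))" .
  qed
  also have "\<dots> = (\<Sum>l\<le>L. \<integral>\<omega>. weight * (\<Sum>t=1..T. ?A l t \<omega>) \<partial>M)"
    by (rule Bochner_Integration.integral_sum)
      (intro Bochner_Integration.integrable_sum integrable_mult_right A, auto)
  also have "\<dots> = (\<Sum>l\<le>L. weight * (\<Sum>t=1..T. \<integral>\<omega>. ?A l t \<omega> \<partial>M))"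
  proof (rule sum.cong[OF refl])
    fix l assume "l \<in> {..L}"
    then have "(\<integral>\<omega>. (\<Sum>t=1..T. ?A l t \<omega>) \<partial>M) = (\<Sum>t=1..T. \<integral>\<omega>. ?A l t \<omega> \<partial>M)"
      by (intro Bochner_Integration.integral_sum A) auto
    then show "(\<integral>\<omega>. weight * (\<Sum>t=1..T. ?A l t \<omega>) \<partial>M) = weight * (\<Sum>t=1..T. \<integral>\<omega>. ?A l t \<omega> \<partial>M)"
      by (simp only: integral_mult_right_zero)
  qed
  also have "\<dots> \<le> (\<Sum>l\<le>L. weight * (\<Sum>t=1..T. (\<integral>u. sampled_gap t l z u \<partial>unif01) + bias t * mean_dist t l z))"
  proof (intro sum_mono mult_left_mono weights(2))
    fix l t assume l: "l \<in> {..L}" and t: "t \<in> {1..T}"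
    have "iter z l t \<in> policies \<Xi> t (\<X> t)" if "t \<in> {1..T}" for t using pol[OF _ that] l by simp
    from expected_bias[OF this t]
    show "(\<integral>\<omega>. ?A l t \<omega> \<partial>M) \<le> (\<integral>u. sampled_gap t l z u \<partial>unif01) + bias t * mean_dist t l z"
      unfolding sampled_gap_def mean_dist_def .
  qed
  finally show ?thesis .
qed

text \<open>
  Cauchy-Schwarz over the stages, for each scenario, against the distance in the product norm.
\<close>

lemma sum_bias_le:
  assumes z: "seeds_in_unit z" and l: "l \<le> L" and b: "0 \<le> b" "b\<^sup>2 = (\<Sum>t=1..T. (bias t)\<^sup>2)"
  shows "(\<Sum>t=1..T. bias t * mean_dist t l z) \<le> b * D"
proof -
  note pol = iter_policies_unit[OF z l]
  let ?n = "\<lambda>t \<omega>. N t (iter z l t (H t \<omega>) - Xs t (H t \<omega>))"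
  have int: "integrable M (\<lambda>\<omega>. bias t * ?n t \<omega>)" if "t \<in> {1..T}" for t
    by (intro integrable_mult_right integrable_distance[OF pol that])
  have "(\<Sum>t=1..T. bias t * mean_dist t l z) = (\<integral>\<omega>. (\<Sum>t=1..T. bias t * ?n t \<omega>) \<partial>M)"
    unfolding mean_dist_def by (subst Bochner_Integration.integral_sum) (use int in auto)
  also have "\<dots> \<le> (\<integral>\<omega>. b * D \<partial>M)"
  proof (rule integral_mono)
    show "integrable M (\<lambda>\<omega>. \<Sum>t=1..T. bias t * ?n t \<omega>)" by (intro Bochner_Integration.integrable_sum int)
    fix \<omega> assume \<omega>: "\<omega> \<in> space M"
    have mem: "iter z l t (H t \<omega>) \<in> \<X> t" "Xs t (H t \<omega>) \<in> \<X> t" if "t \<in> {1..T}" for t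
      using that \<omega> by (auto intro!: valid_policyD[OF policies_valid[OF pol]] valid_policyD[OF Xs_valid] H_in)
    have dist: "(\<Sum>t=1..T. (?n t \<omega>)\<^sup>2) \<le> D\<^sup>2" "0 \<le> D"
      using weighted_distance_le[of "\<lambda>t. iter z l t (H t \<omega>)" "\<lambda>t. Xs t (H t \<omega>)", OF mem] by auto
    have "(\<Sum>t=1..T. bias t * ?n t \<omega>) \<le> (\<Sum>t=1..T. \<bar>bias t\<bar> * \<bar>?n t \<omega>\<bar>)"
      by (intro sum_mono) (metis abs_ge_self abs_mult)
    also have "\<dots> \<le> L2_set bias {1..T} * L2_set (\<lambda>t. ?n t \<omega>) {1..T}" by (rule L2_set_mult_ineq)
    also have "L2_set bias {1..T} = b" unfolding L2_set_def by (rule real_sqrt_unique[OF b(2,1)])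
    also have "b * L2_set (\<lambda>t. ?n t \<omega>) {1..T} \<le> b * D"
      unfolding L2_set_def using b(1) dist by (intro mult_left_mono real_le_lsqrt sum_nonneg) auto
    finally show "(\<Sum>t=1..T. bias t * ?n t \<omega>) \<le> b * D" .
  qed simp
  also have "\<dots> = b * D" using M.prob_space by simp
  finally show ?thesis .
qed

text \<open>
  The regret bound at the random history, summed over the stages and integrated. It holds for every
  realization of the seeds.
\<close>

lemma expected_regret:
  assumes z: "seeds_in_unit z"
    and breg: "integrable M (\<lambda>\<omega>. total_bregman T v gv (induced \<xi> Xs \<omega>) (induced \<xi> X0 \<omega>))"
      "(\<integral>\<omega>. total_bregman T v gv (induced \<xi> Xs \<omega>) (induced \<xi> X0 \<omega>) \<partial>M) \<le> Dt\<^sup>2"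
    and Lt: "Lt\<^sup>2 = (\<Sum>t=1..T. (Lip t)\<^sup>2)"
  shows "c * (\<Sum>l\<le>L. \<Sum>t=1..T. sampled_gap t l z (z t l)) \<le> Dt\<^sup>2 + (real L + 1) * c\<^sup>2 * Lt\<^sup>2 / 2"
proof -
  note pol = iter_policies_unit[OF z]
  let ?B = "\<lambda>l t \<omega>. stoch_grad T V f sam (iter z l) (z t l) t (H t \<omega>) \<bullet> (iter z l t (H t \<omega>) - Xs t (H t \<omega>))"
  let ?D = "\<lambda>\<omega>. total_bregman T v gv (induced \<xi> Xs \<omega>) (induced \<xi> X0 \<omega>)"
  have B: "integrable M (?B l t)" if "l \<le> L" "t \<in> {1..T}" for l t
    by (rule integrable_sampled_gap[OF pol that(2)]) (use that z in \<open>auto simp: seeds_in_unit_def\<close>)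
  have "c * (\<Sum>l\<le>L. \<Sum>t=1..T. sampled_gap t l z (z t l)) = (\<Sum>l\<le>L. \<Sum>t=1..T. \<integral>\<omega>. c * ?B l t \<omega> \<partial>M)"
    by (simp add: sampled_gap_def sum_distrib_left)
  also have "\<dots> = (\<Sum>l\<le>L. \<integral>\<omega>. (\<Sum>t=1..T. c * ?B l t \<omega>) \<partial>M)"
    by (intro sum.cong refl Bochner_Integration.integral_sum[symmetric] integrable_mult_right B) auto
  also have "\<dots> = (\<integral>\<omega>. (\<Sum>l\<le>L. \<Sum>t=1..T. c * ?B l t \<omega>) \<partial>M)"
    by (intro Bochner_Integration.integral_sum[symmetric] Bochner_Integration.integrable_sum integrable_mult_right B) auto
  also have "\<dots> \<le> (\<integral>\<omega>. ?D \<omega> + (real L + 1) * c\<^sup>2 * Lt\<^sup>2 / 2 \<partial>M)"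
  proof (rule integral_mono)
    show "integrable M (\<lambda>\<omega>. \<Sum>l\<le>L. \<Sum>t=1..T. c * ?B l t \<omega>)"
      by (intro Bochner_Integration.integrable_sum integrable_mult_right B) auto
    show "integrable M (\<lambda>\<omega>. ?D \<omega> + (real L + 1) * c\<^sup>2 * Lt\<^sup>2 / 2)" using breg(1) by simp
    fix \<omega> assume \<omega>: "\<omega> \<in> space M"
    have "(\<Sum>l\<le>L. \<Sum>t=1..T. c * ?B l t \<omega>) = (\<Sum>t=1..T. \<Sum>l\<le>L. c * ?B l t \<omega>)" by (rule sum.swap)
    also have "\<dots> \<le> (\<Sum>t=1..T. bregman (v t) (gv t) (Xs t (H t \<omega>)) (X0 t (H t \<omega>)) + (real L + 1) * c\<^sup>2 * (Lip t)\<^sup>2 / 2)"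
    proof (rule sum_mono)
      fix t assume t: "t \<in> {1..T}"
      have "(\<Sum>l<Suc L. c * ?B l t \<omega>)
        \<le> bregman (v t) (gv t) (Xs t (H t \<omega>)) (X0 t (H t \<omega>)) + real (Suc L) * c\<^sup>2 * (Lip t)\<^sup>2 / 2"
        by (rule mirror_descent_regret)
          (use z step c t \<omega> H_in valid_policyD[OF Xs_valid] in \<open>auto simp: seeds_in_unit_def\<close>)
      then show "(\<Sum>l\<le>L. c * ?B l t \<omega>)
        \<le> bregman (v t) (gv t) (Xs t (H t \<omega>)) (X0 t (H t \<omega>)) + (real L + 1) * c\<^sup>2 * (Lip t)\<^sup>2 / 2"
        by (simp add: lessThan_Suc_atMost add.commute)
    qed
    also have "\<dots> = ?D \<omega> + (real L + 1) * c\<^sup>2 * Lt\<^sup>2 / 2"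
      by (simp add: total_bregman_eq_sum induced_def sum.distrib Lt sum_distrib_left sum_divide_distrib)
    finally show "(\<Sum>l\<le>L. \<Sum>t=1..T. c * ?B l t \<omega>) \<le> ?D \<omega> + (real L + 1) * c\<^sup>2 * Lt\<^sup>2 / 2" .
  qed
  also have "\<dots> = (\<integral>\<omega>. ?D \<omega> \<partial>M) + (real L + 1) * c\<^sup>2 * Lt\<^sup>2 / 2"
    using breg(1) M.prob_space by simp
  finally show ?thesis using breg(2) by linarith
qed

abbreviation seed_index :: "(nat \<times> nat) set" where "seed_index \<equiv> {1..T} \<times> {0..L}"

abbreviation seed_space :: "(nat \<times> nat \<Rightarrow> real) measure" where
  "seed_space \<equiv> PiM seed_index (\<lambda>_. unif01)"

lemma prob_seed_space: "prob_space seed_space"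
  by (rule prob_space_PiM) (rule prob_space_unif01)

lemma seed_space_in_unit: "z \<in> space seed_space \<Longrightarrow> seeds_in_unit (curry z)"
  by (auto simp: seeds_in_unit_def space_PiM PiE_iff)

lemma measurable_seed:
  assumes "r \<in> measurable K seed_space" "t \<in> {1..T}" "l \<le> L"
  shows "(\<lambda>k. curry (r k) t l) \<in> measurable K (restrict_space borel {0..1})"
proof -
  have "(\<lambda>z. z (t, l)) \<in> measurable seed_space unif01"
    using assms(2,3) by (intro measurable_component_singleton) auto
  from measurable_compose[OF assms(1) this] show ?thesis by (simp add: measurable_unif01_iff)
qed

lemma policy_family_seeds:
  assumes "r \<in> measurable K seed_space" "l \<le> L"
  shows "policy_family K (\<lambda>k. iter (curry (r k)) l)"
  by (rule policy_family_iter) (rule measurable_seed[OF assms(1)], use assms in auto)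

lemma sampled_gap_bound:
  assumes z: "seeds_in_unit z" and t: "t \<in> {1..T}" and l: "l \<le> L" and u: "u \<in> {0..1}"
  shows "\<bar>sampled_gap t l z u\<bar> \<le> \<bar>Lip t\<bar> * D"
  unfolding sampled_gap_def
proof (rule abs_integral_le[OF prob_M])
  fix \<omega> assume \<omega>: "\<omega> \<in> space M"
  show "\<bar>stoch_grad T V f sam (iter z l) u t (H t \<omega>) \<bullet> (iter z l t (H t \<omega>) - Xs t (H t \<omega>))\<bar> \<le> \<bar>Lip t\<bar> * D"
    unfolding stoch_grad_eq_history_grad
    using t u \<omega> z l by (intro gradient_gap_bound policies_valid iter_policies_unit H_in sample_in) auto
qed

lemma measurable_sampled_gap:
  assumes t: "t \<in> {1..T}" and l: "l \<le> L"
  shows "case_prod (\<lambda>z. sampled_gap t l (curry z)) \<in> borel_measurable (seed_space \<Otimes>\<^sub>M unif01)"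
proof -
  let ?K = "(seed_space \<Otimes>\<^sub>M unif01) \<Otimes>\<^sub>M M"
  have r: "(\<lambda>k. fst (fst k)) \<in> measurable ?K seed_space" by measurable
  have q: "(\<lambda>k. H t (snd k)) \<in> measurable ?K (hist_space \<Xi> t)"
    by (rule measurable_compose[OF measurable_snd measurable_H[OF t]])
  have "(\<lambda>k. snd (fst k)) \<in> measurable ?K unif01" by measurable
  then have u: "(\<lambda>k. snd (fst k)) \<in> measurable ?K (restrict_space borel {0..1})"
    by (simp only: measurable_unif01_iff)
  note fam = policy_family_seeds[OF r l]
  have "(\<lambda>k. stoch_grad T V f sam (iter (curry (fst (fst k))) l) (snd (fst k)) t (H t (snd k))
      \<bullet> (iter (curry (fst (fst k))) l t (H t (snd k)) - Xs t (H t (snd k)))) \<in> borel_measurable ?K"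
    by (intro borel_measurable_inner measurable_stoch_grad[OF fam t q u] measurable_policy_diff[OF fam t q])
  then have "(\<lambda>p. \<integral>\<omega>. stoch_grad T V f sam (iter (curry (fst p)) l) (snd p) t (H t \<omega>)
      \<bullet> (iter (curry (fst p)) l t (H t \<omega>) - Xs t (H t \<omega>)) \<partial>M) \<in> borel_measurable (seed_space \<Otimes>\<^sub>M unif01)"
    by (intro M.borel_measurable_lebesgue_integral) (simp add: case_prod_unfold)
  then show ?thesis by (simp add: sampled_gap_def case_prod_unfold)
qed

lemma measurable_gap: "(\<lambda>z. gap (curry z)) \<in> borel_measurable seed_space"
proof -
  let ?K = "seed_space \<Otimes>\<^sub>M M"
  have fam: "policy_family ?K (\<lambda>k. avg (curry (fst k)))"
    by (rule policy_family_average[where W="\<lambda>k l. iter (curry (fst k)) l" and I="{..L}"])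
      (use weights in \<open>auto intro!: policy_family_seeds\<close>)
  have "(\<lambda>k. policy_cost T f \<xi> (avg (curry (fst k))) (snd k) - policy_cost T f \<xi> Xs (snd k)) \<in> borel_measurable ?K"
    by (intro borel_measurable_diff measurable_policy_cost[OF fam measurable_snd xi]
        measurable_policy_cost[OF policy_family_const[OF Xs] measurable_snd xi])
  then show ?thesis unfolding gap_def GapU_def
    by (intro M.borel_measurable_lebesgue_integral) (simp add: case_prod_unfold)
qed

lemma gap_bound:
  assumes "seeds_in_unit z"
  shows "\<bar>gap z\<bar> \<le> (\<Sum>t=1..T. \<bar>Lip t\<bar> * D)"
  unfolding gap_def GapU_def
  by (intro abs_integral_le prob_M policy_cost_diff_bound policies_valid avg_policies assms Xs_valid)

text \<open>
  The iterate \<open>l\<close> does not read the coordinate \<open>(t, l)\<close> of the seeds.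
\<close>

lemma sampled_gap_fresh_seed:
  assumes t: "t \<in> {1..T}" and l: "l \<le> L"
  shows "(\<integral>z. (\<integral>u. sampled_gap t l (curry z) u \<partial>unif01) \<partial>seed_space)
    = (\<integral>z. sampled_gap t l (curry z) (z (t, l)) \<partial>seed_space)"
proof (rule resample_coordinate[where i="(t, l)" and P="\<lambda>_. unif01"])
  show "prob_space unif01" by (rule prob_space_unif01)
  show "(t, l) \<in> seed_index" using t l by simp
  show "case_prod (\<lambda>z. sampled_gap t l (curry z)) \<in> borel_measurable (seed_space \<Otimes>\<^sub>M unif01)"
    by (rule measurable_sampled_gap[OF t l])
  show "\<bar>sampled_gap t l (curry z) u\<bar> \<le> \<bar>Lip t\<bar> * D" if "z \<in> space seed_space" "u \<in> space unif01" for z u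
    using that t l by (intro sampled_gap_bound seed_space_in_unit) auto
  fix z :: "nat \<times> nat \<Rightarrow> real" and a u
  have "iter (curry (z((t, l) := a))) l j h = iter (curry z) l j h" if "j \<in> {1..T}" for j h
    by (rule iter_depends_on_past[OF _ that]) auto
  then have "stoch_grad T V f sam (iter (curry (z((t, l) := a))) l) u t h = stoch_grad T V f sam (iter (curry z) l) u t h"
    "iter (curry (z((t, l) := a))) l t h = iter (curry z) l t h" for h
    using t pred_in_stages[OF t] by (auto simp: stoch_grad_def Let_def)
  then show "sampled_gap t l (curry (z((t, l) := a))) u = sampled_gap t l (curry z) u"
    by (simp add: sampled_gap_def)
qed auto

lemma integrable_fresh_sampled_gap:
  assumes t: "t \<in> {1..T}" and l: "l \<le> L"
  shows "integrable seed_space (\<lambda>z. sampled_gap t l (curry z) (z (t, l)))"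
    and "integrable seed_space (\<lambda>z. \<integral>u. sampled_gap t l (curry z) u \<partial>unif01)"
proof -
  have sgm: "(\<lambda>p. sampled_gap t l (curry (fst p)) (snd p)) \<in> borel_measurable (seed_space \<Otimes>\<^sub>M unif01)"
    using measurable_sampled_gap[OF t l] by (simp add: case_prod_unfold)
  have "(\<lambda>z. (z, z (t, l))) \<in> measurable seed_space (seed_space \<Otimes>\<^sub>M unif01)"
    using t l by (intro measurable_Pair measurable_component_singleton) auto
  from measurable_compose[OF this sgm]
  have "(\<lambda>z. sampled_gap t l (curry z) (z (t, l))) \<in> borel_measurable seed_space" by simp
  then show "integrable seed_space (\<lambda>z. sampled_gap t l (curry z) (z (t, l)))"
  proof (rule integrable_bounded[OF prob_seed_space])
    fix z assume z: "z \<in> space seed_space"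
    then have "z (t, l) \<in> {0..1}" using t l by (auto simp: space_PiM PiE_iff)
    then show "\<bar>sampled_gap t l (curry z) (z (t, l))\<bar> \<le> \<bar>Lip t\<bar> * D"
      using z t l by (intro sampled_gap_bound seed_space_in_unit) auto
  qed
  interpret U: prob_space unif01 by (rule prob_space_unif01)
  have "(\<lambda>z. \<integral>u. sampled_gap t l (curry z) u \<partial>unif01) \<in> borel_measurable seed_space"
    by (rule U.borel_measurable_lebesgue_integral[OF measurable_sampled_gap[OF t l]])
  then show "integrable seed_space (\<lambda>z. \<integral>u. sampled_gap t l (curry z) u \<partial>unif01)"
  proof (rule integrable_bounded[OF prob_seed_space])
    fix z assume "z \<in> space seed_space"
    then show "\<bar>\<integral>u. sampled_gap t l (curry z) u \<partial>unif01\<bar> \<le> \<bar>Lip t\<bar> * D"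
      using t l by (intro abs_integral_le prob_space_unif01 sampled_gap_bound seed_space_in_unit) auto
  qed
qed

text \<open>
  All estimates in order: the gap is bounded by linearized gaps with a fresh sampling variable plus the
  bias, the fresh variable is replaced by the seed of the algorithm under the expectation, and then the
  regret bound applies for each realization of the seeds.
\<close>

lemma expected_gap_seed_space:
  assumes b: "0 \<le> b" "b\<^sup>2 = (\<Sum>t=1..T. (bias t)\<^sup>2)"
    and breg: "integrable M (\<lambda>\<omega>. total_bregman T v gv (induced \<xi> Xs \<omega>) (induced \<xi> X0 \<omega>))"
      "(\<integral>\<omega>. total_bregman T v gv (induced \<xi> Xs \<omega>) (induced \<xi> X0 \<omega>) \<partial>M) \<le> Dt\<^sup>2"
    and Lt: "Lt\<^sup>2 = (\<Sum>t=1..T. (Lip t)\<^sup>2)"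
  shows "integrable seed_space (\<lambda>z. gap (curry z))"
    and "(\<integral>z. gap (curry z) \<partial>seed_space)
      \<le> (Dt\<^sup>2 + (real L + 1) * c\<^sup>2 * Lt\<^sup>2 / 2) / ((real L + 1) * c) + b * D"
proof -
  interpret Z: prob_space seed_space by (rule prob_seed_space)
  show gap_int: "integrable seed_space (\<lambda>z. gap (curry z))"
    by (rule integrable_bounded[OF prob_seed_space measurable_gap gap_bound[OF seed_space_in_unit]])
  let ?S = "\<lambda>l t z. \<integral>u. sampled_gap t l (curry z) u \<partial>unif01"
  let ?F = "\<lambda>l t z. sampled_gap t l (curry z) (z (t, l))"
  have S: "integrable seed_space (?S l t)" and F: "integrable seed_space (?F l t)"
    and SF: "(\<integral>z. ?S l t z \<partial>seed_space) = (\<integral>z. ?F l t z \<partial>seed_space)"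
    if "l \<in> {..L}" "t \<in> {1..T}" for l t
    using that integrable_fresh_sampled_gap[of t l] sampled_gap_fresh_seed[of t l] by auto
  have "(\<integral>z. gap (curry z) \<partial>seed_space) \<le> (\<integral>z. weight * (\<Sum>l\<le>L. \<Sum>t=1..T. ?S l t z) + b * D \<partial>seed_space)"
  proof (rule integral_mono[OF gap_int])
    show "integrable seed_space (\<lambda>z. weight * (\<Sum>l\<le>L. \<Sum>t=1..T. ?S l t z) + b * D)"
      by (intro Bochner_Integration.integrable_add integrable_mult_right Bochner_Integration.integrable_sum S
          Z.integrable_const)
    fix z assume "z \<in> space seed_space"
    then have z: "seeds_in_unit (curry z)" by (rule seed_space_in_unit)
    have "gap (curry z) \<le> (\<Sum>l\<le>L. weight * ((\<Sum>t=1..T. ?S l t z) + (\<Sum>t=1..T. bias t * mean_dist t l (curry z))))"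
      using gap_le_sampled_gaps[OF z] by (simp add: sum.distrib)
    also have "\<dots> \<le> (\<Sum>l\<le>L. weight * ((\<Sum>t=1..T. ?S l t z) + b * D))"
      by (intro sum_mono mult_left_mono add_left_mono sum_bias_le[OF z _ b] weights(2)) auto
    also have "\<dots> = weight * (\<Sum>l\<le>L. \<Sum>t=1..T. ?S l t z) + (\<Sum>l\<le>L. weight) * (b * D)"
      by (simp only: distrib_left sum.distrib sum_distrib_left sum_distrib_right)
    finally show "gap (curry z) \<le> weight * (\<Sum>l\<le>L. \<Sum>t=1..T. ?S l t z) + b * D"
      unfolding weights(1) by simp
  qed
  also have "\<dots> = weight * (\<integral>z. (\<Sum>l\<le>L. \<Sum>t=1..T. ?S l t z) \<partial>seed_space) + b * D"
  proof -
    have "integrable seed_space (\<lambda>z. weight * (\<Sum>l\<le>L. \<Sum>t=1..T. ?S l t z))"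
      by (intro integrable_mult_right Bochner_Integration.integrable_sum S)
    moreover have "(\<integral>z. b * D \<partial>seed_space) = b * D" using Z.prob_space by simp
    ultimately show ?thesis
      using Bochner_Integration.integral_add[OF _ Z.integrable_const, of _ "b * D"]
      by (simp only: integral_mult_right_zero)
  qed
  also have "(\<integral>z. (\<Sum>l\<le>L. \<Sum>t=1..T. ?S l t z) \<partial>seed_space) = (\<Sum>l\<le>L. \<Sum>t=1..T. \<integral>z. ?S l t z \<partial>seed_space)"
    by (subst Bochner_Integration.integral_sum; intro sum.cong refl Bochner_Integration.integrable_sum
        Bochner_Integration.integral_sum S)
  also have "\<dots> = (\<Sum>l\<le>L. \<Sum>t=1..T. \<integral>z. ?F l t z \<partial>seed_space)"
    by (intro sum.cong refl SF)
  also have "\<dots> = (\<integral>z. (\<Sum>l\<le>L. \<Sum>t=1..T. ?F l t z) \<partial>seed_space)"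
    by (subst Bochner_Integration.integral_sum; intro sum.cong refl Bochner_Integration.integrable_sum
        Bochner_Integration.integral_sum[symmetric] F)
  also have "weight * (\<integral>z. (\<Sum>l\<le>L. \<Sum>t=1..T. ?F l t z) \<partial>seed_space) + b * D
      \<le> weight * (\<integral>z. (Dt\<^sup>2 + (real L + 1) * c\<^sup>2 * Lt\<^sup>2 / 2) / c \<partial>seed_space) + b * D"
  proof (intro add_right_mono mult_left_mono integral_mono weights(2) Bochner_Integration.integrable_sum F)
    fix z assume "z \<in> space seed_space"
    from expected_regret[OF seed_space_in_unit[OF this] breg Lt]
    have "c * (\<Sum>l\<le>L. \<Sum>t=1..T. ?F l t z) \<le> Dt\<^sup>2 + (real L + 1) * c\<^sup>2 * Lt\<^sup>2 / 2"
      by simp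
    then show "(\<Sum>l\<le>L. \<Sum>t=1..T. ?F l t z) \<le> (Dt\<^sup>2 + (real L + 1) * c\<^sup>2 * Lt\<^sup>2 / 2) / c"
      using c by (simp add: pos_le_divide_eq mult.commute)
  qed (assumption | rule Z.integrable_const)+
  also have "weight * (\<integral>z. (Dt\<^sup>2 + (real L + 1) * c\<^sup>2 * Lt\<^sup>2 / 2) / c \<partial>seed_space)
      = (Dt\<^sup>2 + (real L + 1) * c\<^sup>2 * Lt\<^sup>2 / 2) / ((real L + 1) * c)"
    using Z.prob_space by simp
  finally show "(\<integral>z. gap (curry z) \<partial>seed_space)
      \<le> (Dt\<^sup>2 + (real L + 1) * c\<^sup>2 * Lt\<^sup>2 / 2) / ((real L + 1) * c) + b * D" .
qed

lemma GapU_md_output: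
  assumes "\<And>t l. t \<in> {1..T} \<Longrightarrow> l \<le> L \<Longrightarrow> z t l = z' t l"
  shows "GapU M T f \<xi> Xs (md_output T V f \<X> v gv sam \<gamma> X0 z L) = gap z'"
  unfolding gap_def
proof (rule GapU_cong[OF T])
  fix t h assume t: "t \<in> {1..T}"
  have "iter z l t h = iter z' l t h" if "l \<le> L" for l
    using assms that by (intro iter_depends_on_past t) auto
  then show "md_output T V f \<X> v gv sam \<gamma> X0 z L t h = avg z' t h"
    by (simp add: md_output_eq_avg)
qed

lemma integrable_md_output_gap:
  assumes "seeds_in_unit z"
  shows "integrable M (\<lambda>\<omega>. policy_cost T f \<xi> (md_output T V f \<X> v gv sam \<gamma> X0 z L) \<omega> - policy_cost T f \<xi> Xs \<omega>)"
proof -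
  have "md_output T V f \<X> v gv sam \<gamma> X0 z L = avg z" by (simp add: fun_eq_iff md_output_eq_avg)
  then show ?thesis using integrable_policy_cost_diff[OF avg_policies[OF assms] Xs] by simp
qed

text \<open>
  Independent uniform seeds have the product law, and the gap of the output reads no other seeds.
\<close>

lemma expected_gap_seeds:
  assumes Mi: "prob_space Mi" and seeds: "iid_seeds Mi T L \<zeta>"
    and gap: "integrable seed_space (\<lambda>z. gap (curry z))"
  shows "integrable Mi (\<lambda>\<omega>. GapU M T f \<xi> Xs (md_output T V f \<X> v gv sam \<gamma> X0 (\<lambda>t l. \<zeta> t l \<omega>) L))"
    and "(\<integral>\<omega>. GapU M T f \<xi> Xs (md_output T V f \<X> v gv sam \<gamma> X0 (\<lambda>t l. \<zeta> t l \<omega>) L) \<partial>Mi)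
      = (\<integral>z. gap (curry z) \<partial>seed_space)"
    and "\<And>\<omega>. \<omega> \<in> space Mi \<Longrightarrow> seeds_in_unit (\<lambda>t l. \<zeta> t l \<omega>)"
proof -
  interpret Mi: prob_space Mi by fact
  let ?r = "\<lambda>\<omega>. \<lambda>(t, l)\<in>seed_index. \<zeta> t l \<omega>"
  have \<zeta>: "\<zeta> t l \<in> measurable Mi unif01" if "t \<in> {1..T}" "l \<le> L" for t l
    using seeds that unfolding iid_seeds_def Mi.indep_vars_def by auto
  have r: "?r \<in> measurable Mi seed_space"
    by (rule measurable_restrict) (use \<zeta> in auto)
  have eq: "GapU M T f \<xi> Xs (md_output T V f \<X> v gv sam \<gamma> X0 (\<lambda>t l. \<zeta> t l \<omega>) L) = gap (curry (?r \<omega>))" for \<omega>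
    by (rule GapU_md_output) auto
  note distr = distr_iid_seeds[OF Mi seeds T]
  show "integrable Mi (\<lambda>\<omega>. GapU M T f \<xi> Xs (md_output T V f \<X> v gv sam \<gamma> X0 (\<lambda>t l. \<zeta> t l \<omega>) L))"
    unfolding eq using gap integrable_distr[OF r, of "\<lambda>z. gap (curry z)"] unfolding distr by simp
  show "(\<integral>\<omega>. GapU M T f \<xi> Xs (md_output T V f \<X> v gv sam \<gamma> X0 (\<lambda>t l. \<zeta> t l \<omega>) L) \<partial>Mi)
      = (\<integral>z. gap (curry z) \<partial>seed_space)"
    unfolding eq using integral_distr[OF r measurable_gap] unfolding distr by simp
  show "seeds_in_unit (\<lambda>t l. \<zeta> t l \<omega>)" if "\<omega> \<in> space Mi" for \<omega>
    unfolding seeds_in_unit_def using measurable_space[OF \<zeta> that] by simp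
qed

end

section \<open>The convergence bound\<close>

theorem theorem4p1:
  fixes M :: "'w measure" and Mi :: "'i measure"
    and T L :: nat
    and V :: "nat \<Rightarrow> 'a::euclidean_space set"
    and \<Xi> :: "nat \<Rightarrow> 'b::euclidean_space set"
    and \<xi> :: "nat \<Rightarrow> 'w \<Rightarrow> 'b"
    and f :: "nat \<Rightarrow> 'a \<Rightarrow> 'a \<Rightarrow> 'b \<Rightarrow> real"
    and \<X> :: "nat \<Rightarrow> 'a set"
    and Xs X0 :: "nat \<Rightarrow> (nat \<Rightarrow> 'b) \<Rightarrow> 'a"
    and N :: "nat \<Rightarrow> 'a \<Rightarrow> real"
    and v :: "nat \<Rightarrow> 'a \<Rightarrow> real" and gv :: "nat \<Rightarrow> 'a \<Rightarrow> 'a"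
    and \<kappa> :: "nat \<Rightarrow> (nat \<Rightarrow> 'b) \<Rightarrow> 'b measure"
    and sam :: "nat \<Rightarrow> (nat \<Rightarrow> 'b) \<Rightarrow> real \<Rightarrow> 'b"
    and \<zeta> :: "nat \<Rightarrow> nat \<Rightarrow> 'i \<Rightarrow> real"
    and \<beta> Lip bt \<gamma> :: "nat \<Rightarrow> real"
    and D Dt Lt b :: real
  assumes prob_M: "prob_space M" and prob_Mi: "prob_space Mi"
    and T: "1 \<le> T"
    and xi: "\<And>t. t \<in> {1..T} \<Longrightarrow> \<xi> t \<in> measurable M (restrict_space borel (\<Xi> t))"
    and Xi1: "\<exists>c. \<Xi> 1 = {c}"
    and V0: "V 0 = {0}"
    and V: "\<And>t. t \<in> {1..T} \<Longrightarrow> coord_subspace (V t)"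
    and f: "\<And>t. t \<in> {1..T} \<Longrightarrow> stage_cost V \<Xi> f t"
    and X: "\<And>t. t \<in> {1..T} \<Longrightarrow> \<X> t \<subseteq> V t \<and> \<X> t \<noteq> {} \<and> compact (\<X> t) \<and> convex (\<X> t)"
    and sol: "is_solution M T f \<Xi> \<xi> \<X> Xs"
    and norms: "\<And>t. t \<in> {1..T} \<Longrightarrow> is_norm_on (V t) (N t)"
    and dgf: "\<And>t. t \<in> {1..T} \<Longrightarrow> is_dgf (V t) (N t) (\<X> t) (v t) (gv t)"
    and dgf_meas: "\<And>t X. t \<in> {1..T} \<Longrightarrow> X \<in> policies \<Xi> t (dgf_dom (V t) (\<X> t) (v t)) \<Longrightarrow>
           (\<lambda>h. gv t (X h)) \<in> borel_measurable (hist_space \<Xi> t)"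
    and kernel: "\<And>t. t \<in> {2..T} \<Longrightarrow> cond_law M \<Xi> \<xi> t (\<kappa> t)"
    and sampler: "\<And>t. t \<in> {2..T} \<Longrightarrow> biased_sampler \<Xi> t (\<kappa> t) (\<beta> t) (sam t)"
    and seeds: "iid_seeds Mi T L \<zeta>"
    and initial: "\<And>t. t \<in> {1..T} \<Longrightarrow> X0 t \<in> policies \<Xi> t (dgf_dom (V t) (\<X> t) (v t))"
    and oracle_meas: "\<And>t l \<omega>. t \<in> {1..T} \<Longrightarrow> l \<le> L \<Longrightarrow> \<omega> \<in> space Mi \<Longrightarrow>
           stoch_grad T V f sam (md_iter T V f \<X> v gv sam \<gamma> X0 (\<lambda>t l. \<zeta> t l \<omega>) l) (\<zeta> t l \<omega>) t
             \<in> borel_measurable (hist_space \<Xi> t)"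
    and lip: "\<And>t x s. t \<in> {1..T} \<Longrightarrow> x \<in> PiE {1..T} \<X> \<Longrightarrow> s \<in> PiE {1..T} \<Xi> \<Longrightarrow>
           dual_norm (V t) (N t) (grad_total T V f t x s) \<le> Lip t"
    and breg: "integrable M (\<lambda>\<omega>. total_bregman T v gv (induced \<xi> Xs \<omega>) (induced \<xi> X0 \<omega>))"
      "(\<integral>\<omega>. total_bregman T v gv (induced \<xi> Xs \<omega>) (induced \<xi> X0 \<omega>) \<partial>M) \<le> Dt\<^sup>2"
    and diam: "\<And>x x'. x \<in> PiE {1..T} \<X> \<Longrightarrow> x' \<in> PiE {1..T} \<X> \<Longrightarrow> total_norm T N (\<lambda>t. x t - x' t) \<le> D"
    and bt: "\<And>t. t \<in> {1..T} \<Longrightarrow> bt t = (if t \<le> T - 1 then 2 * \<beta> (t + 1) * Lip t else 0)"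
    and b: "0 \<le> b" "b\<^sup>2 = (\<Sum>t=1..T. (bt t)\<^sup>2)"
    and Lt: "0 < Lt" "Lt\<^sup>2 = (\<Sum>t=1..T. (Lip t)\<^sup>2)"
    and Dt: "0 < Dt"
    and step: "\<And>l. l \<le> L \<Longrightarrow> \<gamma> l = sqrt 2 * (Dt / Lt) / sqrt (real L + 1)"
  shows "(\<forall>\<omega>i\<in>space Mi. integrable M (\<lambda>\<omega>.
            policy_cost T f \<xi> (md_output T V f \<X> v gv sam \<gamma> X0 (\<lambda>t l. \<zeta> t l \<omega>i) L) \<omega> - policy_cost T f \<xi> Xs \<omega>))
    \<and> integrable Mi (\<lambda>\<omega>i. GapU M T f \<xi> Xs (md_output T V f \<X> v gv sam \<gamma> X0 (\<lambda>t l. \<zeta> t l \<omega>i) L))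
    \<and> (\<integral>\<omega>i. GapU M T f \<xi> Xs (md_output T V f \<X> v gv sam \<gamma> X0 (\<lambda>t l. \<zeta> t l \<omega>i) L) \<partial>Mi)
        \<le> sqrt 2 * Dt * Lt / sqrt (real L + 1) + b * D"
proof -
  interpret M: prob_space M by (rule prob_M)
  define c where "c = sqrt 2 * (Dt / Lt) / sqrt (real L + 1)"
  have c: "0 < c" unfolding c_def using Dt Lt(1) by simp
  interpret constant_step_program T V \<Xi> f \<X> N Lip D v gv sam X0 \<gamma> M \<xi> \<kappa> \<beta> Xs L c
  proof unfold_locales
    fix t assume t: "t \<in> {1..T}"
    obtain \<omega> where "\<omega> \<in> space M" using M.not_empty by blast
    from measurable_space[OF xi[OF t] this] show "\<Xi> t \<noteq> {}" by (auto simp: space_restrict_space)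
    show "Xs t \<in> policies \<Xi> t (\<X> t)" using sol t unfolding is_solution_def feasible_def by blast
    show "\<X> t \<subseteq> V t \<and> \<X> t \<noteq> {} \<and> compact (\<X> t) \<and> convex (\<X> t)" by (rule X[OF t])
  next
    fix t assume "t \<in> {1..T}" "t < T"
    then have "t + 1 \<in> {2..T}" by auto
    from sampler[OF this]
    show "(\<lambda>(h, u). sam (t + 1) h u)
        \<in> measurable (hist_space \<Xi> t \<Otimes>\<^sub>M restrict_space borel {0..1}) (restrict_space borel (\<Xi> (t + 1)))"
      unfolding biased_sampler_def by simp
  next
    show "\<gamma> l = c" if "l \<le> L" for l using step[OF that] by (simp add: c_def)
  qed (fact T V0 V f norms lip diam dgf initial xi kernel sampler c)+
  have b_eq: "b\<^sup>2 = (\<Sum>t=1..T. (bias t)\<^sup>2)"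
    unfolding b(2) by (intro sum.cong refl) (use bt in auto)
  have step_value: "(Dt\<^sup>2 + (real L + 1) * c\<^sup>2 * Lt\<^sup>2 / 2) / ((real L + 1) * c) = sqrt 2 * Dt * Lt / sqrt (real L + 1)"
  proof -
    define s where "s = sqrt (real L + 1)"
    have s: "0 < s" "real L + 1 = s\<^sup>2" by (auto simp: s_def)
    have cs: "c = sqrt 2 * Dt / (Lt * s)" by (simp add: c_def s_def)
    have "(real L + 1) * c\<^sup>2 * Lt\<^sup>2 / 2 = Dt\<^sup>2"
      using s(1) Lt(1) by (simp add: cs s(2) power_divide power_mult_distrib)
    moreover have "(real L + 1) * c = sqrt 2 * Dt * s / Lt"
      using s(1) by (simp add: cs s(2) power2_eq_square)
    ultimately have "(Dt\<^sup>2 + (real L + 1) * c\<^sup>2 * Lt\<^sup>2 / 2) / ((real L + 1) * c) = 2 * Dt\<^sup>2 / (sqrt 2 * Dt * s / Lt)"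
      by simp
    also have "\<dots> = (sqrt 2)\<^sup>2 * Dt\<^sup>2 * Lt / (sqrt 2 * Dt * s)" by simp
    also have "\<dots> = (sqrt 2 * Dt) * (sqrt 2 * Dt * Lt) / ((sqrt 2 * Dt) * s)"
      by (simp only: power2_eq_square mult_ac)
    also have "\<dots> = sqrt 2 * Dt * Lt / s" by (rule mult_divide_mult_cancel_left) (use Dt in simp)
    finally show ?thesis by (simp add: s_def)
  qed
  note gap = expected_gap_seed_space[OF b(1) b_eq breg Lt(2)]
  note seeded = expected_gap_seeds[OF prob_Mi seeds gap(1)]
  show ?thesis
    using integrable_md_output_gap[OF seeded(3)] seeded(1) gap(2) unfolding seeded(2) step_value by blast
qed

end
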